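(* Let $x: M^n \to E^{n+1}$ be an isometric immersion of an $n$-dimensional Riemannian manifold $(M^n,g)$ as a hypersurface of the Euclidean space $E^{n+1}$. Suppose that $M^n$ is a biharmonic hypersurface and that its Ricci operator is recurrent, i.e. there exists a $1$-form $\eta$ on $M^n$ such that $(\nabla_X \mathrm{Ric})Y=\eta(X)\,\mathrm{Ric}(Y)$ for all $X,Y$ tangent to $M^n$. Then $M^n$ is a minimal hypersurface.
   Context: $\nabla$ is the Levi-Civita connection of $(M^n,g)$. Let $N$ be a local unit normal field, $A$ the shape (Weingarten) operator, and $\overrightarrow{H}=HN$ the mean curvature vector field, where $nH=\mathrm{trace}\,A$. The Laplacian is $\Delta=-\mathrm{trace}\,\nabla^2$, so that $\Delta x=-n\overrightarrow{H}$ (applied componentwise to $E^{n+1}$-valued functions). The hypersurface is biharmonic if $\Delta \overrightarrow{H}=0$; equivalently, $\Delta^{\perp}H+H\,\mathrm{trace}A^2=0$ and $2A(\mathrm{grad}\,H)+nH\,\mathrm{grad}\,H=0$, where $\Delta^{\perp}$ is the Laplacian in the normal bundle. Minimal means $H\equiv 0$. $\mathrm{Ric}$ denotes the Ricci operator, i.e. the $(1,1)$-tensor field metrically equivalent to the Ricci tensor of $(M^n,g)$. *)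

theory Defs
  imports "HOL-Analysis.Analysis"
begin

section \<open>Smooth maps between Euclidean spaces\<close>

definition partial_deriv :: "'n::finite \<Rightarrow> (real^'n \<Rightarrow> 'b::real_normed_vector) \<Rightarrow> real^'n \<Rightarrow> 'b"
  where "partial_deriv i f z = frechet_derivative f (at z) (axis i 1)"

primrec Ck_on :: "nat \<Rightarrow> (real^'n::finite \<Rightarrow> 'b::real_normed_vector) \<Rightarrow> (real^'n) set \<Rightarrow> bool"
  where
    "Ck_on 0 f S \<longleftrightarrow> continuous_on S f"
  | "Ck_on (Suc k) f S \<longleftrightarrow>
       (\<forall>z\<in>S. f differentiable (at z)) \<and> (\<forall>i. Ck_on k (partial_deriv i f) S)"

text \<open>Only used for open \<open>S\<close>, where it is the usual notion of a \<open>C\<^sup>\<infinity>\<close> map.\<close>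

definition smooth_on :: "(real^'n::finite \<Rightarrow> 'b::real_normed_vector) \<Rightarrow> (real^'n) set \<Rightarrow> bool"
  where "smooth_on f S \<longleftrightarrow> (\<forall>k. Ck_on k f S)"

section \<open>Smooth manifolds\<close>

text \<open>A chart \<open>(U, \<phi>)\<close> consists of its domain and its coordinate map; the values of \<open>\<phi>\<close>
  outside \<open>U\<close> are irrelevant.\<close>

type_synonym ('a, 'n) chart = "'a set \<times> ('a \<Rightarrow> real^'n)"

abbreviation chart_dom :: "('a, 'n) chart \<Rightarrow> 'a set"
  where "chart_dom \<equiv> fst"

abbreviation coords :: "('a, 'n) chart \<Rightarrow> 'a \<Rightarrow> real^'n"
  where "coords \<equiv> snd"

abbreviation chart_img :: "('a, 'n) chart \<Rightarrow> (real^'n) set"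
  where "chart_img c \<equiv> coords c ` chart_dom c"

definition chart_point :: "('a, 'n) chart \<Rightarrow> real^'n \<Rightarrow> 'a"
  where "chart_point c = inv_into (chart_dom c) (coords c)"

definition in_chart :: "('a, 'n) chart \<Rightarrow> ('a \<Rightarrow> 'b) \<Rightarrow> real^'n \<Rightarrow> 'b"
  where "in_chart c f = (\<lambda>z. f (chart_point c z))"

definition is_chart :: "'a topology \<Rightarrow> ('a, 'n::finite) chart \<Rightarrow> bool"
  where "is_chart M c \<longleftrightarrow>
    openin M (chart_dom c) \<and> open (chart_img c) \<and>
    homeomorphic_map (subtopology M (chart_dom c)) (top_of_set (chart_img c)) (coords c)"

definition smooth_manifold :: "'a topology \<Rightarrow> ('a, 'n::finite) chart set \<Rightarrow> bool"
  where "smooth_manifold M \<A> \<longleftrightarrow>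
    Hausdorff_space M \<and> second_countable M \<and>
    (\<forall>c\<in>\<A>. is_chart M c) \<and> topspace M = (\<Union>c\<in>\<A>. chart_dom c) \<and>
    (\<forall>c\<in>\<A>. \<forall>d\<in>\<A>. smooth_on (in_chart c (coords d)) (coords c ` (chart_dom c \<inter> chart_dom d)))"

text \<open>Jacobian matrix at \<open>p\<close> of the change of coordinates from \<open>c\<close> to \<open>d\<close>.\<close>

definition transition_jacobian ::
    "('a, 'n::finite) chart \<Rightarrow> ('a, 'n) chart \<Rightarrow> 'a \<Rightarrow> real^'n^'n"
  where "transition_jacobian c d p =
    matrix (frechet_derivative (in_chart c (coords d)) (at (coords c p)))"

text \<open>Tensor fields on the manifold are given by their components in the charts of the atlas,
  related by the usual transformation law.  A 1-form \<open>\<eta>\<close> maps the tangent vector with components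
  \<open>u\<close> in the chart \<open>c\<close> at \<open>p\<close> to \<open>\<eta> c p \<bullet> u\<close>; a metric \<open>g\<close> maps the tangent vectors with
  components \<open>u\<close>, \<open>v\<close> to \<open>u \<bullet> (g c p *v v)\<close>.\<close>

definition one_form ::
    "('a, 'n::finite) chart set \<Rightarrow> (('a, 'n) chart \<Rightarrow> 'a \<Rightarrow> real^'n) \<Rightarrow> bool"
  where "one_form \<A> \<eta> \<longleftrightarrow>
    (\<forall>c\<in>\<A>. smooth_on (in_chart c (\<eta> c)) (chart_img c)) \<and>
    (\<forall>c\<in>\<A>. \<forall>d\<in>\<A>. \<forall>p \<in> chart_dom c \<inter> chart_dom d.
       \<eta> c p = transpose (transition_jacobian c d p) *v \<eta> d p)"

definition riemannian_metric ::
    "('a, 'n::finite) chart set \<Rightarrow> (('a, 'n) chart \<Rightarrow> 'a \<Rightarrow> real^'n^'n) \<Rightarrow> bool"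
  where "riemannian_metric \<A> g \<longleftrightarrow>
    (\<forall>c\<in>\<A>. smooth_on (in_chart c (g c)) (chart_img c) \<and>
       (\<forall>p\<in>chart_dom c. transpose (g c p) = g c p \<and> (\<forall>v. v \<noteq> 0 \<longrightarrow> v \<bullet> (g c p *v v) > 0))) \<and>
    (\<forall>c\<in>\<A>. \<forall>d\<in>\<A>. \<forall>p \<in> chart_dom c \<inter> chart_dom d.
       g c p = transpose (transition_jacobian c d p) ** g d p ** transition_jacobian c d p)"

section \<open>Riemannian geometry in a coordinate domain\<close>

text \<open>Here \<open>G\<close> is the matrix of the metric as a function of the coordinates, and vector fields are
  functions \<open>real^'n \<Rightarrow> real^'n\<close>.  The covariant derivative is that of the Levi-Civita connection,
  \<open>\<nabla>\<^sub>X Y = DY(X) + \<Gamma>(X, Y)\<close>.\<close>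

definition christoffel ::
    "(real^'n \<Rightarrow> real^'n^'n) \<Rightarrow> 'n::finite \<Rightarrow> 'n \<Rightarrow> 'n \<Rightarrow> real^'n \<Rightarrow> real"
  where "christoffel G k i j z =
    (\<Sum>l\<in>UNIV. matrix_inv (G z) $ k $ l *
       (partial_deriv i (\<lambda>w. G w $ j $ l) z + partial_deriv j (\<lambda>w. G w $ i $ l) z
        - partial_deriv l (\<lambda>w. G w $ i $ j) z)) / 2"

definition cov_deriv ::
    "(real^'n \<Rightarrow> real^'n^'n) \<Rightarrow> (real^'n::finite \<Rightarrow> real^'n) \<Rightarrow> (real^'n \<Rightarrow> real^'n) \<Rightarrow> real^'n \<Rightarrow> real^'n"
  where "cov_deriv G X Y z =
    frechet_derivative Y (at z) (X z) +
    (\<chi> k. \<Sum>i\<in>UNIV. \<Sum>j\<in>UNIV. christoffel G k i j z * X z $ i * Y z $ j)"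

definition lie_bracket ::
    "(real^'n::finite \<Rightarrow> real^'n) \<Rightarrow> (real^'n \<Rightarrow> real^'n) \<Rightarrow> real^'n \<Rightarrow> real^'n"
  where "lie_bracket X Y z =
    frechet_derivative Y (at z) (X z) - frechet_derivative X (at z) (Y z)"

definition curvature ::
    "(real^'n \<Rightarrow> real^'n^'n) \<Rightarrow> (real^'n::finite \<Rightarrow> real^'n) \<Rightarrow> (real^'n \<Rightarrow> real^'n) \<Rightarrow> (real^'n \<Rightarrow> real^'n)
      \<Rightarrow> real^'n \<Rightarrow> real^'n"
  where "curvature G X Y Z z =
    cov_deriv G X (cov_deriv G Y Z) z - cov_deriv G Y (cov_deriv G X Z) z
    - cov_deriv G (lie_bracket X Y) Z z"

text \<open>\<open>Ric(u, v)\<close> is the trace of \<open>w \<mapsto> R(w, u) v\<close>; the curvature is tensorial, so tangent vectors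
  may be extended as constant coordinate vector fields.\<close>

definition ricci_tensor ::
    "(real^'n \<Rightarrow> real^'n^'n) \<Rightarrow> real^'n::finite \<Rightarrow> real^'n \<Rightarrow> real^'n \<Rightarrow> real"
  where "ricci_tensor G z u v =
    (\<Sum>i\<in>UNIV. curvature G (\<lambda>_. axis i 1) (\<lambda>_. u) (\<lambda>_. v) z $ i)"

text \<open>The matrix \<open>Q\<close> with \<open>g(Q u, v) = Ric(u, v)\<close>.\<close>

definition ricci_op :: "(real^'n \<Rightarrow> real^'n^'n) \<Rightarrow> real^'n::finite \<Rightarrow> real^'n^'n"
  where "ricci_op G z =
    matrix_inv (G z) ** (\<chi> k j. ricci_tensor G z (axis j 1) (axis k 1))"

definition cov_deriv_endo ::
    "(real^'n \<Rightarrow> real^'n^'n) \<Rightarrow> (real^'n \<Rightarrow> real^'n^'n) \<Rightarrow> (real^'n::finite \<Rightarrow> real^'n)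
      \<Rightarrow> (real^'n \<Rightarrow> real^'n) \<Rightarrow> real^'n \<Rightarrow> real^'n"
  where "cov_deriv_endo G Q X Y z =
    cov_deriv G X (\<lambda>w. Q w *v Y w) z - Q z *v cov_deriv G X Y z"

definition hessian ::
    "(real^'n \<Rightarrow> real^'n^'n) \<Rightarrow> (real^'n::finite \<Rightarrow> 'b::real_normed_vector)
      \<Rightarrow> (real^'n \<Rightarrow> real^'n) \<Rightarrow> (real^'n \<Rightarrow> real^'n) \<Rightarrow> real^'n \<Rightarrow> 'b"
  where "hessian G f X Y z =
    frechet_derivative (\<lambda>w. frechet_derivative f (at w) (Y w)) (at z) (X z)
    - frechet_derivative f (at z) (cov_deriv G X Y z)"

text \<open>Sign convention: \<open>\<Delta> = - trace \<nabla>\<^sup>2\<close>.\<close>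

definition laplacian ::
    "(real^'n \<Rightarrow> real^'n^'n) \<Rightarrow> (real^'n::finite \<Rightarrow> 'b::real_normed_vector) \<Rightarrow> real^'n \<Rightarrow> 'b"
  where "laplacian G f z =
    - (\<Sum>i\<in>UNIV. \<Sum>j\<in>UNIV. matrix_inv (G z) $ i $ j *\<^sub>R
         hessian G f (\<lambda>_. axis i 1) (\<lambda>_. axis j 1) z)"

section \<open>Hypersurfaces\<close>

text \<open>For an immersion \<open>f\<close> of a coordinate domain with unit normal field \<open>\<nu>\<close>, the shape operator \<open>A\<close>
  is given by the Weingarten formula \<open>d\<nu>(v) = - df(A v)\<close>.\<close>

definition shape_op ::
    "(real^'n::finite \<Rightarrow> real^'m) \<Rightarrow> (real^'n \<Rightarrow> real^'m::finite) \<Rightarrow> real^'n \<Rightarrow> real^'n^'n"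
  where "shape_op f \<nu> z =
    (THE A. \<forall>v. frechet_derivative \<nu> (at z) v = - frechet_derivative f (at z) (A *v v))"

definition mean_curvature ::
    "(real^'n::finite \<Rightarrow> real^'m) \<Rightarrow> (real^'n \<Rightarrow> real^'m::finite) \<Rightarrow> real^'n \<Rightarrow> real"
  where "mean_curvature f \<nu> z = trace (shape_op f \<nu> z) / of_nat CARD('n)"

definition mean_curvature_vector ::
    "(real^'n::finite \<Rightarrow> real^'m) \<Rightarrow> (real^'n \<Rightarrow> real^'m::finite) \<Rightarrow> real^'n \<Rightarrow> real^'m"
  where "mean_curvature_vector f \<nu> z = mean_curvature f \<nu> z *\<^sub>R \<nu> z"

definition isometric_immersion ::
    "('a, 'n::finite) chart set \<Rightarrow> (('a, 'n) chart \<Rightarrow> 'a \<Rightarrow> real^'n^'n) \<Rightarrow> ('a \<Rightarrow> real^'m::finite) \<Rightarrow> bool"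
  where "isometric_immersion \<A> g x \<longleftrightarrow>
    (\<forall>c\<in>\<A>. smooth_on (in_chart c x) (chart_img c) \<and>
       (\<forall>p\<in>chart_dom c. inj (frechet_derivative (in_chart c x) (at (coords c p))) \<and>
          (\<forall>u v. frechet_derivative (in_chart c x) (at (coords c p)) u \<bullet>
                 frechet_derivative (in_chart c x) (at (coords c p)) v = u \<bullet> (g c p *v v))))"

definition local_unit_normal ::
    "'a topology \<Rightarrow> ('a, 'n::finite) chart set \<Rightarrow> ('a \<Rightarrow> real^'m::finite)
      \<Rightarrow> 'a set \<Rightarrow> ('a \<Rightarrow> real^'m) \<Rightarrow> bool"
  where "local_unit_normal M \<A> x V N \<longleftrightarrow>
    openin M V \<and>
    (\<forall>c\<in>\<A>. smooth_on (in_chart c N) (coords c ` (V \<inter> chart_dom c))) \<and>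
    (\<forall>p\<in>V. norm (N p) = 1) \<and>
    (\<forall>c\<in>\<A>. \<forall>p \<in> V \<inter> chart_dom c. \<forall>v.
       frechet_derivative (in_chart c x) (at (coords c p)) v \<bullet> N p = 0)"

text \<open>The vector field \<open>H N\<close> does not depend on the choice of \<open>N\<close>, and whether \<open>H\<close> vanishes does
  not either; since \<open>N\<close> need not exist globally, the conditions are imposed for all local unit
  normal fields.\<close>

definition biharmonic_hypersurface ::
    "'a topology \<Rightarrow> ('a, 'n::finite) chart set \<Rightarrow> (('a, 'n) chart \<Rightarrow> 'a \<Rightarrow> real^'n^'n)
      \<Rightarrow> ('a \<Rightarrow> real^'m::finite) \<Rightarrow> bool"
  where "biharmonic_hypersurface M \<A> g x \<longleftrightarrow>
    (\<forall>V N. local_unit_normal M \<A> x V N \<longrightarrow>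
       (\<forall>c\<in>\<A>. \<forall>p \<in> V \<inter> chart_dom c.
          laplacian (in_chart c (g c))
            (mean_curvature_vector (in_chart c x) (in_chart c N)) (coords c p) = 0))"

definition minimal_hypersurface ::
    "'a topology \<Rightarrow> ('a, 'n::finite) chart set \<Rightarrow> ('a \<Rightarrow> real^'m::finite) \<Rightarrow> bool"
  where "minimal_hypersurface M \<A> x \<longleftrightarrow>
    (\<forall>V N. local_unit_normal M \<A> x V N \<longrightarrow>
       (\<forall>c\<in>\<A>. \<forall>p \<in> V \<inter> chart_dom c.
          mean_curvature (in_chart c x) (in_chart c N) (coords c p) = 0))"

definition recurrent_ricci_operator ::
    "('a, 'n::finite) chart set \<Rightarrow> (('a, 'n) chart \<Rightarrow> 'a \<Rightarrow> real^'n^'n) \<Rightarrow> bool"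
  where "recurrent_ricci_operator \<A> g \<longleftrightarrow>
    (\<exists>\<eta>. one_form \<A> \<eta> \<and>
       (\<forall>c\<in>\<A>. \<forall>X Y. smooth_on X (chart_img c) \<longrightarrow> smooth_on Y (chart_img c) \<longrightarrow>
          (\<forall>p\<in>chart_dom c.
             let G = in_chart c (g c); z = coords c p in
             cov_deriv_endo G (ricci_op G) X Y z = (\<eta> c p \<bullet> X z) *\<^sub>R (ricci_op G z *v Y z))))"

end

theory Submission
  imports Defs
begin

text \<open>Write \<open>k = nH\<close> and let \<open>\<tau>\<close> be its gradient.  The tangential part of the biharmonic equation
  says that \<open>\<tau>\<close> is an eigenvector of the shape operator: \<open>A \<tau> = - (k/2) \<tau>\<close>.  Suppose that
  \<open>k \<noteq> 0\<close> and \<open>\<tau> \<noteq> 0\<close>.  By the Gauss equation \<open>Ric = k A - A\<^sup>2\<close>, so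
  \<open>Ric \<tau> = - (3/4) k\<^sup>2 \<tau>\<close>; evaluating the recurrence on \<open>\<tau>\<close> gives \<open>\<eta> = 2 dk/k\<close>, that is,
  \<open>a - a\<^sup>2\<close> is parallel for \<open>a = A/k\<close>.  Together with the Codazzi equation and \<open>trace a = 1\<close> this
  forces \<open>a\<close> to have the eigenvalues \<open>-1/2\<close> (on \<open>\<tau>\<close>), \<open>3/2\<close> (once) and \<open>0\<close>, and determines the
  Hessian of \<open>k\<close> in terms of \<open>k\<close> and \<open>s = |\<tau>|\<^sup>2\<close>.  The Bochner identity for \<open>k\<close> then yields
  \<open>s = (7/2) k\<^sup>4\<close>; differentiating this along \<open>\<tau>\<close> gives the value \<open>7 k\<^sup>3\<close> for the eigenvalue of the
  Hessian on \<open>\<tau>\<close>, which must also be \<open>(41/8) k\<^sup>3\<close>.  Hence \<open>\<tau> = 0\<close> wherever \<open>k \<noteq> 0\<close>, and there the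
  normal part of the biharmonic equation, \<open>k |A|\<^sup>2 = 0\<close>, contradicts \<open>k = trace A\<close>.

  Traces are taken in the ambient space, where an orthonormal basis is at hand: tangent vectors are
  represented by their images under the differential of the immersion, and endomorphisms of the
  tangent space are extended by \<open>0\<close> on the normal.\<close>

section \<open>Smooth maps\<close>

abbreviation D :: "(real^'n::finite \<Rightarrow> 'b::real_normed_vector) \<Rightarrow> real^'n \<Rightarrow> real^'n \<Rightarrow> 'b"
  where "D f z \<equiv> frechet_derivative f (at z)"

lemma D_works: "f differentiable (at z) \<Longrightarrow> (f has_derivative D f z) (at z)"
  by (simp add: frechet_derivative_works)

lemma D_eqI: "(f has_derivative f') (at z) \<Longrightarrow> D f z = f'"
  using frechet_derivative_at by metis

lemma D_cong:
  assumes "open S" "z \<in> S" "f differentiable (at z)" "\<And>w. w \<in> S \<Longrightarrow> f w = g w"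
  shows "D f z = D g z"
  by (rule frechet_derivative_transform_within_open) (use assms in auto)

lemma differentiable_cong:
  assumes "open S" "z \<in> S" "f differentiable (at z)" "\<And>w. w \<in> S \<Longrightarrow> f w = g w"
  shows "g differentiable (at z)"
  using assms unfolding differentiable_def
  by (meson has_derivative_transform_within_open)

text \<open>Openness of \<open>S\<close> puts a whole neighbourhood of each point inside
  \<open>S\<close>, so equality on \<open>S\<close> passes to derivatives of every order. Later
  computations differentiate formulas that hold on \<open>S\<close> only.\<close>

lemma Ck_on_cong:
  assumes "open S" "\<And>z. z \<in> S \<Longrightarrow> f z = g z" "Ck_on k f S"
  shows "Ck_on k g S"
  using assms(2,3)
proof (induction k arbitrary: f g)
  case 0
  then show ?case by (simp cong: continuous_on_cong)
next
  case (Suc k)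
  have "partial_deriv i f z = partial_deriv i g z" if "z \<in> S" for i z
    unfolding partial_deriv_def using D_cong[OF assms(1) that, of f g] Suc.prems that by simp
  with Suc.IH Suc.prems show ?case
    by simp (metis assms(1) differentiable_cong)
qed

lemma Ck_on_continuous: "Ck_on k f S \<Longrightarrow> continuous_on S f"
  by (cases k) (auto intro!: differentiable_imp_continuous_on differentiable_at_imp_differentiable_on)

lemma Ck_on_SucD: "Ck_on (Suc k) f S \<Longrightarrow> Ck_on k f S"
  by (induction k arbitrary: f) (auto intro: Ck_on_continuous[of "Suc 0", simplified])

lemma D_linear:
  assumes "bounded_linear h" "f differentiable (at z)"
  shows "D (\<lambda>w. h (f w)) z u = h (D f z u)"
  by (rule D_eqI[THEN fun_cong]) (rule bounded_linear.has_derivative[OF assms(1) D_works[OF assms(2)]])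

lemma D_bilinear:
  assumes "bounded_bilinear B" "f differentiable (at z)" "g differentiable (at z)"
  shows "D (\<lambda>w. B (f w) (g w)) z u = B (f z) (D g z u) + B (D f z u) (g z)"
  by (rule D_eqI[THEN fun_cong])
    (rule bounded_bilinear.FDERIV[OF assms(1) D_works[OF assms(2)] D_works[OF assms(3)]])

lemma differentiable_linear:
  fixes f :: "real^'n::finite \<Rightarrow> 'b::real_normed_vector"
  assumes "bounded_linear h" "f differentiable (at z)"
  shows "(\<lambda>w. h (f w)) differentiable (at z)"
  using bounded_linear.has_derivative[OF assms(1) D_works[OF assms(2)]]
  by (rule differentiableI)

lemma differentiable_bilinear:
  fixes f :: "real^'n::finite \<Rightarrow> 'b::real_normed_vector"
  assumes "bounded_bilinear B" "f differentiable (at z)" "g differentiable (at z)"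
  shows "(\<lambda>w. B (f w) (g w)) differentiable (at z)"
  using bounded_bilinear.FDERIV[OF assms(1) D_works[OF assms(2)] D_works[OF assms(3)]]
  by (rule differentiableI)

lemma D_add:
  assumes "f differentiable (at z)" "g differentiable (at z)"
  shows "D (\<lambda>w. f w + g w) z u = D f z u + D g z u"
  by (rule D_eqI[THEN fun_cong]) (intro has_derivative_add D_works assms)

lemma D_diff:
  assumes "f differentiable (at z)" "g differentiable (at z)"
  shows "D (\<lambda>w. f w - g w) z u = D f z u - D g z u"
  by (rule D_eqI[THEN fun_cong]) (intro has_derivative_diff D_works assms)

lemma D_minus:
  assumes "f differentiable (at z)"
  shows "D (\<lambda>w. - f w) z u = - D f z u"
  by (rule D_eqI[THEN fun_cong]) (intro has_derivative_minus D_works assms)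

lemma D_sum:
  assumes "\<And>i. i \<in> I \<Longrightarrow> f i differentiable (at z)"
  shows "D (\<lambda>w. \<Sum>i\<in>I. f i w) z u = (\<Sum>i\<in>I. D (f i) z u)"
  by (rule D_eqI[THEN fun_cong]) (intro has_derivative_sum D_works assms)

lemma D_lin_add: "f differentiable (at z) \<Longrightarrow> D f z (u + v) = D f z u + D f z v"
  by (metis linear_frechet_derivative linear_add)

lemma D_lin_scaleR: "f differentiable (at z) \<Longrightarrow> D f z (c *\<^sub>R u) = c *\<^sub>R D f z u"
  by (metis linear_frechet_derivative linear_cmul)

lemma D_lin_sum: "f differentiable (at z) \<Longrightarrow> D f z (\<Sum>i\<in>I. u i) = (\<Sum>i\<in>I. D f z (u i))"
  by (metis linear_frechet_derivative linear_sum)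

lemma D_lin_0: "f differentiable (at z) \<Longrightarrow> D f z 0 = 0"
  by (metis linear_frechet_derivative linear_0)

section \<open>Closure of C^k and smooth maps under algebraic operations\<close>

lemma Ck_on_const: "Ck_on k (\<lambda>_. c) (S :: (real^'b::finite) set)"
proof (induction k arbitrary: c)
  case (Suc k)
  have "partial_deriv i (\<lambda>_. c) = (\<lambda>_::real^'b. 0)" for i
    by (simp add: partial_deriv_def fun_eq_iff)
  then show ?case using Suc by simp
qed simp

lemma partial_deriv_linear:
  assumes "bounded_linear h" "f differentiable (at z)"
  shows "partial_deriv i (\<lambda>w. h (f w)) z = h (partial_deriv i f z)"
  using assms by (simp add: partial_deriv_def D_linear)

lemma partial_deriv_bilinear:
  assumes "bounded_bilinear B" "f differentiable (at z)" "g differentiable (at z)"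
  shows "partial_deriv i (\<lambda>w. B (f w) (g w)) z = B (f z) (partial_deriv i g z) + B (partial_deriv i f z) (g z)"
  using assms by (simp add: partial_deriv_def D_bilinear)

lemma partial_deriv_add:
  assumes "f differentiable (at z)" "g differentiable (at z)"
  shows "partial_deriv i (\<lambda>w. f w + g w) z = partial_deriv i f z + partial_deriv i g z"
  using assms by (simp add: partial_deriv_def D_add)

lemma Ck_on_linear:
  assumes "open S" "bounded_linear h" "Ck_on k f S"
  shows "Ck_on k (\<lambda>z. h (f z)) S"
  using assms(3)
proof (induction k arbitrary: f)
  case 0
  then show ?case using bounded_linear.continuous_on[OF assms(2)] by simp
next
  case (Suc k)
  have "Ck_on k (partial_deriv i (\<lambda>z. h (f z))) S" for i
    by (rule Ck_on_cong[OF assms(1) _ Suc.IH])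
      (use Suc.prems in \<open>auto simp: partial_deriv_linear[OF assms(2)]\<close>)
  then show ?case using Suc.prems by (auto intro: differentiable_linear[OF assms(2)])
qed

lemma Ck_on_add:
  assumes "open S" "Ck_on k f S" "Ck_on k g S"
  shows "Ck_on k (\<lambda>z. f z + g z) S"
  using assms(2,3)
proof (induction k arbitrary: f g)
  case 0
  then show ?case by (simp add: continuous_on_add)
next
  case (Suc k)
  have "Ck_on k (partial_deriv i (\<lambda>z. f z + g z)) S" for i
    by (rule Ck_on_cong[OF assms(1) _ Suc.IH[of "partial_deriv i f" "partial_deriv i g"]])
      (use Suc.prems in \<open>auto simp: partial_deriv_add\<close>)
  then show ?case using Suc.prems by auto
qed

lemma Ck_on_bilinear:
  assumes "open S" "bounded_bilinear B" "Ck_on k f S" "Ck_on k g S"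
  shows "Ck_on k (\<lambda>z. B (f z) (g z)) S"
  using assms(3,4)
proof (induction k arbitrary: f g)
  case 0
  then show ?case using bounded_bilinear.continuous_on[OF assms(2)] by simp
next
  case (Suc k)
  have "Ck_on k (partial_deriv i (\<lambda>z. B (f z) (g z))) S" for i
    by (rule Ck_on_cong[OF assms(1) _ Ck_on_add[OF assms(1)
          Suc.IH[of f "partial_deriv i g"] Suc.IH[of "partial_deriv i f" g]]])
      (use Suc.prems Ck_on_SucD[OF Suc.prems(1)] Ck_on_SucD[OF Suc.prems(2)] in
        \<open>auto simp: partial_deriv_bilinear[OF assms(2)]\<close>)
  then show ?case using Suc.prems by (auto intro: differentiable_bilinear[OF assms(2)])
qed

lemma Ck_on_inverse:
  fixes f :: "real^'n::finite \<Rightarrow> real"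
  assumes "open S" "\<And>z. z \<in> S \<Longrightarrow> f z \<noteq> 0" "Ck_on k f S"
  shows "Ck_on k (\<lambda>z. inverse (f z)) S"
  using assms(3)
proof (induction k)
  case 0
  then show ?case using assms(2) by (auto intro!: continuous_on_inverse)
next
  case (Suc k)
  have d: "((\<lambda>z. inverse (f z)) has_derivative (\<lambda>h. - (inverse (f z) * D f z h * inverse (f z)))) (at z)"
    if "z \<in> S" for z
    using Suc.prems that assms(2) by (auto intro!: derivative_eq_intros D_works)
  \<comment> \<open>The derivative formula contains \<open>inverse (f z)\<close> again, but only C^k
    regularity of it is required here, and that is the induction hypothesis.\<close>
  have *: "Ck_on k (\<lambda>z. - (inverse (f z) * partial_deriv i f z * inverse (f z))) S" for i
    using Suc.prems Suc.IH Ck_on_SucD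
    by (intro Ck_on_linear[OF assms(1) bounded_linear_minus[OF bounded_linear_ident]]
       Ck_on_bilinear[OF assms(1) bounded_bilinear_mult]) auto
  have "Ck_on k (partial_deriv i (\<lambda>z. inverse (f z))) S" for i
    by (rule Ck_on_cong[OF assms(1) _ *[of i]])
      (simp add: partial_deriv_def D_eqI[OF d])
  then show ?case using d by (auto intro: differentiableI)
qed

lemma Ck_on_sum:
  assumes "open S" "\<And>i. i \<in> I \<Longrightarrow> Ck_on k (f i) S"
  shows "Ck_on k (\<lambda>z. \<Sum>i\<in>I. f i z) S"
  using assms(2)
  by (induction I rule: infinite_finite_induct) (auto intro: Ck_on_const Ck_on_add[OF assms(1)])

lemma Ck_on_prod:
  fixes f :: "'i \<Rightarrow> real^'n::finite \<Rightarrow> real"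
  assumes "open S" "\<And>i. i \<in> I \<Longrightarrow> Ck_on k (f i) S"
  shows "Ck_on k (\<lambda>z. \<Prod>i\<in>I. f i z) S"
  using assms(2)
  by (induction I rule: infinite_finite_induct)
     (auto intro: Ck_on_const Ck_on_bilinear[OF assms(1) bounded_bilinear_mult])

lemma smooth_differentiable: "smooth_on f S \<Longrightarrow> z \<in> S \<Longrightarrow> f differentiable (at z)"
  unfolding smooth_on_def using Ck_on.simps(2) by blast

lemma smooth_partial: "smooth_on f S \<Longrightarrow> smooth_on (partial_deriv i f) S"
  unfolding smooth_on_def using Ck_on.simps(2) by blast

lemma smooth_cong:
  "open S \<Longrightarrow> (\<And>z. z \<in> S \<Longrightarrow> f z = g z) \<Longrightarrow> smooth_on f S \<Longrightarrow> smooth_on g S"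
  unfolding smooth_on_def using Ck_on_cong by blast

lemma Ck_on_subset: "T \<subseteq> S \<Longrightarrow> Ck_on k f S \<Longrightarrow> Ck_on k f T"
  by (induction k arbitrary: f) (auto intro: continuous_on_subset)

lemma smooth_subset: "T \<subseteq> S \<Longrightarrow> smooth_on f S \<Longrightarrow> smooth_on f T"
  unfolding smooth_on_def using Ck_on_subset by blast

lemma smooth_const: "smooth_on (\<lambda>_. c) S"
  by (simp add: smooth_on_def Ck_on_const)

lemma smooth_linear: "open S \<Longrightarrow> bounded_linear h \<Longrightarrow> smooth_on f S \<Longrightarrow> smooth_on (\<lambda>z. h (f z)) S"
  by (simp add: smooth_on_def Ck_on_linear)

lemma smooth_bilinear:
  "open S \<Longrightarrow> bounded_bilinear B \<Longrightarrow> smooth_on f S \<Longrightarrow> smooth_on g S \<Longrightarrow> smooth_on (\<lambda>z. B (f z) (g z)) S"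
  by (simp add: smooth_on_def Ck_on_bilinear)

lemma smooth_add: "open S \<Longrightarrow> smooth_on f S \<Longrightarrow> smooth_on g S \<Longrightarrow> smooth_on (\<lambda>z. f z + g z) S"
  by (simp add: smooth_on_def Ck_on_add)

lemma smooth_minus: "open S \<Longrightarrow> smooth_on f S \<Longrightarrow> smooth_on (\<lambda>z. - f z) S"
  by (rule smooth_linear[OF _ bounded_linear_minus[OF bounded_linear_ident]])

lemma smooth_diff: "open S \<Longrightarrow> smooth_on f S \<Longrightarrow> smooth_on g S \<Longrightarrow> smooth_on (\<lambda>z. f z - g z) S"
  using smooth_add[of S f "\<lambda>z. - g z"] smooth_minus[of S g] by simp

lemma smooth_sum: "open S \<Longrightarrow> (\<And>i. i \<in> I \<Longrightarrow> smooth_on (f i) S) \<Longrightarrow> smooth_on (\<lambda>z. \<Sum>i\<in>I. f i z) S"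
  by (simp add: smooth_on_def Ck_on_sum)

lemma smooth_prod:
  "open S \<Longrightarrow> (\<And>i. i \<in> I \<Longrightarrow> smooth_on (f i) S) \<Longrightarrow> smooth_on (\<lambda>z. \<Prod>i\<in>I. f i z :: real) S"
  by (simp add: smooth_on_def Ck_on_prod)

lemma smooth_inverse:
  "open S \<Longrightarrow> (\<And>z. z \<in> S \<Longrightarrow> f z \<noteq> 0) \<Longrightarrow> smooth_on f S \<Longrightarrow> smooth_on (\<lambda>z. inverse (f z) :: real) S"
  by (simp add: smooth_on_def Ck_on_inverse)

lemma bounded_linear_axis: "bounded_linear (axis i :: 'b::euclidean_space \<Rightarrow> 'b^'i::finite)"
  by (intro linear_conv_bounded_linear[THEN iffD1]) (simp add: linear_iff axis_def vec_eq_iff)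

lemma smooth_vec:
  fixes F :: "'i::finite \<Rightarrow> real^'n::finite \<Rightarrow> 'b::euclidean_space"
  assumes "open S" "\<And>i. smooth_on (F i) S"
  shows "smooth_on (\<lambda>z. \<chi> i. F i z) S"
proof -
  have "(\<chi> i. F i z) = (\<Sum>i\<in>UNIV. axis i (F i z))" for z
    by (simp add: vec_eq_iff axis_def if_distrib[of "\<lambda>v. v $ _"] sum.If_cases)
  then show ?thesis
    by (simp add: smooth_sum smooth_linear bounded_linear_axis assms)
qed

lemma smooth_nth: "open S \<Longrightarrow> smooth_on f S \<Longrightarrow> smooth_on (\<lambda>z. f z $ i) S"
  by (rule smooth_linear[OF _ bounded_linear_vec_nth])

lemma vec_axis_expand: "(\<Sum>i\<in>UNIV. u $ i *\<^sub>R axis i (1::real)) = (u :: real^'n::finite)"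
  by (metis basis_expansion scalar_mult_eq_scaleR)

lemma D_axis_expand:
  fixes f :: "real^'n::finite \<Rightarrow> 'b::real_normed_vector"
  assumes "f differentiable (at z)"
  shows "D f z u = (\<Sum>i\<in>UNIV. u $ i *\<^sub>R partial_deriv i f z)"
proof -
  have "D f z u = D f z (\<Sum>i\<in>UNIV. u $ i *\<^sub>R axis i (1::real))"
    by (simp add: vec_axis_expand)
  then show ?thesis
    unfolding partial_deriv_def D_lin_sum[OF assms] D_lin_scaleR[OF assms] .
qed

text \<open>The direction varies with the point; expanding it in the standard basis leaves products
  of components of \<open>X\<close> with partial derivatives of \<open>f\<close>.\<close>

lemma smooth_D:
  fixes f :: "real^'n::finite \<Rightarrow> 'b::real_normed_vector"
  assumes "open S" "smooth_on f S" "smooth_on X S"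
  shows "smooth_on (\<lambda>z. D f z (X z)) S"
proof (rule smooth_cong[OF assms(1)])
  show "smooth_on (\<lambda>z. \<Sum>i\<in>UNIV. X z $ i *\<^sub>R partial_deriv i f z) S"
    by (intro smooth_sum smooth_bilinear[OF _ bounded_bilinear_scaleR] smooth_nth smooth_partial assms)
qed (simp add: D_axis_expand smooth_differentiable[OF assms(2)])

section \<open>Smoothness of determinants and inverse matrices\<close>

lemma smooth_det:
  fixes G :: "real^'n::finite \<Rightarrow> real^'k::finite^'k"
  assumes "open S" "\<And>i j. smooth_on (\<lambda>z. G z $ i $ j) S"
  shows "smooth_on (\<lambda>z. det (G z)) S"
  unfolding det_def
  by (intro smooth_sum smooth_bilinear[OF _ bounded_bilinear_mult] smooth_prod smooth_const assms)

lemma matrix_inv_works: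
  fixes A :: "real^'k::finite^'k"
  assumes "invertible A"
  shows "matrix_inv A ** A = mat 1" "A ** matrix_inv A = mat 1"
  using someI_ex[OF assms[unfolded invertible_def]] unfolding matrix_inv_def by auto

text \<open>Cramer's rule turns each entry of the inverse into a quotient of polynomials in the
  entries of the matrix, from which smoothness of the inverse can be read off.\<close>

lemma matrix_inv_cramer:
  fixes A :: "real^'k::finite^'k"
  assumes "invertible A"
  shows "matrix_inv A $ i $ j = det (\<chi> r c. if c = i then axis j 1 $ r else A $ r $ c) / det A"
proof -
  let ?x = "matrix_inv A *v axis j 1"
  have "A *v ?x = axis j 1"
    by (simp add: matrix_vector_mul_assoc matrix_inv_works[OF assms])
  with assms have "?x = (\<chi> k. det (\<chi> r c. if c = k then axis j 1 $ r else A $ r $ c) / det A)"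
    by (simp add: cramer invertible_det_nz)
  then have "?x $ i = det (\<chi> r c. if c = i then axis j 1 $ r else A $ r $ c) / det A"
    by (metis (no_types, lifting) vec_lambda_beta)
  moreover have "?x $ i = matrix_inv A $ i $ j"
    by (simp add: matrix_mult_dot inner_axis)
  ultimately show ?thesis by simp
qed

lemma smooth_matrix_inv:
  fixes G :: "real^'n::finite \<Rightarrow> real^'k::finite^'k"
  assumes "open S" "smooth_on G S" "\<And>z. z \<in> S \<Longrightarrow> invertible (G z)"
  shows "smooth_on (\<lambda>z. matrix_inv (G z)) S"
proof (rule smooth_cong[OF assms(1)])
  let ?M = "\<lambda>z i j. (\<chi> r c. if c = i then axis j 1 $ r else G z $ r $ c) :: real^'k^'k"
  have G: "smooth_on (\<lambda>z. G z $ i $ j) S" for i j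
    by (intro smooth_nth assms)
  have "smooth_on (\<lambda>z. ?M z i j $ r $ c) S" for i j r c
    by (cases "c = i") (simp_all add: G smooth_const)
  then show "smooth_on (\<lambda>z. (\<chi> i j. det (?M z i j) * inverse (det (G z))) :: real^'k^'k) S"
    by (intro smooth_vec smooth_bilinear[OF _ bounded_bilinear_mult] smooth_inverse smooth_det G assms(1))
       (use assms in \<open>auto simp: invertible_det_nz\<close>)
qed (simp add: vec_eq_iff matrix_inv_cramer[OF assms(3)] divide_inverse)

lemma smooth_matrix:
  assumes "open S" "smooth_on f S"
  shows "smooth_on (\<lambda>z. matrix (D f z)) S"
  unfolding matrix_def
  by (intro smooth_vec smooth_nth smooth_D smooth_const assms)

lemma bounded_bilinear_matrix_vector_mult: "bounded_bilinear ((*v) :: real^'n::finite^'m::finite \<Rightarrow> _)"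
proof -
  have "bilinear ((*v) :: real^'n^'m \<Rightarrow> _)"
    by (auto simp: bilinear_def linear_iff matrix_vector_mult_add_rdistrib scaleR_matrix_vector_assoc
      matrix_vector_right_distrib matrix_vector_mult_scaleR)
  then show ?thesis by (simp add: bilinear_conv_bounded_bilinear)
qed

lemma bounded_bilinear_matrix_mult: "bounded_bilinear ((**) :: real^'n::finite^'m::finite \<Rightarrow> real^'k::finite^'n \<Rightarrow> _)"
proof -
  have "bilinear ((**) :: real^'n::finite^'m::finite \<Rightarrow> real^'k::finite^'n \<Rightarrow> _)"
    by (auto simp: bilinear_def linear_iff matrix_add_ldistrib
       vec_eq_iff matrix_matrix_mult_def sum_distrib_left sum.distrib algebra_simps)
  then show ?thesis by (simp add: bilinear_conv_bounded_bilinear)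
qed

lemma bounded_linear_transpose: "bounded_linear (transpose :: real^'n::finite^'m::finite \<Rightarrow> _)"
  by (intro linear_conv_bounded_linear[THEN iffD1]) (simp add: linear_iff transpose_def vec_eq_iff)

lemma bounded_linear_trace: "bounded_linear (trace :: real^'n::finite^'n \<Rightarrow> _)"
  by (intro linear_conv_bounded_linear[THEN iffD1]) (simp add: linear_iff trace_def sum.distrib sum_distrib_left)

section \<open>Symmetry of second derivatives\<close>

lemma mvt_direction:
  fixes F :: "real^'n::finite \<Rightarrow> real"
  assumes "0 < t" "\<And>s. 0 \<le> s \<Longrightarrow> s \<le> t \<Longrightarrow> F differentiable (at (z + s *\<^sub>R v))"
  obtains s where "0 < s" "s < t" "F (z + t *\<^sub>R v) - F z = t * D F (z + s *\<^sub>R v) v"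
proof -
  have "((\<lambda>s. F (z + s *\<^sub>R v)) has_real_derivative D F (z + s *\<^sub>R v) v) (at s)" if "0 \<le> s" "s \<le> t" for s
  proof -
    have "((\<lambda>s. F (z + s *\<^sub>R v)) has_derivative (\<lambda>h. D F (z + s *\<^sub>R v) (h *\<^sub>R v))) (at s)"
      by (rule has_derivative_compose[where g=F and f="\<lambda>s. z + s *\<^sub>R v" and f'="\<lambda>h. h *\<^sub>R v"])
        (auto intro!: derivative_eq_intros D_works assms(2) that)
    then show ?thesis
      by (simp add: has_field_derivative_def D_lin_scaleR[OF assms(2)[OF that]] mult_commute_abs)
  qed
  from MVT2[OF assms(1) this] that show ?thesis by auto
qed

text \<open>The mean value theorem is used twice: along \<open>u\<close> for the increment of
  \<open>\<phi>\<close> over \<open>t *\<^sub>R v\<close>, then along \<open>v\<close> for the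
  derivative \<open>D \<phi> w u\<close>. The left side is symmetric in \<open>u\<close> and
  \<open>v\<close>, so exchanging them relates the two mixed derivatives at nearby points.\<close>

lemma second_difference:
  fixes \<phi> :: "real^'n::finite \<Rightarrow> real"
  assumes "smooth_on \<phi> S" "open S" "0 < t"
    and S: "\<And>a b. 0 \<le> a \<Longrightarrow> a \<le> t \<Longrightarrow> 0 \<le> b \<Longrightarrow> b \<le> t \<Longrightarrow> z + a *\<^sub>R u + b *\<^sub>R v \<in> S"
  obtains a b where "0 < a" "a < t" "0 < b" "b < t"
    "\<phi> (z + t *\<^sub>R u + t *\<^sub>R v) - \<phi> (z + t *\<^sub>R u) - \<phi> (z + t *\<^sub>R v) + \<phi> z
       = t * t * D (\<lambda>w. D \<phi> w u) (z + a *\<^sub>R u + b *\<^sub>R v) v"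
proof -
  define F where "F = (\<lambda>w. \<phi> (w + t *\<^sub>R v) - \<phi> w)"
  have F: "(F has_derivative (\<lambda>h. D \<phi> (w + t *\<^sub>R v) h - D \<phi> w h)) (at w)"
    if "w \<in> S" "w + t *\<^sub>R v \<in> S" for w
    unfolding F_def
    by (intro has_derivative_diff has_derivative_compose[where g=\<phi>, of "\<lambda>w. w + t *\<^sub>R v" "\<lambda>h. h"] D_works
       smooth_differentiable[OF assms(1)] that) (auto intro!: derivative_eq_intros)
  have in1: "z + a *\<^sub>R u \<in> S" "z + a *\<^sub>R u + t *\<^sub>R v \<in> S" if "0 \<le> a" "a \<le> t" for a
    using S[OF that, of 0] S[OF that, of t] assms(3) by simp_all
  obtain a where a: "0 < a" "a < t" "F (z + t *\<^sub>R u) - F z = t * D F (z + a *\<^sub>R u) u"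
    by (rule mvt_direction[OF assms(3), of F z u]) (use F[OF in1] differentiableI in blast)+
  define H where "H = (\<lambda>w. D \<phi> w u)"
  have "smooth_on H S" unfolding H_def by (intro smooth_D smooth_const assms)
  then have Hd: "H differentiable (at (z + a *\<^sub>R u + s *\<^sub>R v))" if "0 \<le> s" "s \<le> t" for s
    using S[of a s] that a by (simp add: smooth_differentiable)
  obtain b where b: "0 < b" "b < t"
    "H (z + a *\<^sub>R u + t *\<^sub>R v) - H (z + a *\<^sub>R u) = t * D H (z + a *\<^sub>R u + b *\<^sub>R v) v"
    by (rule mvt_direction[OF assms(3), of H "z + a *\<^sub>R u" v]) (use Hd in blast)+
  have "D F (z + a *\<^sub>R u) u = H (z + a *\<^sub>R u + t *\<^sub>R v) - H (z + a *\<^sub>R u)"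
    unfolding H_def using D_eqI[OF F[OF in1]] a by simp
  with a b have "F (z + t *\<^sub>R u) - F z = t * (t * D H (z + a *\<^sub>R u + b *\<^sub>R v) v)" by simp
  then show ?thesis using a b by (intro that[of a b]) (simp_all add: F_def H_def algebra_simps)
qed

lemma smooth_continuous: "smooth_on f S \<Longrightarrow> continuous_on S f"
  unfolding smooth_on_def using Ck_on.simps(1) by blast

lemma second_derivative_symmetric_real:
  fixes \<phi> :: "real^'n::finite \<Rightarrow> real"
  assumes "open S" "smooth_on \<phi> S" "z \<in> S"
  shows "D (\<lambda>w. D \<phi> w v) z u = D (\<lambda>w. D \<phi> w u) z v"
proof (rule ccontr)
  define p where "p = (\<lambda>w. D (\<lambda>w. D \<phi> w v) w u)"
  define q where "q = (\<lambda>w. D (\<lambda>w. D \<phi> w u) w v)"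
  assume "\<not> ?thesis"
  then have e: "\<bar>p z - q z\<bar> / 2 > 0" by (simp add: p_def q_def)
  have "smooth_on p S" "smooth_on q S"
    unfolding p_def q_def by (intro smooth_D smooth_const assms)+
  then have "isCont p z" "isCont q z"
    using assms(1,3) smooth_continuous continuous_on_eq_continuous_at by blast+
  then obtain d1 d2 where d: "d1 > 0" "\<And>w. dist w z < d1 \<Longrightarrow> dist (p w) (p z) < \<bar>p z - q z\<bar> / 2"
     "d2 > 0" "\<And>w. dist w z < d2 \<Longrightarrow> dist (q w) (q z) < \<bar>p z - q z\<bar> / 2"
    unfolding continuous_at_eps_delta using e by blast
  obtain d3 where d3: "d3 > 0" "ball z d3 \<subseteq> S" using assms(1,3) openE by blast
  define r where "r = min d1 (min d2 d3)"
  \<comment> \<open>The parallelogram of side \<open>t\<close> then has diameter bounded by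
    \<open>r / 2\<close> as seen from \<open>z\<close>; the summand 1 keeps the denominator positive
    when \<open>u\<close> and \<open>v\<close> vanish.\<close>
  define t where "t = r / (2 * (norm u + norm v + 1))"
  have r: "r > 0" using d d3 by (simp add: r_def)
  have n: "norm u + norm v + 1 > 0" by (smt (verit) norm_ge_zero)
  have t: "t > 0" using r n by (simp add: t_def)
  have near: "dist (z + a *\<^sub>R u + b *\<^sub>R v) z < r" if "0 \<le> a" "a \<le> t" "0 \<le> b" "b \<le> t" for a b
  proof -
    have "dist (z + a *\<^sub>R u + b *\<^sub>R v) z = norm (a *\<^sub>R u + b *\<^sub>R v)"
      by (simp add: dist_norm algebra_simps)
    also have "\<dots> \<le> norm (a *\<^sub>R u) + norm (b *\<^sub>R v)" by (rule norm_triangle_ineq)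
    also have "\<dots> \<le> t * norm u + t * norm v"
      using that by (auto intro!: add_mono mult_right_mono)
    also have "\<dots> \<le> t * (norm u + norm v + 1)" using t by (simp add: algebra_simps)
    also have "\<dots> = r / 2" using n unfolding t_def by (simp only: times_divide_eq_left) (simp add: field_simps)
    finally show ?thesis using r by simp
  qed
  have inS: "z + a *\<^sub>R u + b *\<^sub>R v \<in> S" if "0 \<le> a" "a \<le> t" "0 \<le> b" "b \<le> t" for a b
    using near[OF that] d3(2) by (auto simp: r_def dist_commute)
  have inS': "z + a *\<^sub>R v + b *\<^sub>R u \<in> S" if "0 \<le> a" "a \<le> t" "0 \<le> b" "b \<le> t" for a b
    using inS[OF that(3,4,1,2)] by (simp add: algebra_simps)
  obtain a b where ab: "0 < a" "a < t" "0 < b" "b < t"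
    "\<phi> (z + t *\<^sub>R u + t *\<^sub>R v) - \<phi> (z + t *\<^sub>R u) - \<phi> (z + t *\<^sub>R v) + \<phi> z = t * t * q (z + a *\<^sub>R u + b *\<^sub>R v)"
    using second_difference[OF assms(2,1) t inS] unfolding q_def by blast
  obtain a' b' where ab': "0 < a'" "a' < t" "0 < b'" "b' < t"
    "\<phi> (z + t *\<^sub>R v + t *\<^sub>R u) - \<phi> (z + t *\<^sub>R v) - \<phi> (z + t *\<^sub>R u) + \<phi> z = t * t * p (z + a' *\<^sub>R v + b' *\<^sub>R u)"
    using second_difference[OF assms(2,1) t inS'] unfolding p_def by blast
  have "t * t * q (z + a *\<^sub>R u + b *\<^sub>R v) = t * t * p (z + a' *\<^sub>R v + b' *\<^sub>R u)"
    using ab(5) ab'(5) by (simp add: algebra_simps)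
  \<comment> \<open>The mixed derivatives agree at two points near \<open>z\<close>, each within
    half of their supposed gap from its value at \<open>z\<close>; the triangle inequality is then
    violated.\<close>
  then have "q (z + a *\<^sub>R u + b *\<^sub>R v) = p (z + a' *\<^sub>R v + b' *\<^sub>R u)" using t by simp
  moreover have "dist (z + a *\<^sub>R u + b *\<^sub>R v) z < d2" "dist (z + a' *\<^sub>R v + b' *\<^sub>R u) z < d1"
    using near[of a b] near[of b' a'] ab ab' by (auto simp: r_def algebra_simps)
  ultimately show False using d(2,4) by (smt (verit) dist_real_def field_sum_of_halves)
qed

lemma second_derivative_symmetric:
  fixes \<phi> :: "real^'n::finite \<Rightarrow> 'b::euclidean_space"
  assumes S: "open S" and \<phi>: "smooth_on \<phi> S" and z: "z \<in> S"
  shows "D (\<lambda>w. D \<phi> w v) z u = D (\<lambda>w. D \<phi> w u) z v"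
proof (rule euclidean_eqI)
  fix b :: 'b assume "b \<in> Basis"
  note bl = bounded_linear_inner_left[of b]
  have sm: "smooth_on (\<lambda>w. D \<phi> w u) S" for u by (intro smooth_D smooth_const S \<phi>)
  have "D (\<lambda>w. D \<phi> w v) z u \<bullet> b = D (\<lambda>w. D (\<lambda>w. \<phi> w \<bullet> b) w v) z u" for u v
  proof -
    have "D (\<lambda>w. D \<phi> w v) z u \<bullet> b = D (\<lambda>w. D \<phi> w v \<bullet> b) z u"
      by (simp add: D_linear[OF bl] smooth_differentiable[OF sm z])
    also have "\<dots> = D (\<lambda>w. D (\<lambda>w. \<phi> w \<bullet> b) w v) z u"
      by (rule fun_cong, rule D_cong[OF S z])
       (auto simp: D_linear[OF bl] smooth_differentiable[OF \<phi>] intro!: differentiable_linear[OF bl] smooth_differentiable[OF sm z])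
    finally show ?thesis .
  qed
  then show "D (\<lambda>w. D \<phi> w v) z u \<bullet> b = D (\<lambda>w. D \<phi> w u) z v \<bullet> b"
    using second_derivative_symmetric_real[OF S smooth_linear[OF S bl \<phi>] z, of v u] by simp
qed

section \<open>Tangential calculus on a hypersurface\<close>

text \<open>Leibniz rule for the pairing of \<open>D \<phi>\<close> with a moving vector, obtained
  from the rule for products after expansion in partial derivatives.\<close>

lemma D_along:
  fixes \<phi> :: "real^'n::finite \<Rightarrow> 'b::real_normed_vector"
  assumes "open S" "smooth_on \<phi> S" "z \<in> S" "X differentiable (at z)"
  shows "D (\<lambda>w. D \<phi> w (X w)) z u = D (\<lambda>w. D \<phi> w (X z)) z u + D \<phi> z (D X z u)"
proof -
  have pd: "partial_deriv i \<phi> differentiable (at z)" for i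
    using smooth_differentiable[OF smooth_partial] assms by blast
  have Xd: "(\<lambda>w. X w $ i) differentiable (at z)" for i
    by (intro differentiable_linear[OF bounded_linear_vec_nth] assms)
  note sc = bounded_bilinear_scaleR
  have dXi: "D (\<lambda>w. X w $ i) z u = D X z u $ i" for i
    by (intro D_linear[OF bounded_linear_vec_nth] assms)
  have ex: "D (\<lambda>w. D \<phi> w (Y w)) z u = (\<Sum>i\<in>UNIV. Y z $ i *\<^sub>R D (partial_deriv i \<phi>) z u + D (\<lambda>w. Y w $ i) z u *\<^sub>R partial_deriv i \<phi> z)"
    if "\<And>i. (\<lambda>w. Y w $ i) differentiable (at z)" for Y
  proof -
    have "D (\<lambda>w. D \<phi> w (Y w)) z u = D (\<lambda>w. \<Sum>i\<in>UNIV. Y w $ i *\<^sub>R partial_deriv i \<phi> w) z u"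
      by (rule fun_cong, rule D_cong[OF assms(1,3), symmetric])
        (auto simp: D_axis_expand smooth_differentiable[OF assms(2)] intro!: differentiable_sum differentiable_bilinear[OF sc] pd that)
    also have "\<dots> = (\<Sum>i\<in>UNIV. D (\<lambda>w. Y w $ i *\<^sub>R partial_deriv i \<phi> w) z u)"
      by (intro D_sum differentiable_bilinear[OF sc] pd that)
    also have "\<dots> = (\<Sum>i\<in>UNIV. Y z $ i *\<^sub>R D (partial_deriv i \<phi>) z u + D (\<lambda>w. Y w $ i) z u *\<^sub>R partial_deriv i \<phi> z)"
      by (simp only: D_bilinear[OF sc that pd])
    finally show ?thesis .
  qed
  show ?thesis
    by (simp add: ex[OF Xd] ex[of "\<lambda>_. X z"] dXi sum.distrib D_axis_expand[OF smooth_differentiable[OF assms(2,3)]])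
qed

text \<open>The local model: \<open>f\<close> is the immersion read in a chart, and the unit normal
  \<open>\<nu>\<close> exists on all of \<open>\<Omega>\<close>. A global normal need not exist on
  the manifold, so the whole argument is run on such patches.\<close>

locale hypersurface_patch =
  fixes \<Omega> :: "(real^'n::finite) set" and f \<nu> :: "real^'n \<Rightarrow> real^'m::finite"
  assumes op: "open \<Omega>" and card: "CARD('m) = CARD('n) + 1"
    and smooth_f: "smooth_on f \<Omega>" and smooth_nu: "smooth_on \<nu> \<Omega>"
    and imm: "z \<in> \<Omega> \<Longrightarrow> inj (D f z)"
    and unit: "z \<in> \<Omega> \<Longrightarrow> \<nu> z \<bullet> \<nu> z = 1"
    and orth: "z \<in> \<Omega> \<Longrightarrow> D f z u \<bullet> \<nu> z = 0"
begin

text \<open>\<open>tderiv w \<phi>\<close> is the derivative of \<open>\<phi>\<close> along the tangential part of the ambient vector \<open>w\<close>;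
  \<open>A\<close> is the ambient extension of the shape operator.\<close>

definition J :: "real^'n \<Rightarrow> real^'n^'m" where "J z = matrix (D f z)"
definition Gi :: "real^'n \<Rightarrow> real^'n^'n" where "Gi z = matrix_inv (transpose (J z) ** J z)"
text \<open>The Moore-Penrose inverse of the differential of \<open>f\<close>: it inverts the
  differential on tangent vectors and annihilates the normal.\<close>

definition Linv :: "real^'n \<Rightarrow> real^'m^'n" where "Linv z = Gi z ** transpose (J z)"
definition tderiv :: "real^'m \<Rightarrow> (real^'n \<Rightarrow> 'b::real_normed_vector) \<Rightarrow> real^'n \<Rightarrow> 'b"
  where "tderiv w \<phi> z = D \<phi> z (Linv z *v w)"
definition Pr :: "real^'n \<Rightarrow> real^'m \<Rightarrow> real^'m" where "Pr z w = w - (\<nu> z \<bullet> w) *\<^sub>R \<nu> z"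
definition A :: "real^'n \<Rightarrow> real^'m^'m" where "A z = - (matrix (D \<nu> z) ** Linv z)"

lemma f_diff: "z \<in> \<Omega> \<Longrightarrow> f differentiable (at z)"
  using smooth_differentiable[OF smooth_f] .

lemma nu_diff: "z \<in> \<Omega> \<Longrightarrow> \<nu> differentiable (at z)"
  using smooth_differentiable[OF smooth_nu] .

lemma J_apply: "z \<in> \<Omega> \<Longrightarrow> J z *v u = D f z u"
  unfolding J_def by (metis matrix_vector_mul(2) f_diff linear_frechet_derivative)

lemma dnu_apply: "z \<in> \<Omega> \<Longrightarrow> matrix (D \<nu> z) *v u = D \<nu> z u"
  by (metis matrix_vector_mul(2) nu_diff linear_frechet_derivative)

lemma inner_tJ: "z \<in> \<Omega> \<Longrightarrow> u \<bullet> (transpose (J z) *v w) = D f z u \<bullet> w"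
  by (metis J_apply dot_lmul_matrix inner_commute transpose_matrix_vector)

text \<open>Pairing the Gram matrix applied to \<open>u\<close> with \<open>u\<close> gives the
  squared length of \<open>D f z u\<close>, so its kernel is that of the injective
  differential.\<close>

lemma gram_invertible:
  assumes "z \<in> \<Omega>"
  shows "invertible (transpose (J z) ** J z)"
proof -
  have "u = 0" if "(transpose (J z) ** J z) *v u = 0" for u
  proof -
    have "u \<bullet> (transpose (J z) *v (J z *v u)) = 0"
      using that by (simp add: matrix_vector_mul_assoc)
    then have "D f z u = 0"
      using assms inner_tJ J_apply by (metis inner_eq_zero_iff)
    then have "D f z u = D f z 0" by (simp add: D_lin_0 f_diff assms)
    then show "u = 0" using imm[OF assms] by (auto dest: injD)
  qed
  then show ?thesis
    by (simp add: invertible_left_inverse matrix_left_invertible_ker)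
qed

lemma Gi_inv:
  assumes "z \<in> \<Omega>"
  shows "Gi z ** (transpose (J z) ** J z) = mat 1"
  unfolding Gi_def by (rule matrix_inv_works(1)[OF gram_invertible[OF assms]])

lemma Linv_J_matrix: "z \<in> \<Omega> \<Longrightarrow> Linv z ** J z = mat 1"
  using Gi_inv by (simp add: Linv_def matrix_mul_assoc)

lemma Linv_J: "z \<in> \<Omega> \<Longrightarrow> Linv z *v D f z u = u"
  using Linv_J_matrix by (simp flip: J_apply add: matrix_vector_mul_assoc)

text \<open>This is where codimension one enters: the tangent space together with
  \<open>\<nu> z\<close> and a nonzero \<open>w\<close> orthogonal to both would have dimension
  \<open>CARD('n) + 2\<close> in a space of dimension \<open>CARD('n) + 1\<close>.\<close>

lemma perp_zero:
  assumes z: "z \<in> \<Omega>" and w: "\<And>u. D f z u \<bullet> w = 0" "\<nu> z \<bullet> w = 0"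
  shows "w = 0"
proof (rule ccontr)
  assume "w \<noteq> 0"
  have nz: "\<nu> z \<noteq> 0" using unit[OF z] by auto
  have lin: "linear (D f z)" by (rule linear_frechet_derivative[OF f_diff[OF z]])
  have "dim (range (D f z)) = CARD('n)"
    using dim_image_eq[OF lin, of UNIV] imm[OF z] by (simp add: dim_UNIV)
  moreover have "dim ({\<nu> z} \<union> {w}) = 2"
    by (subst dim_orthogonal_sum) (use w nz \<open>w \<noteq> 0\<close> in auto)
  moreover have "dim (range (D f z) \<union> {\<nu> z, w}) = dim (range (D f z)) + dim {\<nu> z, w}"
    by (rule dim_orthogonal_sum) (use w orth[OF z] in auto)
  moreover have "dim (range (D f z) \<union> {\<nu> z, w}) \<le> CARD('m)"
    using dim_subset_UNIV[of "range (D f z) \<union> {\<nu> z, w}"] by simp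
  ultimately show False using card by (simp add: insert_commute)
qed

lemma Linv_nu: "z \<in> \<Omega> \<Longrightarrow> Linv z *v \<nu> z = 0"
proof -
  assume z: "z \<in> \<Omega>"
  have "transpose (J z) *v \<nu> z = 0"
    using inner_tJ[OF z, of _ "\<nu> z"] orth[OF z] by (metis inner_eq_zero_iff)
  then show ?thesis by (simp add: Linv_def flip: matrix_vector_mul_assoc)
qed

text \<open>The difference of the two sides is killed by \<open>Linv z\<close>, hence orthogonal to
  all tangent vectors, and it is orthogonal to the normal as well; \<open>perp_zero\<close>
  finishes.\<close>

lemma f_Linv: 
  assumes z: "z \<in> \<Omega>"
  shows "D f z (Linv z *v w) = Pr z w"
proof -
  let ?r = "Pr z w - D f z (Linv z *v w)"
  have "Linv z *v ?r = 0"
    by (simp add: matrix_vector_mult_diff_distrib Linv_J[OF z] Pr_def Linv_nu[OF z] matrix_vector_mult_scaleR)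
  then have "(transpose (J z) ** J z) *v (Gi z *v (transpose (J z) *v ?r)) = 0"
    by (simp add: Linv_def matrix_vector_mul_assoc[symmetric] del: transpose_matrix_vector)
  then have "transpose (J z) *v ?r = 0"
    using matrix_inv_works(2)[OF gram_invertible[OF z]]
    by (simp only: matrix_vector_mul_assoc Gi_def) (simp add: matrix_mul_assoc)
  then have "D f z u \<bullet> ?r = 0" for u
    using inner_tJ[OF z, of u ?r] by simp
  moreover have "\<nu> z \<bullet> ?r = 0"
    using orth[OF z] by (simp add: Pr_def inner_diff_right unit[OF z] inner_commute)
  ultimately have "?r = 0" by (rule perp_zero[OF z])
  then show ?thesis by simp
qed

lemma smooth_J: "smooth_on J \<Omega>"
  unfolding J_def by (rule smooth_matrix[OF op smooth_f])

lemma smooth_Gi: "smooth_on Gi \<Omega>"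
  unfolding Gi_def
  by (intro smooth_matrix_inv smooth_bilinear[OF _ bounded_bilinear_matrix_mult]
     smooth_linear[OF _ bounded_linear_transpose] smooth_J op gram_invertible)

lemma smooth_Linv: "smooth_on Linv \<Omega>"
  unfolding Linv_def
  by (intro smooth_bilinear[OF _ bounded_bilinear_matrix_mult]
     smooth_linear[OF _ bounded_linear_transpose] smooth_J smooth_Gi op)

lemma smooth_Linv_apply: "smooth_on X \<Omega> \<Longrightarrow> smooth_on (\<lambda>z. Linv z *v X z) \<Omega>"
  by (intro smooth_bilinear[OF _ bounded_bilinear_matrix_vector_mult] smooth_Linv op)

lemma smooth_tderiv: "smooth_on \<phi> \<Omega> \<Longrightarrow> smooth_on X \<Omega> \<Longrightarrow> smooth_on (\<lambda>z. tderiv (X z) \<phi> z) \<Omega>"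
  unfolding tderiv_def by (intro smooth_D smooth_Linv_apply op)

lemma smooth_tderiv_const: "smooth_on \<phi> \<Omega> \<Longrightarrow> smooth_on (tderiv v \<phi>) \<Omega>"
  using smooth_tderiv[of \<phi> "\<lambda>_. v"] by (simp add: smooth_const)

lemma smooth_A: "smooth_on A \<Omega>"
  unfolding A_def
  by (intro smooth_minus smooth_bilinear[OF _ bounded_bilinear_matrix_mult] smooth_matrix smooth_Linv op smooth_nu)

lemma tderiv_D: "z \<in> \<Omega> \<Longrightarrow> tderiv (D f z u) \<phi> z = D \<phi> z u"
  by (simp add: tderiv_def Linv_J)

lemma tderiv_w_add: "\<phi> differentiable (at z) \<Longrightarrow> tderiv (u + v) \<phi> z = tderiv u \<phi> z + tderiv v \<phi> z"
  by (simp add: tderiv_def D_lin_add matrix_vector_right_distrib)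

lemma tderiv_w_scaleR: "\<phi> differentiable (at z) \<Longrightarrow> tderiv (c *\<^sub>R u) \<phi> z = c *\<^sub>R tderiv u \<phi> z"
  by (simp add: tderiv_def D_lin_scaleR matrix_vector_mult_scaleR)

lemma tderiv_w_0: "\<phi> differentiable (at z) \<Longrightarrow> tderiv 0 \<phi> z = 0"
  by (simp add: tderiv_def D_lin_0)

lemma tderiv_w_diff: "\<phi> differentiable (at z) \<Longrightarrow> tderiv (u - v) \<phi> z = tderiv u \<phi> z - tderiv v \<phi> z"
  using tderiv_w_add[of \<phi> z u "- v"] tderiv_w_scaleR[of \<phi> z "-1" v] by simp

lemma tderiv_w_sum: "\<phi> differentiable (at z) \<Longrightarrow> tderiv (\<Sum>i\<in>I. u i) \<phi> z = (\<Sum>i\<in>I. tderiv (u i) \<phi> z)"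
  by (induction I rule: infinite_finite_induct) (simp_all add: tderiv_w_0 tderiv_w_add)

lemma tderiv_expand: "\<phi> differentiable (at z) \<Longrightarrow> tderiv w \<phi> z = (\<Sum>i\<in>UNIV. w $ i *\<^sub>R tderiv (axis i 1) \<phi> z)"
  by (metis (mono_tags, lifting) tderiv_w_scaleR tderiv_w_sum sum.cong vec_axis_expand)

lemma tderiv_nu: "z \<in> \<Omega> \<Longrightarrow> tderiv (\<nu> z) \<phi> z = 0" if "\<phi> differentiable (at z)" 
  using that by (simp add: tderiv_def Linv_nu D_lin_0)

lemma tderiv_Pr: "z \<in> \<Omega> \<Longrightarrow> \<phi> differentiable (at z) \<Longrightarrow> tderiv (Pr z w) \<phi> z = tderiv w \<phi> z"
  by (simp add: Pr_def tderiv_w_diff tderiv_w_scaleR tderiv_nu)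

lemma tderiv_f: "z \<in> \<Omega> \<Longrightarrow> tderiv w f z = Pr z w"
  by (simp add: tderiv_def f_Linv)

lemma tderiv_normal: "z \<in> \<Omega> \<Longrightarrow> tderiv w \<nu> z = - (A z *v w)"
proof -
  assume z: "z \<in> \<Omega>"
  have "A z *v w = - (matrix (D \<nu> z) *v (Linv z *v w))"
    by (simp add: A_def matrix_vector_mul_assoc) (simp add: matrix_vector_mult_def vec_eq_iff sum_negf)
  then show ?thesis by (simp add: dnu_apply z tderiv_def)
qed

lemma tderiv_cong: "z \<in> \<Omega> \<Longrightarrow> smooth_on \<phi> \<Omega> \<Longrightarrow> (\<And>w. w \<in> \<Omega> \<Longrightarrow> \<phi> w = \<psi> w) \<Longrightarrow> tderiv v \<phi> z = tderiv v \<psi> z"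
  unfolding tderiv_def by (metis D_cong op smooth_differentiable)

lemma tderiv_eq_const:
  "z \<in> \<Omega> \<Longrightarrow> (\<And>w. w \<in> \<Omega> \<Longrightarrow> \<phi> w = c) \<Longrightarrow> tderiv v \<phi> z = 0"
  using tderiv_cong[of z "\<lambda>_. c" \<phi> v, OF _ smooth_const] by (simp add: tderiv_def)

lemma tderiv_const: "tderiv v (\<lambda>_. c) z = 0"
  by (simp add: tderiv_def)

lemma tderiv_add:
  "\<phi> differentiable (at z) \<Longrightarrow> \<psi> differentiable (at z) \<Longrightarrow> tderiv v (\<lambda>w. \<phi> w + \<psi> w) z = tderiv v \<phi> z + tderiv v \<psi> z"
  unfolding tderiv_def by (rule D_add)

lemma tderiv_diff:
  "\<phi> differentiable (at z) \<Longrightarrow> \<psi> differentiable (at z) \<Longrightarrow> tderiv v (\<lambda>w. \<phi> w - \<psi> w) z = tderiv v \<phi> z - tderiv v \<psi> z"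
  unfolding tderiv_def by (rule D_diff)

lemma tderiv_minus: "\<phi> differentiable (at z) \<Longrightarrow> tderiv v (\<lambda>w. - \<phi> w) z = - tderiv v \<phi> z"
  unfolding tderiv_def by (rule D_minus)

lemma tderiv_sum:
  "(\<And>i. i \<in> I \<Longrightarrow> \<phi> i differentiable (at z)) \<Longrightarrow> tderiv v (\<lambda>w. \<Sum>i\<in>I. \<phi> i w) z = (\<Sum>i\<in>I. tderiv v (\<phi> i) z)"
  unfolding tderiv_def by (rule D_sum)

lemma tderiv_linear: "bounded_linear h \<Longrightarrow> \<phi> differentiable (at z) \<Longrightarrow> tderiv v (\<lambda>w. h (\<phi> w)) z = h (tderiv v \<phi> z)"
  unfolding tderiv_def by (rule D_linear)

lemma tderiv_bilinear:
  "bounded_bilinear B \<Longrightarrow> \<phi> differentiable (at z) \<Longrightarrow> \<psi> differentiable (at z) \<Longrightarrow>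
   tderiv v (\<lambda>w. B (\<phi> w) (\<psi> w)) z = B (\<phi> z) (tderiv v \<psi> z) + B (tderiv v \<phi> z) (\<psi> z)"
  unfolding tderiv_def by (rule D_bilinear)

lemmas tderiv_inner = tderiv_bilinear[OF bounded_bilinear_inner]
lemmas tderiv_scaleR = tderiv_bilinear[OF bounded_bilinear_scaleR]
lemmas tderiv_mult = tderiv_bilinear[OF bounded_bilinear_mult]
lemmas tderiv_mv = tderiv_bilinear[OF bounded_bilinear_matrix_vector_mult]
lemmas tderiv_mm = tderiv_bilinear[OF bounded_bilinear_matrix_mult]

text \<open>Differentiating the orthogonality of \<open>D f\<close> and \<open>\<nu>\<close>
  expresses the pairing of \<open>D f\<close> with \<open>D \<nu>\<close> through the second
  derivative of \<open>f\<close>, which is symmetric. Since \<open>D \<nu>\<close> is tangential,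
  the symmetry extends from tangent vectors to the ambient space.\<close>

lemma A_sym:
  assumes z: "z \<in> \<Omega>"
  shows "(A z *v u) \<bullet> v = u \<bullet> (A z *v v)"
proof -
  note s = smooth_D[OF op smooth_f smooth_const] and sd = smooth_differentiable[OF smooth_D[OF op smooth_f smooth_const] z]
  have 1: "D (\<lambda>w. D f w x) z y \<bullet> \<nu> z = - (D f z x \<bullet> D \<nu> z y)" for x y
  proof -
    have "D (\<lambda>w. D f w x \<bullet> \<nu> w) z y = 0"
      by (rule trans[OF fun_cong[OF D_cong[OF op z, of "\<lambda>_. 0", symmetric]]]) (simp_all add: orth)
    then show ?thesis
      using D_bilinear[OF bounded_bilinear_inner sd nu_diff[OF z], of x y] by simp
  qed
  have 2: "D f z x \<bullet> D \<nu> z y = D f z y \<bullet> D \<nu> z x" for x y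
    using 1[of x y] 1[of y x] second_derivative_symmetric[OF op smooth_f z, of x y] by simp
  have 3: "D \<nu> z y \<bullet> \<nu> z = 0" for y
  proof -
    have "D (\<lambda>w. \<nu> w \<bullet> \<nu> w) z y = 0"
      by (rule trans[OF fun_cong[OF D_cong[OF op z, of "\<lambda>_. 1", symmetric]]]) (simp_all add: unit)
    then show ?thesis
      using D_bilinear[OF bounded_bilinear_inner nu_diff nu_diff, OF z z, of y] by (simp add: inner_commute)
  qed
  have 4: "D f z (Linv z *v x) \<bullet> D \<nu> z y = x \<bullet> D \<nu> z y" for x y
    using 3[of y] by (simp add: f_Linv[OF z] Pr_def inner_diff_left inner_commute[of "\<nu> z" "D \<nu> z y"])
  have "A z *v x = - D \<nu> z (Linv z *v x)" for x using tderiv_normal[OF z, of x] by (simp add: tderiv_def)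
  then show ?thesis
    using 4[of v "Linv z *v u"] 4[of u "Linv z *v v"] 2[of "Linv z *v v" "Linv z *v u"] by (simp add: inner_commute)
qed

lemma A_nu: "z \<in> \<Omega> \<Longrightarrow> A z *v \<nu> z = 0"
  using tderiv_normal[of z "\<nu> z"] tderiv_nu[OF nu_diff] by simp

lemma nu_A: "z \<in> \<Omega> \<Longrightarrow> \<nu> z \<bullet> (A z *v u) = 0"
  using A_sym[of z "\<nu> z" u] A_nu by simp

lemma A_Pr: "z \<in> \<Omega> \<Longrightarrow> A z *v Pr z u = A z *v u"
  by (simp add: Pr_def matrix_vector_mult_diff_distrib matrix_vector_mult_scaleR A_nu)

text \<open>For constant ambient vectors, \<open>tderiv\<close> differentiates along their
  tangential projections, which need not commute. The commutator is the derivative along the Lie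
  bracket \<open>c\<close> of the coordinate fields \<open>\<xi> u\<close> and
  \<open>\<xi> v\<close>, and \<open>c\<close> is identified by applying the same formula to
  \<open>f\<close>, whose tangential derivative is the projection itself.\<close>

lemma commutator:
  fixes \<phi> :: "real^'n \<Rightarrow> 'b::euclidean_space"
  assumes z: "z \<in> \<Omega>" and \<phi>: "smooth_on \<phi> \<Omega>"
  shows "tderiv u (tderiv v \<phi>) z - tderiv v (tderiv u \<phi>) z = (\<nu> z \<bullet> v) *\<^sub>R tderiv (A z *v u) \<phi> z - (\<nu> z \<bullet> u) *\<^sub>R tderiv (A z *v v) \<phi> z"
proof -
  define \<xi> where "\<xi> v w = Linv w *v v" for v w
  have \<xi>: "\<xi> v differentiable (at z)" for v
    unfolding \<xi>_def using smooth_differentiable[OF smooth_Linv_apply[OF smooth_const] z] .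
  define c where "c = D (\<xi> v) z (\<xi> u z) - D (\<xi> u) z (\<xi> v z)"
  have *: "tderiv u (tderiv v \<psi>) z - tderiv v (tderiv u \<psi>) z = D \<psi> z c" if "smooth_on \<psi> \<Omega>" for \<psi> :: "real^'n \<Rightarrow> 'c::euclidean_space"
  proof -
    have "tderiv u (tderiv v \<psi>) z = D (\<lambda>w. D \<psi> w (\<xi> v z)) z (\<xi> u z) + D \<psi> z (D (\<xi> v) z (\<xi> u z))" for u v
      using D_along[OF op that z \<xi>, of v "\<xi> u z"] unfolding tderiv_def \<xi>_def .
    moreover have "D \<psi> z c = D \<psi> z (D (\<xi> v) z (\<xi> u z)) - D \<psi> z (D (\<xi> u) z (\<xi> v z))"
      unfolding c_def using linear_frechet_derivative[OF smooth_differentiable[OF that z]] by (simp add: linear_diff)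
    ultimately show ?thesis
      using second_derivative_symmetric[OF op that z, of "\<xi> v z" "\<xi> u z"] by simp
  qed
  have 1: "tderiv u (tderiv v f) z = - ((\<nu> z \<bullet> v) *\<^sub>R tderiv u \<nu> z + (tderiv u \<nu> z \<bullet> v) *\<^sub>R \<nu> z)" for u v
  proof -
    have d: "(\<lambda>w. \<nu> w \<bullet> v) differentiable (at z)"
      by (intro differentiable_bilinear[OF bounded_bilinear_inner] nu_diff[OF z]) simp
    have "tderiv u (tderiv v f) z = tderiv u (\<lambda>w. v - (\<nu> w \<bullet> v) *\<^sub>R \<nu> w) z"
      by (rule tderiv_cong[OF z smooth_tderiv_const[OF smooth_f]]) (simp add: tderiv_f Pr_def)
    also have "\<dots> = - ((\<nu> z \<bullet> v) *\<^sub>R tderiv u \<nu> z + (tderiv u \<nu> z \<bullet> v) *\<^sub>R \<nu> z)"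
      using d nu_diff[OF z]
      by (subst tderiv_diff) (simp_all add: tderiv_const differentiable_bilinear[OF bounded_bilinear_scaleR] tderiv_scaleR tderiv_inner)
    finally show ?thesis .
  qed
  have fc: "D f z c = (\<nu> z \<bullet> v) *\<^sub>R (A z *v u) - (\<nu> z \<bullet> u) *\<^sub>R (A z *v v)"
    unfolding *[OF smooth_f, symmetric] 1 tderiv_normal[OF z] using A_sym[OF z, of u v]
    by (simp add: inner_commute algebra_simps)
  have "D \<phi> z c = tderiv (D f z c) \<phi> z" by (simp add: tderiv_D z)
  also have "\<dots> = (\<nu> z \<bullet> v) *\<^sub>R tderiv (A z *v u) \<phi> z - (\<nu> z \<bullet> u) *\<^sub>R tderiv (A z *v v) \<phi> z"
    using smooth_differentiable[OF \<phi> z] by (simp add: fc tderiv_w_diff tderiv_w_scaleR)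
  finally show ?thesis using *[OF \<phi>] by simp
qed

lemma A_diff: "z \<in> \<Omega> \<Longrightarrow> A differentiable (at z)"
  using smooth_differentiable[OF smooth_A] .

lemma dA_apply:
  assumes z: "z \<in> \<Omega>"
  shows "tderiv u A z *v v = - tderiv u (tderiv v \<nu>) z"
proof -
  have "tderiv u (tderiv v \<nu>) z = tderiv u (\<lambda>w. - (A w *v v)) z"
    by (rule tderiv_cong[OF z smooth_tderiv_const[OF smooth_nu]]) (simp add: tderiv_normal)
  also have "\<dots> = - (tderiv u A z *v v)"
    using A_diff[OF z]
    by (subst tderiv_minus) (simp_all add: differentiable_bilinear[OF bounded_bilinear_matrix_vector_mult] tderiv_mv tderiv_const)
  finally show ?thesis by simp
qed

text \<open>The commutator applied to the normal field. The right side is the price of admitting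
  arbitrary ambient vectors; it vanishes when \<open>u\<close> and \<open>v\<close> are
  tangent.\<close>

lemma codazzi:
  assumes z: "z \<in> \<Omega>"
  shows "tderiv u A z *v v - tderiv v A z *v u = (\<nu> z \<bullet> v) *\<^sub>R (A z *v (A z *v u)) - (\<nu> z \<bullet> u) *\<^sub>R (A z *v (A z *v v))"
  using commutator[OF z smooth_nu, of u v] by (simp add: dA_apply z tderiv_normal algebra_simps)

lemma A_transpose: "z \<in> \<Omega> \<Longrightarrow> transpose (A z) = A z"
  by (metis A_sym dot_lmul_matrix matrix_eq transpose_matrix_vector vector_eq_ldot inner_commute)

lemma dA_sym:
  assumes z: "z \<in> \<Omega>"
  shows "(tderiv u A z *v v) \<bullet> w = v \<bullet> (tderiv u A z *v w)"
proof -
  have "transpose (tderiv u A z) = tderiv u (\<lambda>w. transpose (A w)) z"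
    by (simp add: tderiv_linear[OF bounded_linear_transpose A_diff[OF z]])
  also have "\<dots> = tderiv u A z"
    by (rule tderiv_cong[OF z smooth_linear[OF op bounded_linear_transpose smooth_A]]) (rule A_transpose)
  finally show ?thesis by (metis dot_lmul_matrix inner_commute transpose_matrix_vector)
qed

end

section \<open>Intrinsic geometry in terms of the shape operator\<close>

lemma trace_eq_sum: "trace (M :: real^'k::finite^'k) = (\<Sum>i\<in>UNIV. axis i 1 \<bullet> (M *v axis i 1))"
  by (simp add: trace_def inner_axis' matrix_mult_dot inner_axis)

lemma D_expand:
  fixes \<phi> :: "real^'n::finite \<Rightarrow> 'b::real_normed_vector"
  assumes "\<phi> differentiable (at z)"
  shows "D \<phi> z u = (\<Sum>i\<in>UNIV. u $ i *\<^sub>R D \<phi> z (axis i 1))"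
  using D_axis_expand[OF assms, of u] by (simp add: partial_deriv_def)

context hypersurface_patch
begin

definition d2f :: "real^'n \<Rightarrow> real^'n \<Rightarrow> real^'n \<Rightarrow> real^'m"
  where "d2f u v z = D (\<lambda>w. D f w v) z u"

lemma smooth_Df: "smooth_on (\<lambda>w. D f w v) \<Omega>"
  by (intro smooth_D smooth_const op smooth_f)

lemma smooth_d2f: "smooth_on (d2f u v) \<Omega>"
  unfolding d2f_def[abs_def] by (intro smooth_D smooth_const op smooth_Df)

lemma Df_diff: "z \<in> \<Omega> \<Longrightarrow> (\<lambda>w. D f w v) differentiable (at z)"
  using smooth_differentiable[OF smooth_Df] .

lemma d2f_diff: "z \<in> \<Omega> \<Longrightarrow> d2f u v differentiable (at z)"
  using smooth_differentiable[OF smooth_d2f] .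

lemma d2f_sym: "z \<in> \<Omega> \<Longrightarrow> d2f u v z = d2f v u z"
  unfolding d2f_def by (rule second_derivative_symmetric[OF op smooth_f])

lemma d2f_expand1: "z \<in> \<Omega> \<Longrightarrow> d2f u v z = (\<Sum>i\<in>UNIV. u $ i *\<^sub>R d2f (axis i 1) v z)"
  unfolding d2f_def by (rule D_expand[OF Df_diff])

lemma d2f_expand:
  assumes "z \<in> \<Omega>"
  shows "d2f u v z = (\<Sum>i\<in>UNIV. \<Sum>j\<in>UNIV. (u $ i * v $ j) *\<^sub>R d2f (axis i 1) (axis j 1) z)"
proof -
  have "d2f (axis i 1) v z = (\<Sum>j\<in>UNIV. v $ j *\<^sub>R d2f (axis i 1) (axis j 1) z)" for i
    using d2f_expand1[OF assms, of v "axis i 1"] by (simp add: d2f_sym[OF assms, of "axis i 1"])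
  then show ?thesis by (subst d2f_expand1[OF assms]) (simp add: scaleR_sum_right)
qed

text \<open>Gauss formula: differentiating the orthogonality of \<open>D f\<close> and
  \<open>\<nu>\<close> shows that the normal part of the second derivative of \<open>f\<close> is
  the second fundamental form.\<close>

lemma d2f_nu:
  assumes z: "z \<in> \<Omega>"
  shows "\<nu> z \<bullet> d2f u v z = D f z u \<bullet> (A z *v D f z v)"
proof -
  have "D (\<lambda>w. D f w v \<bullet> \<nu> w) z u = 0"
    by (rule trans[OF fun_cong[OF D_cong[OF op z, of "\<lambda>_. 0", symmetric]]]) (simp_all add: orth)
  then have "d2f u v z \<bullet> \<nu> z = - (D f z v \<bullet> D \<nu> z u)"
    using D_bilinear[OF bounded_bilinear_inner Df_diff[OF z] nu_diff[OF z], of v u] unfolding d2f_def by simp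
  moreover have "D \<nu> z u = - (A z *v D f z u)"
    using tderiv_normal[OF z, of "D f z u"] tderiv_D[OF z, of u \<nu>] by simp
  ultimately show ?thesis using A_sym[OF z, of "D f z v" "D f z u"] by (simp add: inner_commute)
qed

lemma Linv_component: "z \<in> \<Omega> \<Longrightarrow> (Linv z *v w) $ k = (\<Sum>l\<in>UNIV. Gi z $ k $ l * (D f z (axis l 1) \<bullet> w))"
proof -
  assume z: "z \<in> \<Omega>"
  have "(transpose (J z) *v w) $ l = D f z (axis l 1) \<bullet> w" for l
    using inner_tJ[OF z, of "axis l 1" w] by (simp add: inner_axis' del: transpose_matrix_vector)
  then show ?thesis
    by (simp add: Linv_def matrix_vector_mul_assoc[symmetric] del: transpose_matrix_vector)
      (simp add: matrix_vector_mult_def del: transpose_matrix_vector)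
qed

end

section \<open>Levi-Civita connection, curvature and Ricci operator of the induced metric\<close>

locale metric_patch = hypersurface_patch \<Omega> f \<nu>
  for \<Omega> :: "(real^'n::finite) set" and f \<nu> :: "real^'n \<Rightarrow> real^'m::finite" +
  fixes G :: "real^'n \<Rightarrow> real^'n^'n"
  assumes metric: "z \<in> \<Omega> \<Longrightarrow> D f z u \<bullet> D f z v = u \<bullet> (G z *v v)"
begin

lemma G_eq: "z \<in> \<Omega> \<Longrightarrow> G z = transpose (J z) ** J z"
proof -
  assume z: "z \<in> \<Omega>"
  have "u \<bullet> (G z *v v) = u \<bullet> ((transpose (J z) ** J z) *v v)" for u v
    using inner_tJ[OF z, of u "J z *v v"] metric[OF z, of u v] J_apply[OF z]
    by (simp add: matrix_vector_mul_assoc[symmetric] del: transpose_matrix_vector)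
  then have "G z *v v = (transpose (J z) ** J z) *v v" for v
    using vector_eq_ldot by blast
  then show ?thesis by (simp add: matrix_eq)
qed

lemma G_inv: "z \<in> \<Omega> \<Longrightarrow> matrix_inv (G z) = Gi z"
  by (simp add: G_eq Gi_def)

lemma G_entry: "z \<in> \<Omega> \<Longrightarrow> G z $ i $ j = D f z (axis i 1) \<bullet> D f z (axis j 1)"
  by (simp add: metric inner_axis' matrix_mult_dot inner_axis)

lemma G_deriv:
  assumes z: "z \<in> \<Omega>"
  shows "partial_deriv i (\<lambda>w. G w $ j $ l) z =
    d2f (axis i 1) (axis j 1) z \<bullet> D f z (axis l 1) + D f z (axis j 1) \<bullet> d2f (axis i 1) (axis l 1) z"
proof -
  have "partial_deriv i (\<lambda>w. G w $ j $ l) z = D (\<lambda>w. D f w (axis j 1) \<bullet> D f w (axis l 1)) z (axis i 1)"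
    unfolding partial_deriv_def
    by (rule fun_cong, rule D_cong[OF op z, symmetric])
      (auto simp: G_entry intro!: differentiable_bilinear[OF bounded_bilinear_inner] Df_diff z)
  then show ?thesis
    unfolding d2f_def by (simp add: D_bilinear[OF bounded_bilinear_inner Df_diff Df_diff, OF z z])
qed

text \<open>The three metric derivatives contribute six terms; four cancel by symmetry of
  \<open>d2f\<close>. So the Levi-Civita connection is the tangential part of the ambient
  derivative.\<close>

lemma christoffel_eq:
  assumes z: "z \<in> \<Omega>"
  shows "christoffel G k i j z = (Linv z *v d2f (axis i 1) (axis j 1) z) $ k"
proof -
  have "partial_deriv i (\<lambda>w. G w $ j $ l) z + partial_deriv j (\<lambda>w. G w $ i $ l) z
        - partial_deriv l (\<lambda>w. G w $ i $ j) z = 2 * (D f z (axis l 1) \<bullet> d2f (axis i 1) (axis j 1) z)" for l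
    using d2f_sym[OF z, of "axis i 1" "axis j 1"] d2f_sym[OF z, of "axis l 1" "axis j 1"] d2f_sym[OF z, of "axis l 1" "axis i 1"]
    by (simp add: G_deriv[OF z] inner_commute)
  then show ?thesis
    by (simp add: christoffel_def Linv_component z G_inv sum_divide_distrib sum_distrib_left sum_distrib_right algebra_simps)
qed

lemma christoffel_sum:
  assumes z: "z \<in> \<Omega>"
  shows "(\<chi> k. \<Sum>i\<in>UNIV. \<Sum>j\<in>UNIV. christoffel G k i j z * u $ i * v $ j) = Linv z *v d2f u v z"
proof -
  have "Linv z *v d2f u v z = (\<Sum>i\<in>UNIV. \<Sum>j\<in>UNIV. (u $ i * v $ j) *\<^sub>R (Linv z *v d2f (axis i 1) (axis j 1) z))"
    unfolding d2f_expand[OF z, of u v] by (simp add: linear_sum matrix_vector_mult_scaleR)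
  then show ?thesis by (simp add: vec_eq_iff christoffel_eq[OF z] mult_ac)
qed

lemma cov_deriv_eq:
  assumes z: "z \<in> \<Omega>" and Y: "Y differentiable (at z)"
  shows "cov_deriv G X Y z = Linv z *v D (\<lambda>w. D f w (Y w)) z (X z)"
  using christoffel_sum[OF z, of "X z" "Y z"]
  by (simp add: cov_deriv_def D_along[OF op smooth_f z Y] matrix_vector_right_distrib Linv_J[OF z] d2f_def)

lemma cov_deriv_const:
  assumes z: "z \<in> \<Omega>"
  shows "cov_deriv G (\<lambda>_. u) (\<lambda>_. v) z = Linv z *v d2f u v z"
  using cov_deriv_eq[OF z, of "\<lambda>_. v" "\<lambda>_. u"] by (simp add: d2f_def)

text \<open>With the gradient of \<open>F\<close> written in ambient components, the
  second-derivative term of \<open>f\<close> coming from the product rule is exactly the connection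
  term that the Hessian subtracts.\<close>

lemma hessian_eq:
  fixes F :: "real^'n \<Rightarrow> 'b::euclidean_space"
  assumes z: "z \<in> \<Omega>" and F: "smooth_on F \<Omega>"
  shows "hessian G F (\<lambda>_. u) (\<lambda>_. v) z = (\<Sum>b\<in>UNIV. D f z v $ b *\<^sub>R tderiv (D f z u) (tderiv (axis b 1) F) z)"
proof -
  have c: "(\<lambda>w. D f w v $ b) differentiable (at z)" for b
    by (intro differentiable_linear[OF bounded_linear_vec_nth] Df_diff z)
  have dc: "D (\<lambda>w. D f w v $ b) z u = d2f u v z $ b" for b
    unfolding d2f_def by (intro D_linear[OF bounded_linear_vec_nth] Df_diff z)
  have g: "tderiv (axis b 1) F differentiable (at z)" for b
    using smooth_differentiable[OF smooth_tderiv_const[OF F] z] .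
  note sc = bounded_bilinear_scaleR
  have "D (\<lambda>w. D F w v) z u = D (\<lambda>w. \<Sum>b\<in>UNIV. D f w v $ b *\<^sub>R tderiv (axis b 1) F w) z u"
  proof (rule fun_cong, rule D_cong[OF op z])
    show "(\<lambda>w. D F w v) differentiable (at z)"
      by (rule smooth_differentiable[OF smooth_D[OF op F smooth_const] z])
    show "D F w v = (\<Sum>b\<in>UNIV. D f w v $ b *\<^sub>R tderiv (axis b 1) F w)" if "w \<in> \<Omega>" for w
      using tderiv_expand[OF smooth_differentiable[OF F that], of "D f w v"] by (simp add: tderiv_D that)
  qed
  also have "\<dots> = (\<Sum>b\<in>UNIV. D f z v $ b *\<^sub>R D (tderiv (axis b 1) F) z u + d2f u v z $ b *\<^sub>R tderiv (axis b 1) F z)"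
    by (subst D_sum) (simp_all add: differentiable_bilinear[OF sc] c g D_bilinear[OF sc c g] dc)
  also have "\<dots> = (\<Sum>b\<in>UNIV. D f z v $ b *\<^sub>R D (tderiv (axis b 1) F) z u) + tderiv (d2f u v z) F z"
    by (simp add: sum.distrib tderiv_expand[OF smooth_differentiable[OF F z], of "d2f u v z"])
  finally show ?thesis
    by (simp add: hessian_def cov_deriv_const[OF z] tderiv_D[OF z]) (simp add: tderiv_def)
qed

text \<open>Contracting the differential of \<open>f\<close> with the inverse metric yields the
  tangential projections of the standard basis vectors. The metric trace thus becomes a trace over
  an ambient orthonormal basis, because \<open>tderiv\<close> ignores normal components.\<close>

lemma laplacian_eq:
  fixes F :: "real^'n \<Rightarrow> 'b::euclidean_space"
  assumes z: "z \<in> \<Omega>" and F: "smooth_on F \<Omega>"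
  shows "laplacian G F z = - (\<Sum>b\<in>UNIV. tderiv (axis b 1) (tderiv (axis b 1) F) z)"
proof -
  have g: "tderiv (axis b 1) F differentiable (at z)" for b
    using smooth_differentiable[OF smooth_tderiv_const[OF F] z] .
  have dl: "linear (\<lambda>v. D f z v)" by (rule linear_frechet_derivative[OF f_diff[OF z]])
  have "(\<Sum>i\<in>UNIV. \<Sum>j\<in>UNIV. (Gi z $ i $ j * D f z (axis j 1) $ b) *\<^sub>R D f z (axis i 1)) = Pr z (axis b 1)" for b
  proof -
    have "Linv z *v axis b 1 = (\<Sum>i\<in>UNIV. (Linv z *v axis b 1) $ i *\<^sub>R axis i 1)"
      by (rule vec_axis_expand[symmetric])
    then have "Linv z *v axis b 1 = (\<Sum>i\<in>UNIV. (\<Sum>j\<in>UNIV. Gi z $ i $ j * D f z (axis j 1) $ b) *\<^sub>R axis i 1)"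
      by (simp add: Linv_component[OF z] inner_axis)
    then show ?thesis
      using f_Linv[OF z, of "axis b 1"] by (simp add: linear_sum[OF dl] linear_cmul[OF dl] scaleR_sum_left)
  qed
  note P = this
  have "(\<Sum>i\<in>UNIV. \<Sum>j\<in>UNIV. Gi z $ i $ j *\<^sub>R hessian G F (\<lambda>_. axis i 1) (\<lambda>_. axis j 1) z)
     = (\<Sum>i\<in>UNIV. \<Sum>j\<in>UNIV. \<Sum>b\<in>UNIV. (Gi z $ i $ j * D f z (axis j 1) $ b) *\<^sub>R tderiv (D f z (axis i 1)) (tderiv (axis b 1) F) z)"
    by (simp add: hessian_eq[OF z F] scaleR_sum_right)
  also have "\<dots> = (\<Sum>i\<in>UNIV. \<Sum>b\<in>UNIV. \<Sum>j\<in>UNIV. (Gi z $ i $ j * D f z (axis j 1) $ b) *\<^sub>R tderiv (D f z (axis i 1)) (tderiv (axis b 1) F) z)"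
    by (intro sum.cong refl sum.swap)
  also have "\<dots> = (\<Sum>b\<in>UNIV. \<Sum>i\<in>UNIV. \<Sum>j\<in>UNIV. (Gi z $ i $ j * D f z (axis j 1) $ b) *\<^sub>R tderiv (D f z (axis i 1)) (tderiv (axis b 1) F) z)"
    by (rule sum.swap)
  also have "\<dots> = (\<Sum>b\<in>UNIV. tderiv (Pr z (axis b 1)) (tderiv (axis b 1) F) z)"
    by (simp add: P[symmetric] tderiv_w_sum g tderiv_w_scaleR)
  also have "\<dots> = (\<Sum>b\<in>UNIV. tderiv (axis b 1) (tderiv (axis b 1) F) z)"
    by (simp add: tderiv_Pr z g)
  finally show ?thesis by (simp add: laplacian_def G_inv[OF z])
qed

text \<open>By the Gauss equation this is the Ricci operator transported to the ambient space,
  extended by zero on the normal.\<close>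

definition R :: "real^'n \<Rightarrow> real^'m^'m" where "R z = trace (A z) *\<^sub>R A z - A z ** A z"

text \<open>The inner covariant derivative is \<open>d2f\<close> with its normal part removed.
  Differentiating that removed part produces \<open>D \<nu>\<close>, hence the shape operator term;
  its remaining contribution is normal and disappears under \<open>Linv\<close>.\<close>

lemma cov_cov_deriv:
  assumes z: "z \<in> \<Omega>"
  shows "cov_deriv G (\<lambda>_. e) (cov_deriv G (\<lambda>_. u) (\<lambda>_. v)) z =
    Linv z *v D (d2f u v) z e + (D f z u \<bullet> (A z *v D f z v)) *\<^sub>R (Linv z *v (A z *v D f z e))"
proof -
  let ?Y = "\<lambda>w. Linv w *v d2f u v w"
  have sY: "smooth_on ?Y \<Omega>" by (rule smooth_Linv_apply[OF smooth_d2f])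
  have Y: "?Y w = cov_deriv G (\<lambda>_. u) (\<lambda>_. v) w" if "w \<in> \<Omega>" for w
    using cov_deriv_const[OF that] by simp
  have d: "cov_deriv G (\<lambda>_. u) (\<lambda>_. v) differentiable (at z)"
    by (rule differentiable_cong[OF op z smooth_differentiable[OF sY z] Y])
  have dn: "(\<lambda>w. \<nu> w \<bullet> d2f u v w) differentiable (at z)"
    by (intro differentiable_bilinear[OF bounded_bilinear_inner] nu_diff d2f_diff z)
  have "D (\<lambda>w. D f w (cov_deriv G (\<lambda>_. u) (\<lambda>_. v) w)) z e = D (\<lambda>w. d2f u v w - (\<nu> w \<bullet> d2f u v w) *\<^sub>R \<nu> w) z e"
    by (rule fun_cong, rule D_cong[OF op z, symmetric])
      (auto simp: Y[symmetric] f_Linv Pr_def d2f_diff z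
        intro!: differentiable_diff differentiable_bilinear[OF bounded_bilinear_scaleR] dn nu_diff)
  also have "\<dots> = D (d2f u v) z e - ((\<nu> z \<bullet> d2f u v z) *\<^sub>R D \<nu> z e + D (\<lambda>w. \<nu> w \<bullet> d2f u v w) z e *\<^sub>R \<nu> z)"
    by (simp add: D_diff d2f_diff z D_bilinear[OF bounded_bilinear_scaleR dn nu_diff[OF z]]
       differentiable_bilinear[OF bounded_bilinear_scaleR dn nu_diff[OF z]])
  also have "D \<nu> z e = - (A z *v D f z e)"
    using tderiv_normal[OF z, of "D f z e"] tderiv_D[OF z, of e \<nu>] by simp
  finally show ?thesis
    using cov_deriv_eq[OF z d, of "\<lambda>_. e"]
    by (simp add: d2f_nu[OF z] matrix_vector_mult_diff_distrib matrix_vector_right_distrib matrix_vector_mult_scaleR Linv_nu[OF z])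
qed

text \<open>Gauss equation: the third derivatives of \<open>f\<close> are symmetric in
  \<open>e\<close> and \<open>u\<close> and cancel, and constant coordinate fields have vanishing
  bracket.\<close>

lemma curvature_eq:
  assumes z: "z \<in> \<Omega>"
  shows "curvature G (\<lambda>_. e) (\<lambda>_. u) (\<lambda>_. v) z =
    (D f z u \<bullet> (A z *v D f z v)) *\<^sub>R (Linv z *v (A z *v D f z e)) -
    (D f z e \<bullet> (A z *v D f z v)) *\<^sub>R (Linv z *v (A z *v D f z u))"
proof -
  have "D (d2f u v) z e = D (d2f e v) z u"
    unfolding d2f_def[abs_def] by (rule second_derivative_symmetric[OF op smooth_Df z])
  moreover have "lie_bracket (\<lambda>_. e) (\<lambda>_. u) = (\<lambda>_. 0)"
    by (simp add: lie_bracket_def fun_eq_iff)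
  moreover have "cov_deriv G (\<lambda>_. 0) (\<lambda>_. v) z = 0"
    by (simp add: cov_deriv_def vec_eq_iff)
  ultimately show ?thesis
    by (simp add: curvature_def cov_cov_deriv[OF z])
qed

lemma R_apply: "R z *v w = trace (A z) *\<^sub>R (A z *v w) - A z *v (A z *v w)"
  by (simp add: R_def matrix_vector_mult_diff_rdistrib scaleR_matrix_vector_assoc[symmetric] matrix_vector_mul_assoc)

lemma ricci_tensor_eq:
  assumes z: "z \<in> \<Omega>"
  shows "ricci_tensor G z u v = D f z v \<bullet> (R z *v D f z u)"
proof -
  let ?S = "Linv z ** A z ** J z"
  have S: "?S *v u = Linv z *v (A z *v D f z u)" for u
    by (simp add: matrix_vector_mul_assoc[symmetric] J_apply z)
  have "ricci_tensor G z u v = (\<Sum>i\<in>UNIV. (D f z u \<bullet> (A z *v D f z v)) * (?S *v axis i 1) $ i)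
     - (\<Sum>i\<in>UNIV. (?S *v u) $ i * (D f z (axis i 1) \<bullet> (A z *v D f z v)))"
    by (simp add: ricci_tensor_def curvature_eq[OF z] sum_subtractf S mult.commute)
  also have "(\<Sum>i\<in>UNIV. (D f z u \<bullet> (A z *v D f z v)) * (?S *v axis i 1) $ i) = (D f z u \<bullet> (A z *v D f z v)) * trace ?S"
    by (simp add: trace_eq_sum inner_axis' sum_distrib_left)
  \<comment> \<open>Cyclicity of the trace moves \<open>J z\<close> to the front;
    \<open>J z ** Linv z\<close> is the tangential projection, which \<open>A z\<close>
    absorbs.\<close>
  also have "trace ?S = trace (A z)"
  proof -
    have "trace ?S = trace (J z ** Linv z ** A z)"
      using trace_mul_sym[of "Linv z ** A z" "J z"] by (simp add: matrix_mul_assoc)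
    also have "\<dots> = trace (A z ** (J z ** Linv z))"
      by (rule trace_mul_sym)
    also have "A z ** (J z ** Linv z) = A z"
      by (simp add: matrix_eq matrix_vector_mul_assoc[symmetric] J_apply f_Linv A_Pr z)
    finally show ?thesis .
  qed
  also have "(\<Sum>i\<in>UNIV. (?S *v u) $ i * (D f z (axis i 1) \<bullet> (A z *v D f z v))) = D f z (?S *v u) \<bullet> (A z *v D f z v)"
    by (simp add: D_expand[OF f_diff[OF z], of "?S *v u"] inner_sum_left)
  also have "\<dots> = (A z *v D f z u) \<bullet> (A z *v D f z v)"
    unfolding S f_Linv[OF z] using nu_A[OF z] by (simp add: Pr_def inner_diff_left)
  finally show ?thesis
    using A_sym[OF z, of "D f z u" "D f z v"] A_sym[OF z, of "A z *v D f z u" "D f z v"]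
    by (simp add: R_apply inner_diff_right inner_commute mult.commute)
qed

lemma ricci_op_eq:
  assumes z: "z \<in> \<Omega>"
  shows "ricci_op G z = Linv z ** R z ** J z"
proof -
  have "(\<chi> k j. ricci_tensor G z (axis j 1) (axis k 1)) = transpose (J z) ** R z ** J z"
  proof -
    have "(transpose (J z) ** R z ** J z) $ k $ j = D f z (axis k 1) \<bullet> (R z *v D f z (axis j 1))" for k j
    proof -
      have "(transpose (J z) ** R z ** J z) $ k $ j = axis k 1 \<bullet> ((transpose (J z) ** R z ** J z) *v axis j 1)"
        by (simp add: inner_axis' matrix_mult_dot inner_axis)
      also have "\<dots> = axis k 1 \<bullet> (transpose (J z) *v (R z *v D f z (axis j 1)))"
        by (simp add: matrix_vector_mul_assoc[symmetric] J_apply z del: transpose_matrix_vector)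
      finally show ?thesis by (simp only: inner_tJ[OF z])
    qed
    then show ?thesis by (simp add: vec_eq_iff ricci_tensor_eq[OF z])
  qed
  then show ?thesis by (simp add: ricci_op_def G_inv[OF z] Linv_def matrix_mul_assoc)
qed

lemma smooth_R: "smooth_on R \<Omega>"
  unfolding R_def
  by (intro smooth_diff smooth_bilinear[OF _ bounded_bilinear_scaleR] smooth_bilinear[OF _ bounded_bilinear_matrix_mult]
   smooth_linear[OF _ bounded_linear_trace] smooth_A op)

lemma R_Pr: "z \<in> \<Omega> \<Longrightarrow> R z *v Pr z w = R z *v w"
  by (simp add: R_apply A_Pr)

lemma Pr_R: "z \<in> \<Omega> \<Longrightarrow> Pr z (R z *v w) = R z *v w"
  by (simp add: Pr_def R_apply inner_diff_right nu_A)

text \<open>The second derivatives of \<open>f\<close> occur on both sides of the covariant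
  derivative of an endomorphism and cancel, as \<open>R\<close> ignores normal components. What
  remains is the derivative of \<open>R\<close> compressed to the tangent space.\<close>

lemma recurrent_eq:
  assumes z: "z \<in> \<Omega>"
    and rec: "\<And>u v. cov_deriv_endo G (ricci_op G) (\<lambda>_. u) (\<lambda>_. v) z = (e \<bullet> u) *\<^sub>R (ricci_op G z *v v)"
  shows "Pr z (tderiv x R z *v Pr z y) = (e \<bullet> (Linv z *v x)) *\<^sub>R (R z *v y)"
proof -
  define u where "u = Linv z *v x"
  define v where "v = Linv z *v y"
  have Q: "ricci_op G w *v v = Linv w *v (R w *v D f w v)" if "w \<in> \<Omega>" for w v
    by (simp add: ricci_op_eq[OF that] matrix_vector_mul_assoc[symmetric] J_apply that)
  have sRD: "smooth_on (\<lambda>w. R w *v D f w v) \<Omega>"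
    by (intro smooth_bilinear[OF _ bounded_bilinear_matrix_vector_mult] op smooth_R smooth_Df)
  have d: "(\<lambda>w. ricci_op G w *v v) differentiable (at z)"
    by (rule differentiable_cong[OF op z smooth_differentiable[OF smooth_Linv_apply[OF sRD] z]]) (simp add: Q)
  have "D (\<lambda>w. D f w (ricci_op G w *v v)) z u = D (\<lambda>w. R w *v D f w v) z u"
    by (rule fun_cong, rule D_cong[OF op z, symmetric])
      (auto simp: Q f_Linv Pr_R intro!: smooth_differentiable[OF sRD] z)
  also have "\<dots> = R z *v d2f u v z + D R z u *v D f z v"
    unfolding d2f_def by (intro D_bilinear[OF bounded_bilinear_matrix_vector_mult] smooth_differentiable[OF smooth_R] Df_diff z)
  finally have 1: "cov_deriv G (\<lambda>_. u) (\<lambda>w. ricci_op G w *v v) z = Linv z *v (R z *v d2f u v z) + Linv z *v (D R z u *v D f z v)"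
    by (simp add: cov_deriv_eq[OF z d] matrix_vector_right_distrib)
  have "ricci_op G z *v cov_deriv G (\<lambda>_. u) (\<lambda>_. v) z = Linv z *v (R z *v d2f u v z)"
    by (simp add: Q[OF z] cov_deriv_const[OF z] f_Linv[OF z] R_Pr[OF z])
  with 1 rec[of u v] have "Linv z *v (D R z u *v D f z v) = (e \<bullet> u) *\<^sub>R (Linv z *v (R z *v D f z v))"
    by (simp add: cov_deriv_endo_def Q[OF z])
  then have "D f z (Linv z *v (D R z u *v D f z v)) = (e \<bullet> u) *\<^sub>R D f z (Linv z *v (R z *v D f z v))"
    using D_lin_scaleR[OF f_diff[OF z]] by simp
  then show ?thesis
    by (simp add: f_Linv[OF z] Pr_R[OF z] tderiv_def u_def v_def R_Pr[OF z])
qed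

text \<open>Existence in the definite description of \<open>shape_op\<close> is the Weingarten
  formula, uniqueness the injectivity of the differential; the trace is then moved to the ambient
  space by cyclicity.\<close>

lemma mean_curvature_eq:
  assumes z: "z \<in> \<Omega>"
  shows "mean_curvature f \<nu> z = trace (A z) / CARD('n)"
proof -
  have *: "shape_op f \<nu> z = Linv z ** A z ** J z"
    unfolding shape_op_def
  proof (rule the_equality)
    have "D \<nu> z v = - (A z *v D f z v)" for v
      using tderiv_normal[OF z, of "D f z v"] tderiv_D[OF z, of v \<nu>] by simp
    moreover have "Pr z (A z *v w) = A z *v w" for w by (simp add: Pr_def nu_A[OF z])
    ultimately show "\<forall>v. D \<nu> z v = - D f z ((Linv z ** A z ** J z) *v v)"
      by (simp add: matrix_vector_mul_assoc[symmetric] J_apply f_Linv z)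
    fix S assume S: "\<forall>v. D \<nu> z v = - D f z (S *v v)"
    show "S = Linv z ** A z ** J z"
    proof (subst matrix_eq, intro allI)
      fix v
      have "A z *v D f z v = D f z (S *v v)"
        using S tderiv_normal[OF z, of "D f z v"] tderiv_D[OF z, of v \<nu>] by simp
      then show "S *v v = (Linv z ** A z ** J z) *v v"
        by (simp add: matrix_vector_mul_assoc[symmetric] J_apply Linv_J z)
    qed
  qed
  have "trace (Linv z ** A z ** J z) = trace (J z ** Linv z ** A z)"
    using trace_mul_sym[of "Linv z ** A z" "J z"] by (simp add: matrix_mul_assoc)
  also have "\<dots> = trace (A z ** (J z ** Linv z))"
    by (rule trace_mul_sym)
  also have "A z ** (J z ** Linv z) = A z"
    by (simp add: matrix_eq matrix_vector_mul_assoc[symmetric] J_apply f_Linv A_Pr z)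
  finally show ?thesis by (simp add: mean_curvature_def *)
qed

end

section \<open>Pointwise algebra\<close>

text \<open>A trace for plain functions, so that maps such as
  \<open>\<lambda>y. tderiv y \<tau> z\<close> need not be turned into matrices.\<close>

definition tr :: "(real^'k::finite \<Rightarrow> real^'k) \<Rightarrow> real" where "tr T = (\<Sum>i\<in>UNIV. T (axis i 1) $ i)"

lemma trace_tr: "trace M = tr ((*v) M)"
  by (simp add: trace_def tr_def matrix_mult_dot inner_axis)

lemma tr_add: "tr (\<lambda>y. T y + S y) = tr T + tr S"
  by (simp add: tr_def sum.distrib)

lemma tr_diff: "tr (\<lambda>y. T y - S y) = tr T - tr S"
  by (simp add: tr_def sum_subtractf)

lemma tr_scaleR: "tr (\<lambda>y. c *\<^sub>R T y) = c * tr T"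
  by (simp add: tr_def sum_distrib_left)

lemma tr_rank_one: "tr (\<lambda>y. (x \<bullet> y) *\<^sub>R w) = x \<bullet> w"
  by (simp add: tr_def inner_axis) (simp add: inner_vec_def)

lemma tr_rank_one_scaled:
  "tr (\<lambda>y. ((x \<bullet> y) / d) *\<^sub>R w) = (x \<bullet> w) / d"
  "tr (\<lambda>y. (c * (x \<bullet> y)) *\<^sub>R w) = c * (x \<bullet> w)"
  "tr (\<lambda>y. (c * (x \<bullet> y) / d) *\<^sub>R w) = c * (x \<bullet> w) / d"
  using tr_rank_one[of x "(1/d) *\<^sub>R w"] tr_rank_one[of x "c *\<^sub>R w"] tr_rank_one[of x "(c/d) *\<^sub>R w"]
  by (simp_all add: mult.commute)

text \<open>For self-adjoint \<open>T\<close> the trace of its square is the sum of the squared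
  lengths of the images of the basis vectors.\<close>

lemma tr_square_eq_0:
  assumes "linear T" "\<And>x y. T x \<bullet> y = x \<bullet> T y" "tr (\<lambda>y. T (T y)) = 0"
  shows "T y = 0"
proof -
  have "T (T (axis i 1)) $ i = T (axis i 1) \<bullet> T (axis i 1)" for i
    using assms(2)[of "T (axis i 1)" "axis i 1"] by (simp add: inner_axis)
  then have "(\<Sum>i\<in>UNIV. T (axis i 1) \<bullet> T (axis i 1)) = 0"
    using assms(3) by (simp add: tr_def)
  then have 0: "T (axis i 1) = 0" for i
    by (simp add: sum_nonneg_eq_0_iff)
  have "T y = T (\<Sum>i\<in>UNIV. y $ i *\<^sub>R axis i 1)" by (simp add: vec_axis_expand)
  then show ?thesis by (simp add: linear_sum[OF assms(1)] linear_cmul[OF assms(1)] 0)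
qed

lemma inner_eqI: "(\<And>x. x \<bullet> u = x \<bullet> v) \<Longrightarrow> u = (v :: 'a::real_inner)"
  using vector_eq_ldot by blast

text \<open>To be read with \<open>a = A/k\<close>, \<open>F v = (\<nabla>\<^sub>v a) \<tau>\<close>, \<open>D\<tau> = \<nabla>\<^sub>\<tau> a\<close> and \<open>hh\<close> the Hessian of \<open>k\<close>: \<open>D_rel\<close> and
  \<open>F2\<close> express that \<open>a - a\<^sup>2\<close> is parallel, \<open>F1\<close> is the Codazzi equation, and \<open>F3\<close> comes from
  differentiating \<open>a \<tau> = - \<tau>/2\<close>.  By \<open>F2\<close> and its transpose, \<open>D\<tau>\<close> is a multiple of \<open>b\<^sup>2 - (3/2) b\<close>,
  where \<open>b\<close> is the part of \<open>a\<close> orthogonal to \<open>\<tau>\<close>; then \<open>D\<tau>\<close> is a multiple of an orthogonal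
  projection, and it vanishes because its trace does.\<close>

lemma pointwise_algebra:
  fixes a D\<tau> F hh :: "real^'m::finite \<Rightarrow> real^'m"
  assumes lin: "linear a" "linear D\<tau>" "linear hh"
    and a_sym: "\<And>x y. a x \<bullet> y = x \<bullet> a y" and D_sym: "\<And>x y. D\<tau> x \<bullet> y = x \<bullet> D\<tau> y"
    and h_sym: "\<And>x y. hh x \<bullet> y = x \<bullet> hh y"
    and a_tau: "a \<tau> = (-1/2) *\<^sub>R \<tau>" and s: "s = \<tau> \<bullet> \<tau>" "s \<noteq> 0" and k: "k \<noteq> 0"
    and D_rel: "\<And>y. D\<tau> y = a (D\<tau> y) + D\<tau> (a y)"
    and F1: "\<And>y. F y = (s / k) *\<^sub>R a y + ((\<tau> \<bullet> y) / (2 * k)) *\<^sub>R \<tau> + D\<tau> y"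
    and F2: "\<And>y. a (F y) = (3/2) *\<^sub>R F y"
    and F3: "\<And>y. F y = - (a (hh y) + (1/2) *\<^sub>R hh y)"
    and trD: "tr D\<tau> = 0" and tra: "tr a = 1"
  defines "\<alpha> \<equiv> (\<tau> \<bullet> hh \<tau>) / s"
  shows "hh \<tau> = \<alpha> *\<^sub>R \<tau>" "tr (\<lambda>y. a (a y)) = 5/2"
    "tr hh = \<alpha> - 3 * s / (4 * k)" "tr (\<lambda>y. hh (hh y)) = \<alpha>\<^sup>2 + 9 * s\<^sup>2 / (16 * k\<^sup>2)"
proof -
  note la = linear_add[OF lin(1)] linear_cmul[OF lin(1)]
  note lD = linear_add[OF lin(2)] linear_cmul[OF lin(2)]
  note ls = inner_add_right inner_add_left inner_scaleR_right inner_scaleR_left inner_minus_right inner_diff_right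
  have F_sym: "F x \<bullet> y = x \<bullet> F y" for x y
    unfolding F1 by (simp add: ls a_sym D_sym inner_commute[of x \<tau>])
  have Fa: "F (a y) = (3/2) *\<^sub>R F y" for y
  proof (rule inner_eqI)
    fix x
    have "x \<bullet> F (a y) = a (F x) \<bullet> y" by (simp add: F_sym[symmetric] a_sym)
    then show "x \<bullet> F (a y) = x \<bullet> (3/2) *\<^sub>R F y" by (simp add: F2 F_sym)
  qed
  have lF: "F (c *\<^sub>R y) = c *\<^sub>R F y" for c y
    unfolding F1 by (simp add: la lD scaleR_add_right)
  \<comment> \<open>\<open>Fa\<close> gives the factor 3/2 where the eigenvalue of \<open>a\<close>
    on \<open>\<tau>\<close> gives -1/2.\<close>
  have F_tau: "F \<tau> = 0"
    using Fa[of \<tau>] unfolding a_tau lF by (simp add: scaleR_left_distrib[symmetric] flip: scaleR_minus_left)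
  have D_tau: "D\<tau> \<tau> = 0"
    using F1[of \<tau>] s k by (simp add: F_tau a_tau mult.commute[of k 2])
  have tau_D: "\<tau> \<bullet> D\<tau> y = 0" for y using D_sym[of \<tau> y] by (simp add: D_tau)
  have tau_F: "\<tau> \<bullet> F y = 0" for y using F_sym[of \<tau> y] by (simp add: F_tau)
  \<comment> \<open>Changes the eigenvalue of \<open>a\<close> on \<open>\<tau>\<close> from -1/2 to
    0 and leaves \<open>a\<close> unchanged on the orthogonal complement of
    \<open>\<tau>\<close>.\<close>
  define b where "b y = a y + ((\<tau> \<bullet> y) / (2 * s)) *\<^sub>R \<tau>" for y
  have b_sym: "b x \<bullet> y = x \<bullet> b y" for x y by (simp add: b_def ls a_sym inner_commute[of x \<tau>])
  have b_tau: "b \<tau> = 0" using s by (simp add: b_def a_tau)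
  have lb: "b (x + y) = b x + b y" "b (c *\<^sub>R y) = c *\<^sub>R b y" for x y c
    by (simp_all add: b_def la ls scaleR_add_right add_divide_distrib scaleR_add_left)
  have bD: "b (D\<tau> y) = a (D\<tau> y)" for y by (simp add: b_def tau_D)
  have Db: "D\<tau> (b y) = D\<tau> (a y)" for y by (simp add: b_def lD D_tau)
  have bF: "b (F y) = (3/2) *\<^sub>R F y" for y by (simp add: b_def tau_F F2)
  define c where "c = s / k"
  have c0: "c \<noteq> 0" using s k by (simp add: c_def)
  have Fb: "F y = c *\<^sub>R b y + D\<tau> y" for y
    using s by (simp add: F1 b_def c_def scaleR_add_right)
  have Fbb: "F (b y) = (3/2) *\<^sub>R F y" for y
    by (rule inner_eqI) (metis F_sym bF b_sym inner_scaleR_left inner_scaleR_right)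
  \<comment> \<open>Add the relations b F = (3/2) F and F b = (3/2) F, insert F = c b +
    \<open>D\<tau>\<close>, and use that \<open>D\<tau>\<close> is the sum of its products with
    \<open>b\<close> from the left and from the right.\<close>
  have D_eq: "D\<tau> y = c *\<^sub>R (b (b y) - (3/2) *\<^sub>R b y)" for y
  proof (rule inner_eqI)
    fix x
    have "x \<bullet> b (F y) = x \<bullet> (3/2) *\<^sub>R F y" "x \<bullet> F (b y) = x \<bullet> (3/2) *\<^sub>R F y"
      "x \<bullet> D\<tau> y = x \<bullet> b (D\<tau> y) + x \<bullet> D\<tau> (b y)"
      by (simp_all only: bF Fbb bD Db inner_add_right[symmetric] D_rel[symmetric])
    then show "x \<bullet> D\<tau> y = x \<bullet> c *\<^sub>R (b (b y) - (3/2) *\<^sub>R b y)"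
      unfolding Fb by (simp add: lb ls algebra_simps)
  qed
  have bminus: "b (x - y) = b x - b y" for x y
    using lb(1)[of "x - y" y] by (simp add: algebra_simps)
  have comm: "b (D\<tau> y) = D\<tau> (b y)" for y by (simp add: D_eq lb bminus)
  \<comment> \<open>Being a polynomial in \<open>b\<close>, the map \<open>D\<tau>\<close> commutes
    with \<open>b\<close>, so the two summands in \<open>D_rel\<close> coincide.\<close>
  have bD2: "b (D\<tau> y) = (1/2) *\<^sub>R D\<tau> y" for y
  proof -
    have "D\<tau> y = 2 *\<^sub>R b (D\<tau> y)" using D_rel[of y] by (simp add: bD[symmetric] Db[symmetric] comm[symmetric] scaleR_2)
    then show ?thesis by (metis divide_self_if field_sum_of_halves scaleR_half_double scaleR_2 scaleR_scaleR mult_2 one_neq_zero scaleR_one)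
  qed
  \<comment> \<open>On the range of \<open>D\<tau>\<close> the map \<open>b\<close> is 1/2, and c
    (1/4 - 3/4) = -c/2.\<close>
  have DD: "D\<tau> (D\<tau> y) = (- c / 2) *\<^sub>R D\<tau> y" for y
    by (subst D_eq) (simp add: bD2 lb scaleR_diff_left[symmetric])
  have "tr (\<lambda>y. D\<tau> (D\<tau> y)) = 0" by (simp only: DD tr_scaleR trD mult_zero_right)
  then have D0: "D\<tau> y = 0" for y by (rule tr_square_eq_0[OF lin(2) D_sym])
  have bb: "b (b y) = (3/2) *\<^sub>R b y" for y using D_eq[of y] c0 by (simp add: D0)
  have tau_b: "\<tau> \<bullet> b y = 0" for y using b_sym[of \<tau> y] by (simp add: b_tau)
  have b_h: "b (hh y) = (- 3 * c / 4) *\<^sub>R b y" and h_eq: "hh y = (- c / 2) *\<^sub>R b y + ((\<tau> \<bullet> hh y) / s) *\<^sub>R \<tau>" for y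
  proof -
    have a_h: "a (hh y) = b (hh y) - ((\<tau> \<bullet> hh y) / (2 * s)) *\<^sub>R \<tau>" by (simp add: b_def)
    have 1: "c *\<^sub>R b y = - (b (hh y) - ((\<tau> \<bullet> hh y) / (2 * s)) *\<^sub>R \<tau> + (1/2) *\<^sub>R hh y)"
      using F3[of y] by (simp add: Fb D0 a_h)
    have bneg: "b (- x) = - b x" for x using lb(2)[of "-1" x] by simp
    \<comment> \<open>Applying \<open>b\<close> to \<open>1\<close> removes the
      \<open>\<tau>\<close> term; as b^2 = (3/2) b, both terms with \<open>hh\<close> become
      multiples of \<open>b (hh y)\<close>, which can be solved for and put back into
      \<open>1\<close>.\<close>
    have 2: "b (c *\<^sub>R b y) = b (- (b (hh y) - ((\<tau> \<bullet> hh y) / (2 * s)) *\<^sub>R \<tau> + (1/2) *\<^sub>R hh y))"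
      by (simp only: 1)
    show 3: "b (hh y) = (- 3 * c / 4) *\<^sub>R b y"
    proof (rule inner_eqI)
      fix x
      show "x \<bullet> b (hh y) = x \<bullet> (- 3 * c / 4) *\<^sub>R b y"
        using arg_cong[OF 2, of "\<lambda>v. x \<bullet> v"] by (simp add: lb bneg bminus bb b_tau ls)
    qed
    show "hh y = (- c / 2) *\<^sub>R b y + ((\<tau> \<bullet> hh y) / s) *\<^sub>R \<tau>"
    proof (rule inner_eqI)
      fix x
      show "x \<bullet> hh y = x \<bullet> ((- c / 2) *\<^sub>R b y + ((\<tau> \<bullet> hh y) / s) *\<^sub>R \<tau>)"
        using arg_cong[OF 1, of "\<lambda>v. x \<bullet> v"] s by (simp add: 3 ls field_simps)
    qed
  qed
  show h_tau: "hh \<tau> = \<alpha> *\<^sub>R \<tau>" using h_eq[of \<tau>] by (simp add: b_tau \<alpha>_def)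
  have "\<tau> \<bullet> hh y = \<alpha> * (\<tau> \<bullet> y)" for y using h_sym[of \<tau> y] by (simp add: h_tau)
  then have hh: "hh y = (- c / 2) *\<^sub>R b y + (\<alpha> / s) *\<^sub>R ((\<tau> \<bullet> y) *\<^sub>R \<tau>)" for y
    using h_eq[of y] by simp
  have bf: "b = (\<lambda>y. a y + (1 / (2 * s)) *\<^sub>R ((\<tau> \<bullet> y) *\<^sub>R \<tau>))" by (simp add: b_def fun_eq_iff)
  have trb: "tr b = 3/2"
    by (subst bf) (use s in \<open>simp add: tr_add tr_diff tr_scaleR tr_rank_one tr_rank_one_scaled tra\<close>)
  have "a (a y) = b (b y) + (1 / (4 * s)) *\<^sub>R ((\<tau> \<bullet> y) *\<^sub>R \<tau>)" for y
  proof -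
    have "a x = b x - ((\<tau> \<bullet> x) / (2 * s)) *\<^sub>R \<tau>" for x by (simp add: b_def)
    then show ?thesis
      using s by (simp add: bminus lb b_tau tau_b inner_diff_right)
  qed
  then show "tr (\<lambda>y. a (a y)) = 5/2"
    using s by (simp add: tr_add tr_diff tr_scaleR tr_rank_one tr_rank_one_scaled bb trb)
  show "tr hh = \<alpha> - 3 * s / (4 * k)"
    by (subst hh[abs_def]) (use s in \<open>simp add: tr_add tr_diff tr_scaleR tr_rank_one tr_rank_one_scaled trb c_def\<close>)
  have "hh (hh y) = (3 * c\<^sup>2 / 8) *\<^sub>R b y + (\<alpha>\<^sup>2 / s) *\<^sub>R ((\<tau> \<bullet> y) *\<^sub>R \<tau>)" for y
    using s by (simp add: hh lb bminus bb b_tau tau_b ls power2_eq_square mult.assoc)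
  then show "tr (\<lambda>y. hh (hh y)) = \<alpha>\<^sup>2 + 9 * s\<^sup>2 / (16 * k\<^sup>2)"
    using s by (simp add: tr_add tr_diff tr_scaleR tr_rank_one tr_rank_one_scaled trb c_def power_divide)
qed

section \<open>The biharmonic and the recurrence equations\<close>

lemma vec_sum_axis: "linear T \<Longrightarrow> (\<Sum>i\<in>UNIV. y $ i *\<^sub>R T (axis i 1)) = T (y :: real^'k::finite)"
  by (metis (mono_tags, lifting) linear_cmul linear_sum sum.cong vec_axis_expand)

context hypersurface_patch
begin

text \<open>\<open>k\<close> is \<open>n\<close> times the mean curvature and \<open>\<tau>\<close> its gradient.\<close>

definition k :: "real^'n \<Rightarrow> real" where "k z = trace (A z)"
definition \<tau> :: "real^'n \<Rightarrow> real^'m" where "\<tau> z = (\<chi> i. tderiv (axis i 1) k z)"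
definition normsq_A :: "real^'n \<Rightarrow> real" where "normsq_A z = trace (A z ** A z)"

lemma smooth_k: "smooth_on k \<Omega>"
  unfolding k_def[abs_def] by (intro smooth_linear[OF _ bounded_linear_trace] op smooth_A)

lemma k_diff: "z \<in> \<Omega> \<Longrightarrow> k differentiable (at z)"
  using smooth_differentiable[OF smooth_k] .

lemma smooth_tau: "smooth_on \<tau> \<Omega>"
  unfolding \<tau>_def[abs_def] by (intro smooth_vec op smooth_tderiv_const smooth_k)

lemma tau_diff: "z \<in> \<Omega> \<Longrightarrow> \<tau> differentiable (at z)"
  using smooth_differentiable[OF smooth_tau] .

lemma tderiv_k: "z \<in> \<Omega> \<Longrightarrow> tderiv w k z = \<tau> z \<bullet> w"
  using tderiv_expand[OF k_diff, of z w] by (simp add: \<tau>_def inner_vec_def mult.commute)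

lemma tau_nu: "z \<in> \<Omega> \<Longrightarrow> \<tau> z \<bullet> \<nu> z = 0"
  using tderiv_nu[OF k_diff, of z] by (simp add: tderiv_k)

lemma Pr_tau: "z \<in> \<Omega> \<Longrightarrow> Pr z (\<tau> z) = \<tau> z"
  by (simp add: Pr_def tau_nu inner_commute[of "\<nu> z" "\<tau> z"])

lemma tderiv_tau_inner: "z \<in> \<Omega> \<Longrightarrow> tderiv u \<tau> z \<bullet> v = tderiv u (tderiv v k) z"
proof -
  assume z: "z \<in> \<Omega>"
  have "tderiv u (tderiv v k) z = tderiv u (\<lambda>w. \<tau> w \<bullet> v) z"
    by (rule tderiv_cong[OF z smooth_tderiv_const[OF smooth_k]]) (simp add: tderiv_k)
  then show ?thesis
    by (simp add: tderiv_inner[OF tau_diff[OF z]] tderiv_const)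
qed

text \<open>For tangent \<open>u\<close> and \<open>v\<close> this is the symmetry of the Hessian of
  \<open>k\<close>; the right side collects the effect of normal components.\<close>

lemma tau_commutator:
  assumes z: "z \<in> \<Omega>"
  shows "tderiv u \<tau> z \<bullet> v - tderiv v \<tau> z \<bullet> u = (\<nu> z \<bullet> v) * (\<tau> z \<bullet> (A z *v u)) - (\<nu> z \<bullet> u) * (\<tau> z \<bullet> (A z *v v))"
  using commutator[OF z smooth_k, of u v] by (simp add: tderiv_tau_inner z tderiv_k)

lemma tderiv_trace_A: "z \<in> \<Omega> \<Longrightarrow> tr (\<lambda>v. tderiv u A z *v v) = \<tau> z \<bullet> u"
proof -
  assume z: "z \<in> \<Omega>"
  have "\<tau> z \<bullet> u = trace (tderiv u A z)"
    using tderiv_linear[OF bounded_linear_trace A_diff[OF z], of u] by (simp add: tderiv_k[OF z, symmetric] k_def[abs_def])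
  then show ?thesis by (simp add: trace_tr)
qed

lemma normsq_A_tr: "normsq_A z = tr (\<lambda>v. A z *v (A z *v v))"
  by (simp add: normsq_A_def trace_tr matrix_vector_mul_assoc)

lemma linear_A: "linear (\<lambda>v. A z *v v)" by simp

text \<open>Contracted Codazzi equation: after exchanging the differentiation direction with the
  test vector \<open>w\<close>, the trace is the derivative of \<open>k\<close> along
  \<open>w\<close>. The normal part with \<open>normsq_A\<close> comes from the correction terms in
  \<open>codazzi\<close>.\<close>

lemma div_A:
  assumes z: "z \<in> \<Omega>"
  shows "(\<Sum>i\<in>UNIV. tderiv (axis i 1) A z *v axis i 1) = \<tau> z + normsq_A z *\<^sub>R \<nu> z"
proof (rule inner_eqI)
  fix w
  have "w \<bullet> (tderiv (axis i 1) A z *v axis i 1) = (tderiv w A z *v axis i 1) $ i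
      + (\<nu> z \<bullet> w) * (A z *v (A z *v axis i 1)) $ i - ((\<nu> z \<bullet> axis i 1) *\<^sub>R (A z *v (A z *v w))) $ i" for i
  proof -
    have "w \<bullet> (tderiv (axis i 1) A z *v axis i 1) = (tderiv (axis i 1) A z *v w) \<bullet> axis i 1"
      using dA_sym[OF z, of "axis i 1" w "axis i 1"] by (simp add: inner_commute)
    also have "tderiv (axis i 1) A z *v w = tderiv w A z *v axis i 1 + (\<nu> z \<bullet> w) *\<^sub>R (A z *v (A z *v axis i 1)) - (\<nu> z \<bullet> axis i 1) *\<^sub>R (A z *v (A z *v w))"
      using codazzi[OF z, of "axis i 1" w] by (simp add: algebra_simps)
    finally show ?thesis by (simp add: inner_axis)
  qed
  then have "w \<bullet> (\<Sum>i\<in>UNIV. tderiv (axis i 1) A z *v axis i 1) =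
    tr (\<lambda>v. tderiv w A z *v v) + (\<nu> z \<bullet> w) * normsq_A z - tr (\<lambda>v. (\<nu> z \<bullet> v) *\<^sub>R (A z *v (A z *v w)))"
    by (simp add: inner_sum_right tr_def sum.distrib sum_subtractf sum_distrib_left normsq_A_tr)
  moreover have "tr (\<lambda>v. (\<nu> z \<bullet> v) *\<^sub>R (A z *v (A z *v w))) = 0"
    by (simp add: tr_rank_one nu_A[OF z])
  ultimately show "w \<bullet> (\<Sum>i\<in>UNIV. tderiv (axis i 1) A z *v axis i 1) = w \<bullet> (\<tau> z + normsq_A z *\<^sub>R \<nu> z)"
    by (simp add: tderiv_trace_A z inner_add_right inner_commute mult.commute)
qed

text \<open>Product rule: the mixed first derivatives sum to the term with
  \<open>A z *v \<tau> z\<close> and its factor 2, while the second derivatives of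
  \<open>\<nu>\<close> sum to minus the divergence of \<open>A\<close>, evaluated by
  \<open>div_A\<close>. The sum is the trace of the second derivative, that is, minus the
  Laplacian.\<close>

lemma laplacian_knu:
  assumes z: "z \<in> \<Omega>"
  shows "(\<Sum>b\<in>UNIV. tderiv (axis b 1) (tderiv (axis b 1) (\<lambda>w. k w *\<^sub>R \<nu> w)) z) =
    (tr (\<lambda>b. tderiv b \<tau> z) - k z * normsq_A z) *\<^sub>R \<nu> z - 2 *\<^sub>R (A z *v \<tau> z) - k z *\<^sub>R \<tau> z"
proof -
  have dnn: "tderiv b \<nu> differentiable (at z)" and dkk: "tderiv b k differentiable (at z)" for b
    using smooth_differentiable[OF smooth_tderiv_const z] smooth_nu smooth_k by blast+
  note sc = bounded_bilinear_scaleR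
  have *: "tderiv b (tderiv b (\<lambda>w. k w *\<^sub>R \<nu> w)) z =
    (tderiv b \<tau> z \<bullet> b) *\<^sub>R \<nu> z - ((\<tau> z \<bullet> b) *\<^sub>R (A z *v b) + (\<tau> z \<bullet> b) *\<^sub>R (A z *v b)) - k z *\<^sub>R (tderiv b A z *v b)" for b
  proof -
    have "tderiv b (tderiv b (\<lambda>w. k w *\<^sub>R \<nu> w)) z = tderiv b (\<lambda>w. k w *\<^sub>R tderiv b \<nu> w + tderiv b k w *\<^sub>R \<nu> w) z"
      by (rule tderiv_cong[OF z]) (auto intro!: smooth_tderiv_const smooth_bilinear[OF op sc] smooth_k smooth_nu simp: tderiv_scaleR k_diff nu_diff)
    also have "\<dots> = k z *\<^sub>R tderiv b (tderiv b \<nu>) z + tderiv b k z *\<^sub>R tderiv b \<nu> z + (tderiv b k z *\<^sub>R tderiv b \<nu> z + tderiv b (tderiv b k) z *\<^sub>R \<nu> z)"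
      by (subst tderiv_add) (simp_all add: differentiable_bilinear[OF sc] tderiv_scaleR k_diff nu_diff z dnn dkk)
    also have "tderiv b (tderiv b \<nu>) z = - (tderiv b A z *v b)" by (simp add: dA_apply z)
    finally show ?thesis by (simp add: tderiv_normal z tderiv_k tderiv_tau_inner)
  qed
  have "(\<Sum>b\<in>UNIV. (\<tau> z \<bullet> axis b 1) *\<^sub>R (A z *v axis b 1)) = A z *v \<tau> z"
    using vec_sum_axis[OF linear_A, of "\<tau> z" z] by (simp add: inner_axis)
  moreover have "(\<Sum>b\<in>UNIV. tderiv (axis b 1) \<tau> z \<bullet> axis b 1) = tr (\<lambda>b. tderiv b \<tau> z)"
    by (simp add: tr_def inner_axis)
  ultimately show ?thesis
    unfolding * sum_subtractf sum.distrib scaleR_sum_left[symmetric] scaleR_sum_right[symmetric]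
    by (simp add: div_A[OF z] scaleR_2 algebra_simps)
qed

end

text \<open>Recurrence is recorded pointwise, on constant coordinate fields and with some covector
  \<open>e\<close> at each point; \<open>recurrent_explicit\<close> determines its action where
  \<open>k\<close> and \<open>\<tau>\<close> are nonzero.\<close>

locale biharmonic_patch = metric_patch \<Omega> f \<nu> G
  for \<Omega> :: "(real^'n::finite) set" and f \<nu> :: "real^'n \<Rightarrow> real^'m::finite" and G +
  assumes biharmonic: "z \<in> \<Omega> \<Longrightarrow> laplacian G (mean_curvature_vector f \<nu>) z = 0"
    and recurrent: "z \<in> \<Omega> \<Longrightarrow>
      \<exists>e. \<forall>u v. cov_deriv_endo G (ricci_op G) (\<lambda>_. u) (\<lambda>_. v) z = (e \<bullet> u) *\<^sub>R (ricci_op G z *v v)"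
begin

text \<open>The constant factor relating \<open>k\<close> to the mean curvature is pulled out of the
  Laplacian. Pairing with \<open>\<nu> z\<close> isolates the normal equation, and inserting it
  leaves the tangential one.\<close>

lemma biharmonic_split:
  assumes z: "z \<in> \<Omega>"
  shows "A z *v \<tau> z = (- k z / 2) *\<^sub>R \<tau> z" "tr (\<lambda>b. tderiv b \<tau> z) = k z * normsq_A z"
proof -
  define c where "c = 1 / real CARD('n)"
  have c: "c \<noteq> 0" by (simp add: c_def)
  let ?F = "\<lambda>w. k w *\<^sub>R \<nu> w"
  have sF: "smooth_on ?F \<Omega>"
    by (intro smooth_bilinear[OF op bounded_bilinear_scaleR] smooth_k smooth_nu)
  have m: "c *\<^sub>R ?F w = mean_curvature_vector f \<nu> w" if "w \<in> \<Omega>" for w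
    using that by (simp add: mean_curvature_vector_def mean_curvature_eq k_def c_def divide_inverse mult.commute)
  have sc: "smooth_on (\<lambda>w. c *\<^sub>R ?F w) \<Omega>"
    by (rule smooth_linear[OF op bounded_linear_scaleR_right sF])
  have sm: "smooth_on (mean_curvature_vector f \<nu>) \<Omega>"
    by (rule smooth_cong[OF op m sc])
  have 1: "tderiv b (mean_curvature_vector f \<nu>) w = c *\<^sub>R tderiv b ?F w" if "w \<in> \<Omega>" for w b
  proof -
    have "tderiv b (mean_curvature_vector f \<nu>) w = tderiv b (\<lambda>w. c *\<^sub>R ?F w) w"
      by (rule tderiv_cong[OF that sm]) (simp only: m)
    then show ?thesis
      by (simp only: tderiv_linear[OF bounded_linear_scaleR_right smooth_differentiable[OF sF that]])
  qed
  have "tderiv b (tderiv b (mean_curvature_vector f \<nu>)) z = c *\<^sub>R tderiv b (tderiv b ?F) z" for b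
  proof -
    have "tderiv b (tderiv b (mean_curvature_vector f \<nu>)) z = tderiv b (\<lambda>w. c *\<^sub>R tderiv b ?F w) z"
      by (rule tderiv_cong[OF z smooth_tderiv_const[OF sm] 1])
    then show ?thesis
      by (simp only: tderiv_linear[OF bounded_linear_scaleR_right smooth_differentiable[OF smooth_tderiv_const[OF sF] z]])
  qed
  then have "c *\<^sub>R (\<Sum>b\<in>UNIV. tderiv (axis b 1) (tderiv (axis b 1) ?F) z) = 0"
    using biharmonic[OF z] by (simp add: laplacian_eq[OF z sm] scaleR_sum_right)
  then have eq: "(tr (\<lambda>b. tderiv b \<tau> z) - k z * normsq_A z) *\<^sub>R \<nu> z - 2 *\<^sub>R (A z *v \<tau> z) - k z *\<^sub>R \<tau> z = 0"
    using c by (simp add: laplacian_knu[OF z])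
  from arg_cong[OF eq, of "\<lambda>v. \<nu> z \<bullet> v"] show 1: "tr (\<lambda>b. tderiv b \<tau> z) = k z * normsq_A z"
    using tau_nu[OF z] by (simp add: inner_diff_right unit[OF z] nu_A[OF z] inner_commute)
  show "A z *v \<tau> z = (- k z / 2) *\<^sub>R \<tau> z"
  proof (rule inner_eqI)
    fix x
    show "x \<bullet> (A z *v \<tau> z) = x \<bullet> (- k z / 2) *\<^sub>R \<tau> z"
      using arg_cong[OF eq, of "\<lambda>v. x \<bullet> v"] by (simp add: 1 inner_diff_right)
  qed
qed

lemma R_tau: "z \<in> \<Omega> \<Longrightarrow> R z *v \<tau> z = (- (3/4) * (k z)\<^sup>2) *\<^sub>R \<tau> z"
  by (simp add: R_apply biharmonic_split matrix_vector_mult_scaleR k_def[symmetric] scaleR_diff_left[symmetric] power2_eq_square del: scaleR_minus_left)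

lemma tderiv_R_apply:
  assumes z: "z \<in> \<Omega>"
  shows "tderiv w R z *v y = (\<tau> z \<bullet> w) *\<^sub>R (A z *v y) + k z *\<^sub>R (tderiv w A z *v y) - A z *v (tderiv w A z *v y) - tderiv w A z *v (A z *v y)"
proof -
  have R: "R = (\<lambda>z. k z *\<^sub>R A z - A z ** A z)" by (simp add: R_def k_def fun_eq_iff)
  have "tderiv w R z = k z *\<^sub>R tderiv w A z + tderiv w k z *\<^sub>R A z - (A z ** tderiv w A z + tderiv w A z ** A z)"
    unfolding R
    by (subst tderiv_diff) (simp_all add: differentiable_bilinear[OF bounded_bilinear_scaleR]
       differentiable_bilinear[OF bounded_bilinear_matrix_mult] tderiv_scaleR tderiv_mm k_diff A_diff z)
  then show ?thesis
    by (simp add: tderiv_k z matrix_vector_mult_diff_rdistrib matrix_vector_mult_add_rdistrib scaleR_matrix_vector_assoc[symmetric] matrix_vector_mul_assoc[symmetric])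
qed

lemma inner_Pr: "z \<in> \<Omega> \<Longrightarrow> x \<bullet> \<nu> z = 0 \<Longrightarrow> x \<bullet> Pr z w = x \<bullet> w"
  by (simp add: Pr_def inner_diff_right)

text \<open>Evaluating the recurrence on \<open>\<tau>\<close> identifies the recurrence form as \<open>2 dk / k\<close>.\<close>

lemma recurrent_explicit:
  assumes z: "z \<in> \<Omega>" "k z \<noteq> 0" "\<tau> z \<noteq> 0"
  shows "k z *\<^sub>R Pr z (tderiv w R z *v Pr z y) = (2 * (\<tau> z \<bullet> w)) *\<^sub>R (R z *v y)"
proof -
  obtain e where e: "\<And>u v. cov_deriv_endo G (ricci_op G) (\<lambda>_. u) (\<lambda>_. v) z = (e \<bullet> u) *\<^sub>R (ricci_op G z *v v)"
    using recurrent[OF z(1)] by blast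
  define \<eta> where "\<eta> = e \<bullet> (Linv z *v w)"
  note rec = recurrent_eq[OF z(1) e, of w, folded \<eta>_def]
  have Rd: "R differentiable (at z)" using smooth_differentiable[OF smooth_R z(1)] .
  have kd: "(\<lambda>w. - (3/4) * (k w * k w)) differentiable (at z)"
    by (intro differentiable_mult k_diff z(1)) simp
  have dk2: "tderiv w (\<lambda>w. - (3/4) * (k w * k w)) z = - (3/2) * k z * (\<tau> z \<bullet> w)"
    using tderiv_linear[OF bounded_linear_mult_right differentiable_mult[OF k_diff k_diff, OF z(1) z(1)], of w "- (3/4)"]
    by (simp add: tderiv_mult k_diff z(1) tderiv_k)
  \<comment> \<open>Differentiates the eigenvector equation \<open>R_tau\<close>, which holds on all
    of \<open>\<Omega>\<close>.\<close>
  have "tderiv w (\<lambda>w. R w *v \<tau> w) z = tderiv w (\<lambda>w. (- (3/4) * (k w * k w)) *\<^sub>R \<tau> w) z"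
    by (rule tderiv_cong[OF z(1)])
      (auto intro!: smooth_bilinear[OF op bounded_bilinear_matrix_vector_mult] smooth_R smooth_tau simp: R_tau power2_eq_square)
  then have "R z *v tderiv w \<tau> z + tderiv w R z *v \<tau> z =
     (- (3/4) * (k z)\<^sup>2) *\<^sub>R tderiv w \<tau> z + (- (3/2) * k z * (\<tau> z \<bullet> w)) *\<^sub>R \<tau> z"
    unfolding tderiv_mv[OF Rd tau_diff[OF z(1)]] tderiv_scaleR[OF kd tau_diff[OF z(1)]] dk2 by (simp add: power2_eq_square)
  then have "\<tau> z \<bullet> (R z *v tderiv w \<tau> z + tderiv w R z *v \<tau> z) =
     \<tau> z \<bullet> ((- (3/4) * (k z)\<^sup>2) *\<^sub>R tderiv w \<tau> z + (- (3/2) * k z * (\<tau> z \<bullet> w)) *\<^sub>R \<tau> z)"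
    by simp
  \<comment> \<open>Self-adjointness of \<open>R\<close> cancels the two terms with the derivative
    of \<open>\<tau>\<close>, leaving only the derivative of the eigenvalue.\<close>
  moreover have "\<tau> z \<bullet> (R z *v v) = (R z *v \<tau> z) \<bullet> v" for v
    unfolding R_apply by (simp add: inner_diff_right inner_diff_left A_sym[OF z(1)])
  ultimately have 1: "\<tau> z \<bullet> (tderiv w R z *v \<tau> z) = - (3/2) * k z * (\<tau> z \<bullet> w) * (\<tau> z \<bullet> \<tau> z)"
    by (simp add: inner_add_right inner_diff_right inner_minus_right R_tau[OF z(1)])
  have "\<tau> z \<bullet> Pr z (tderiv w R z *v Pr z (\<tau> z)) = \<eta> * (\<tau> z \<bullet> (R z *v \<tau> z))"
    using rec[of "\<tau> z"] by simp
  then have "- (3/2) * k z * (\<tau> z \<bullet> w) * (\<tau> z \<bullet> \<tau> z) = \<eta> * (- (3/4) * (k z)\<^sup>2 * (\<tau> z \<bullet> \<tau> z))"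
    by (simp add: inner_Pr[OF z(1) tau_nu[OF z(1)]] Pr_tau[OF z(1)] 1 R_tau[OF z(1)])
  then have "k z * \<eta> = 2 * (\<tau> z \<bullet> w)" using z(2,3) by (simp add: power2_eq_square)
  then show ?thesis by (simp add: rec)
qed

end

section \<open>The Hessian of the mean curvature\<close>

context hypersurface_patch
begin

lemma linear_tderiv: "\<phi> differentiable (at z) \<Longrightarrow> linear (\<lambda>w. tderiv w \<phi> z)"
  by (rule linearI) (simp_all add: tderiv_w_add tderiv_w_scaleR)

lemma linear_Pr: "linear (Pr z)"
  by (rule linearI) (simp_all add: Pr_def inner_add_right algebra_simps)

lemma Pr_sym: "Pr z u \<bullet> v = u \<bullet> Pr z v"
  by (simp add: Pr_def inner_diff_left inner_diff_right inner_commute)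

lemma nu_Pr: "z \<in> \<Omega> \<Longrightarrow> \<nu> z \<bullet> Pr z u = 0"
  by (simp add: Pr_def inner_diff_right unit)

lemma Pr_A: "z \<in> \<Omega> \<Longrightarrow> Pr z (A z *v u) = A z *v u"
  by (simp add: Pr_def nu_A)

lemma dA_nu:
  assumes z: "z \<in> \<Omega>"
  shows "tderiv w A z *v \<nu> z = A z *v (A z *v w)"
proof -
  have "tderiv w (\<lambda>w. A w *v \<nu> w) z = 0"
    by (rule tderiv_eq_const[OF z A_nu])
  then show ?thesis
    by (simp add: tderiv_mv[OF A_diff[OF z] nu_diff[OF z]] tderiv_normal[OF z] linear_neg[OF linear_A])
qed

text \<open>Compression to the tangent space discards the row and column of the normal; of these
  only the normal-normal entry meets the trace, and it is zero.\<close>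

lemma tr_Pr_Pr:
  assumes z: "z \<in> \<Omega>" and M: "\<nu> z \<bullet> (M *v \<nu> z) = 0" "\<And>y. \<nu> z \<bullet> (M *v y) = y \<bullet> (M *v \<nu> z)"
  shows "tr (\<lambda>y. Pr z (M *v Pr z y)) = tr (\<lambda>y. M *v y)"
proof -
  have 1: "M *v Pr z y = M *v y - (\<nu> z \<bullet> y) *\<^sub>R (M *v \<nu> z)" for y
    by (simp add: Pr_def matrix_vector_mult_diff_distrib matrix_vector_mult_scaleR)
  have 2: "\<nu> z \<bullet> (M *v Pr z y) = (M *v \<nu> z) \<bullet> y" for y
    by (simp add: 1 inner_diff_right M(1)) (metis M(2) inner_commute)
  have "Pr z (M *v Pr z y) = M *v y - (\<nu> z \<bullet> y) *\<^sub>R (M *v \<nu> z) - ((M *v \<nu> z) \<bullet> y) *\<^sub>R \<nu> z" for y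
    unfolding Pr_def[of z "M *v Pr z y"] 2 by (simp add: 1)
  then show ?thesis
    using M(1) by (simp add: tr_diff tr_rank_one inner_commute[of "M *v \<nu> z" "\<nu> z"])
qed

lemma tderiv_cong_open:
  "open U \<Longrightarrow> z \<in> U \<Longrightarrow> \<phi> differentiable (at z) \<Longrightarrow> (\<And>w. w \<in> U \<Longrightarrow> \<phi> w = \<psi> w) \<Longrightarrow> tderiv v \<phi> z = tderiv v \<psi> z"
  unfolding tderiv_def by (metis D_cong)

end

context biharmonic_patch
begin

text \<open>Feeds \<open>pointwise_algebra\<close> with the geometry at \<open>z\<close>:
  \<open>a\<close> is A/k, \<open>Dw w\<close> its covariant derivative along \<open>w\<close>, and
  \<open>hh\<close> the Hessian of \<open>k\<close>, all extended by zero on the normal. The number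
  \<open>\<alpha>\<close> is the eigenvalue of the Hessian on \<open>\<tau>\<close>.\<close>

lemma gradient_structure:
  assumes z: "z \<in> \<Omega>" and k0: "k z \<noteq> 0" and t0: "\<tau> z \<noteq> 0"
  defines "s \<equiv> \<tau> z \<bullet> \<tau> z" and "\<alpha> \<equiv> 3 * (\<tau> z \<bullet> \<tau> z) / (4 * k z) + 5/2 * k z ^ 3"
  shows "tderiv (\<tau> z) \<tau> z = \<alpha> *\<^sub>R \<tau> z - (k z * s / 2) *\<^sub>R \<nu> z"
    and "normsq_A z = 5/2 * (k z)\<^sup>2"
    and "tr (\<lambda>y. tderiv (tderiv y \<tau> z) \<tau> z) = \<alpha>\<^sup>2 + 9 * s\<^sup>2 / (16 * (k z)\<^sup>2)"
    and "\<tau> z \<bullet> tderiv y \<tau> z = \<alpha> * (\<tau> z \<bullet> y)"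
proof -
  let ?\<kappa> = "k z" and ?t = "\<tau> z"
  have s: "s = ?t \<bullet> ?t" "s \<noteq> 0" using t0 by (auto simp: s_def)
  define a where "a y = (1 / ?\<kappa>) *\<^sub>R (A z *v y)" for y
  define Dw where "Dw w y = (1 / ?\<kappa>) *\<^sub>R (Pr z (tderiv w A z *v Pr z y) - (\<tau> z \<bullet> w) *\<^sub>R a y)" for w y
  define hh where "hh y = Pr z (tderiv y \<tau> z)" for y
  define F where "F y = Dw y ?t" for y
  note td = tau_diff[OF z]
  have ka: "A z *v y = ?\<kappa> *\<^sub>R a y" for y using k0 by (simp add: a_def)
  have la: "linear a" unfolding a_def[abs_def] by (rule linearI) (simp_all add: matrix_vector_right_distrib matrix_vector_mult_scaleR scaleR_add_right mult.commute)
  note la' = linear_add[OF la] linear_cmul[OF la] linear_diff[OF la] linear_neg[OF la]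
  have lDw: "linear (Dw w)" for w unfolding Dw_def[abs_def]
    by (rule linearI) (simp_all add: la' linear_add[OF linear_Pr] linear_cmul[OF linear_Pr] matrix_vector_right_distrib matrix_vector_mult_scaleR algebra_simps)
  note lD' = linear_add[OF lDw] linear_cmul[OF lDw] linear_diff[OF lDw] linear_neg[OF lDw]
  have lh: "linear hh" unfolding hh_def[abs_def]
    by (rule linearI) (simp_all add: linear_add[OF linear_Pr] linear_cmul[OF linear_Pr] tderiv_w_add td tderiv_w_scaleR)
  note lh' = linear_add[OF lh] linear_cmul[OF lh] linear_diff[OF lh]
  have a_sym: "a x \<bullet> y = x \<bullet> a y" for x y by (simp add: a_def A_sym[OF z])
  have a_Pr: "a (Pr z y) = a y" for y by (simp add: a_def A_Pr[OF z])
  have Pr_a: "Pr z (a y) = a y" for y by (simp add: a_def linear_cmul[OF linear_Pr] Pr_A[OF z])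
  have D_sym: "Dw w x \<bullet> y = x \<bullet> Dw w y" for w x y
    unfolding Dw_def by (simp add: inner_diff_left inner_diff_right a_sym Pr_sym dA_sym[OF z])
  have h_sym: "hh x \<bullet> y = x \<bullet> hh y" for x y
  proof -
    have *: "hh x \<bullet> y = tderiv (Pr z x) \<tau> z \<bullet> Pr z y" for x y
      by (simp add: hh_def Pr_sym tderiv_Pr[OF z td])
    show ?thesis
      using tau_commutator[OF z, of "Pr z x" "Pr z y"] by (simp add: * inner_commute[of x] nu_Pr[OF z])
  qed
  have a_tau: "a ?t = (-1/2) *\<^sub>R ?t" using k0 by (simp add: a_def biharmonic_split[OF z])
  \<comment> \<open>The recurrence enters here: \<open>R\<close> is k^2 (a - a^2), and the
    recurrence form 2 dk/k accounts exactly for the derivative of the factor k^2.\<close>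
  have D_rel: "Dw w y = a (Dw w y) + Dw w (a y)" for w y
  proof -
    define B where "B y = Pr z (tderiv w A z *v Pr z y)" for y
    define dk where "dk = \<tau> z \<bullet> w"
    have B: "B y = ?\<kappa> *\<^sub>R Dw w y + dk *\<^sub>R a y" for y using k0 by (simp add: Dw_def B_def dk_def)
    have aB: "a (B y) = a (tderiv w A z *v Pr z y)" for y by (simp add: B_def a_Pr)
    have "Pr z (tderiv w R z *v Pr z y) = dk *\<^sub>R (?\<kappa> *\<^sub>R a y) + ?\<kappa> *\<^sub>R B y - ?\<kappa> *\<^sub>R a (B y) - B (?\<kappa> *\<^sub>R a y)"
      unfolding tderiv_R_apply[OF z] ka a_Pr aB
      by (simp add: linear_add[OF linear_Pr] linear_diff[OF linear_Pr] linear_cmul[OF linear_Pr] Pr_a B_def dk_def)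
    then have e: "?\<kappa> *\<^sub>R (dk *\<^sub>R (?\<kappa> *\<^sub>R a y) + ?\<kappa> *\<^sub>R B y - ?\<kappa> *\<^sub>R a (B y) - B (?\<kappa> *\<^sub>R a y)) =
       (2 * dk) *\<^sub>R (?\<kappa> *\<^sub>R ?\<kappa> *\<^sub>R a y - ?\<kappa> *\<^sub>R a (?\<kappa> *\<^sub>R a y))"
      using recurrent_explicit[OF z k0 t0, of w y] by (simp add: R_apply k_def[symmetric] ka dk_def)
    have "(?\<kappa> * ?\<kappa> * ?\<kappa>) *\<^sub>R Dw w y = (?\<kappa> * ?\<kappa> * ?\<kappa>) *\<^sub>R (a (Dw w y) + Dw w (a y))"
    \<comment> \<open>Pairing with an arbitrary vector turns the identity into a polynomial one
      between real numbers.\<close>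
    proof (rule inner_eqI)
      fix x
      show "x \<bullet> (?\<kappa> * ?\<kappa> * ?\<kappa>) *\<^sub>R Dw w y = x \<bullet> (?\<kappa> * ?\<kappa> * ?\<kappa>) *\<^sub>R (a (Dw w y) + Dw w (a y))"
        using arg_cong[OF e, of "\<lambda>v. x \<bullet> v"] unfolding B
        apply (simp only: la' lD' inner_add_right inner_diff_right inner_scaleR_right)
        apply algebra
        done
    qed
    then show ?thesis using k0 by simp
  qed
  have kF: "?\<kappa> *\<^sub>R F y = Pr z (tderiv y A z *v ?t) + ((\<tau> z \<bullet> y) / 2) *\<^sub>R ?t" for y
    unfolding F_def Dw_def Pr_tau[OF z] a_tau using k0 by simp
  have F1: "F y = (s / ?\<kappa>) *\<^sub>R a y + ((?t \<bullet> y) / (2 * ?\<kappa>)) *\<^sub>R ?t + Dw ?t y" for y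
  proof -
    \<comment> \<open>Codazzi for the two tangent vectors \<open>Pr z y\<close> and
      \<open>\<tau> z\<close>, so that the normal corrections vanish.\<close>
    have "tderiv y A z *v ?t = tderiv ?t A z *v Pr z y"
      using codazzi[OF z, of "Pr z y" ?t] tau_nu[OF z] by (simp add: tderiv_Pr[OF z A_diff[OF z]] nu_Pr[OF z] inner_commute)
    then have "?\<kappa> *\<^sub>R F y = ?\<kappa> *\<^sub>R Dw ?t y + s *\<^sub>R a y + ((\<tau> z \<bullet> y) / 2) *\<^sub>R ?t"
      unfolding kF using k0 by (simp add: Dw_def s_def)
    then have "(1 / ?\<kappa>) *\<^sub>R (?\<kappa> *\<^sub>R F y) = (1 / ?\<kappa>) *\<^sub>R (?\<kappa> *\<^sub>R Dw ?t y + s *\<^sub>R a y + ((\<tau> z \<bullet> y) / 2) *\<^sub>R ?t)" by simp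
    then show ?thesis using k0 by (simp add: scaleR_add_right add_ac mult.commute)
  qed
  have F2: "a (F y) = (3/2) *\<^sub>R F y" for y
  proof (rule inner_eqI)
    fix x
    show "x \<bullet> a (F y) = x \<bullet> (3/2) *\<^sub>R F y"
      using arg_cong[OF D_rel[of y ?t], of "\<lambda>v. x \<bullet> v"] unfolding a_tau lD' F_def by (simp add: inner_add_right inner_diff_right)
  qed
  \<comment> \<open>Comes from differentiating the eigenvector equation of \<open>A\<close> along
    \<open>y\<close> and projecting to the tangent space.\<close>
  have F3: "F y = - (a (hh y) + (1/2) *\<^sub>R hh y)" for y
  proof -
    have kd: "(\<lambda>w. (-1/2) * k w) differentiable (at z)" by (intro differentiable_mult k_diff z) simp
    have dk: "tderiv y (\<lambda>w. (-1/2) * k w) z = (-1/2) * (?t \<bullet> y)"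
      using tderiv_linear[OF bounded_linear_mult_right k_diff[OF z]] by (simp only: tderiv_k[OF z])
    have "tderiv y (\<lambda>w. A w *v \<tau> w) z = tderiv y (\<lambda>w. ((-1/2) * k w) *\<^sub>R \<tau> w) z"
      by (rule tderiv_cong[OF z])
        (auto intro!: smooth_bilinear[OF op bounded_bilinear_matrix_vector_mult] smooth_A smooth_tau simp: biharmonic_split)
    then have "A z *v tderiv y \<tau> z + tderiv y A z *v ?t = ((-1/2) * ?\<kappa>) *\<^sub>R tderiv y \<tau> z + ((-1/2) * (?t \<bullet> y)) *\<^sub>R ?t"
      unfolding tderiv_mv[OF A_diff[OF z] td] tderiv_scaleR[OF kd td] dk .
    from arg_cong[OF this, of "Pr z"] have e: "?\<kappa> *\<^sub>R a (hh y) + Pr z (tderiv y A z *v ?t) = ((-1/2) * ?\<kappa>) *\<^sub>R hh y + ((-1/2) * (?t \<bullet> y)) *\<^sub>R ?t"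
      unfolding linear_add[OF linear_Pr] linear_cmul[OF linear_Pr] Pr_A[OF z] Pr_tau[OF z] hh_def a_Pr Pr_a ka .
    have "?\<kappa> *\<^sub>R F y = ?\<kappa> *\<^sub>R (- (a (hh y) + (1/2) *\<^sub>R hh y))"
    proof (rule inner_eqI)
      fix x
      show "x \<bullet> ?\<kappa> *\<^sub>R F y = x \<bullet> ?\<kappa> *\<^sub>R (- (a (hh y) + (1/2) *\<^sub>R hh y))"
        using arg_cong[OF e, of "\<lambda>v. x \<bullet> v"] unfolding kF
        by (simp add: inner_add_right inner_diff_right inner_minus_right algebra_simps)
    qed
    then show ?thesis using k0 by simp
  qed
  have tra: "tr a = 1"
    unfolding a_def[abs_def] tr_scaleR using k0 by (simp add: k_def trace_tr)
  \<comment> \<open>The trace of \<open>a\<close> is constant: the derivative of the trace of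
    \<open>A\<close> along \<open>\<tau>\<close> is \<open>s\<close>, and so is the subtracted
    term.\<close>
  have trD: "tr (Dw ?t) = 0"
  proof -
    have n: "\<nu> z \<bullet> (tderiv ?t A z *v y) = y \<bullet> (tderiv ?t A z *v \<nu> z)" for y
      using dA_sym[OF z, of ?t "\<nu> z" y] by (simp add: inner_commute)
    have "tr (\<lambda>y. Pr z (tderiv ?t A z *v Pr z y)) = s"
      by (subst tr_Pr_Pr[OF z _ n]) (simp_all add: tderiv_trace_A[OF z] s_def dA_nu[OF z] nu_A[OF z])
    then show ?thesis
      unfolding Dw_def[abs_def] tr_scaleR tr_diff by (simp add: tra s_def)
  qed
  note alg = pointwise_algebra[OF la lDw lh a_sym D_sym h_sym a_tau s k0 D_rel F1 F2 F3 trD tra]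
  define \<beta> where "\<beta> = (?t \<bullet> hh ?t) / s"
  have nu_dt: "\<nu> z \<bullet> tderiv y \<tau> z = - (?\<kappa> / 2) * (?t \<bullet> y)" for y
  proof -
    have "tderiv y (\<lambda>w. \<nu> w \<bullet> \<tau> w) z = 0"
      by (rule tderiv_eq_const[OF z, where c=0]) (metis tau_nu inner_commute)
    then have "\<nu> z \<bullet> tderiv y \<tau> z = (A z *v y) \<bullet> ?t"
      by (simp add: tderiv_inner[OF nu_diff[OF z] td] tderiv_normal[OF z])
    then show ?thesis using A_sym[OF z, of y ?t] by (simp add: biharmonic_split[OF z] inner_commute)
  qed
  have T: "tderiv y \<tau> z = hh y - (?\<kappa> / 2 * (?t \<bullet> y)) *\<^sub>R \<nu> z" for y
    using nu_dt[of y] by (simp add: hh_def Pr_def)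
  have h_nu: "hh (\<nu> z) = 0" by (simp add: hh_def tderiv_nu[OF td z] linear_0[OF linear_Pr])
  have tr_h: "tr (\<lambda>y. tderiv y \<tau> z) = tr hh"
    unfolding T tr_diff using tau_nu[OF z] by (simp add: tr_rank_one_scaled)
  show normsq_A: "normsq_A z = 5/2 * (k z)\<^sup>2"
  proof -
    have "normsq_A z = tr (\<lambda>y. (?\<kappa> * ?\<kappa>) *\<^sub>R a (a y))"
      unfolding normsq_A_tr ka la' by simp
    then show ?thesis by (simp only: tr_scaleR alg(2)) (simp add: power2_eq_square)
  qed
  \<comment> \<open>Two values for the trace of the Hessian: the normal part of the biharmonic
    equation and the pointwise algebra. Comparing them fixes the eigenvalue on
    \<open>\<tau>\<close>.\<close>
  have "?\<kappa> * normsq_A z = \<beta> - 3 * s / (4 * ?\<kappa>)"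
    using biharmonic_split(2)[OF z] alg(3)[folded \<beta>_def] tr_h by simp
  then have \<beta>: "\<beta> = \<alpha>"
    unfolding normsq_A \<alpha>_def s_def by (simp add: power2_eq_square power3_eq_cube)
  have h_tau: "hh ?t = \<alpha> *\<^sub>R ?t" using alg(1)[folded \<beta>_def] by (simp only: \<beta>)
  show "tderiv (\<tau> z) \<tau> z = \<alpha> *\<^sub>R \<tau> z - (k z * s / 2) *\<^sub>R \<nu> z"
    unfolding T h_tau by (simp add: s_def)
  show "\<tau> z \<bullet> tderiv y \<tau> z = \<alpha> * (\<tau> z \<bullet> y)"
    using h_sym[of ?t y] tau_nu[OF z] by (simp add: T h_tau inner_diff_right)
  have TT: "tderiv (tderiv y \<tau> z) \<tau> z = hh (hh y) - (?\<kappa> / 2 * (hh ?t \<bullet> y)) *\<^sub>R \<nu> z" for y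
    using tau_nu[OF z] by (simp add: T lh' h_nu inner_diff_right h_sym)
  show "tr (\<lambda>y. tderiv (tderiv y \<tau> z) \<tau> z) = \<alpha>\<^sup>2 + 9 * s\<^sup>2 / (16 * (k z)\<^sup>2)"
    unfolding TT tr_diff tr_rank_one_scaled(2) using tau_nu[OF z] alg(4)[folded \<beta>_def, unfolded \<beta>]
    by (simp add: h_tau)
qed

end

section \<open>The Bochner identity and the conclusion\<close>

text \<open>In terms of r = s/k everything is polynomial, and the difference of the two sides of the
  equation factors as k r (3/4 r - 21/8 k^3).\<close>

lemma bochner_algebra:
  fixes k s \<alpha> :: real
  assumes "k \<noteq> 0" "s \<noteq> 0" and \<alpha>: "\<alpha> = 3 * s / (4 * k) + 5/2 * k ^ 3"
    and eq: "k * (\<alpha>\<^sup>2 + 9 * s\<^sup>2 / (16 * k\<^sup>2) + 15/2 * k\<^sup>2 * s - k\<^sup>2 * s / 4) + \<alpha> * s =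
      k * \<alpha> * (5/2 * k ^ 3) + (3/2 * \<alpha> + 10 * k ^ 3) * s + k\<^sup>2 * s / 2 * k"
  shows "s = 7/2 * k ^ 4"
proof -
  define r where "r = s / k"
  have s: "s = r * k" and r: "r \<noteq> 0" using assms by (simp_all add: r_def)
  have \<alpha>': "\<alpha> = 3/4 * r + 5/2 * k ^ 3" using assms(1) by (simp add: \<alpha> s)
  have q: "9 * s\<^sup>2 / (16 * k\<^sup>2) = 9/16 * r\<^sup>2" using assms(1) by (simp add: s power_mult_distrib)
  define L where "L = k * (\<alpha>\<^sup>2 + 9/16 * r\<^sup>2 + 15/2 * k\<^sup>2 * s - k\<^sup>2 * s / 4) + \<alpha> * s"
  define R where "R = k * \<alpha> * (5/2 * k ^ 3) + (3/2 * \<alpha> + 10 * k ^ 3) * s + k\<^sup>2 * s / 2 * k"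
  have "k * r * (3/4 * r - 21/8 * k ^ 3) = L - R"
    unfolding L_def R_def s \<alpha>' by (simp add: field_simps power2_eq_square power3_eq_cube)
  also have "\<dots> = 0" using eq[unfolded q] unfolding L_def R_def by simp
  finally have "k * r * (3/4 * r - 21/8 * k ^ 3) = 0" .
  then have "r = 7/2 * k ^ 3" using assms(1) r by simp
  then show ?thesis by (simp add: s eval_nat_numeral)
qed

context hypersurface_patch
begin

text \<open>Exchanging the order of the two derivatives of \<open>\<tau>\<close> by
  \<open>commutator\<close> turns the divergence into a derivative of the trace. The Ricci curvature
  of \<open>\<tau>\<close> is present implicitly: the last term gives minus the squared length of A
  \<tau>, and the normal part of the differentiated field on the left gives the remaining term with
  \<open>k\<close>.\<close>

lemma bochner:
  assumes z: "z \<in> \<Omega>"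
  shows "tr (\<lambda>y. tderiv y (\<lambda>w. tderiv (\<tau> w) \<tau> w) z) =
    tr (\<lambda>y. tderiv (tderiv y \<tau> z) \<tau> z) + tderiv (\<tau> z) (\<lambda>w. tr (\<lambda>b. tderiv b \<tau> w)) z - \<nu> z \<bullet> tderiv (A z *v \<tau> z) \<tau> z"
proof -
  let ?e = "\<lambda>i. axis i (1::real) :: real^'m"
  note sc = bounded_bilinear_scaleR
  note td = tau_diff[OF z]
  have dt: "tderiv (?e j) \<tau> differentiable (at z)" for j
    using smooth_differentiable[OF smooth_tderiv_const[OF smooth_tau] z] .
  have tj: "(\<lambda>w. \<tau> w $ j) differentiable (at z)" for j
    by (rule differentiable_linear[OF bounded_linear_vec_nth td])
  have sV: "smooth_on (\<lambda>w. tderiv (\<tau> w) \<tau> w) \<Omega>" by (rule smooth_tderiv[OF smooth_tau smooth_tau])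
  have dV: "tderiv y (\<lambda>w. tderiv (\<tau> w) \<tau> w) z =
     (\<Sum>j\<in>UNIV. \<tau> z $ j *\<^sub>R tderiv y (tderiv (?e j) \<tau>) z + tderiv y \<tau> z $ j *\<^sub>R tderiv (?e j) \<tau> z)" for y
  proof -
    have "tderiv y (\<lambda>w. tderiv (\<tau> w) \<tau> w) z = tderiv y (\<lambda>w. \<Sum>j\<in>UNIV. \<tau> w $ j *\<^sub>R tderiv (?e j) \<tau> w) z"
      by (rule tderiv_cong[OF z sV]) (simp add: tderiv_expand[OF tau_diff, of _ "\<tau> _"])
    also have "\<dots> = (\<Sum>j\<in>UNIV. tderiv y (\<lambda>w. \<tau> w $ j *\<^sub>R tderiv (?e j) \<tau> w) z)"
      by (intro tderiv_sum differentiable_bilinear[OF sc] tj dt)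
    finally show ?thesis
      by (simp only: tderiv_scaleR[OF tj dt] tderiv_linear[OF bounded_linear_vec_nth td])
  qed
  have L: "tderiv y (\<lambda>w. tr (\<lambda>b. tderiv b \<tau> w)) z = (\<Sum>i\<in>UNIV. tderiv y (tderiv (?e i) \<tau>) z $ i)" for y
    unfolding tr_def
    by (subst tderiv_sum) (simp_all add: dt differentiable_linear[OF bounded_linear_vec_nth] tderiv_linear[OF bounded_linear_vec_nth])
  have Ld: "(\<lambda>w. tr (\<lambda>b. tderiv b \<tau> w)) differentiable (at z)"
    unfolding tr_def by (intro differentiable_sum ballI differentiable_linear[OF bounded_linear_vec_nth] dt) simp
  have lin: "linear (\<lambda>y. tderiv y \<tau> z)" by (rule linear_tderiv[OF td])
  have 1: "(\<Sum>i\<in>UNIV. \<Sum>j\<in>UNIV. tderiv (?e i) \<tau> z $ j * tderiv (?e j) \<tau> z $ i) = tr (\<lambda>y. tderiv (tderiv y \<tau> z) \<tau> z)"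
    by (simp add: tr_def tderiv_expand[OF td, of "tderiv _ \<tau> z"])
  have c: "tderiv (?e i) (tderiv (?e j) \<tau>) z = tderiv (?e j) (tderiv (?e i) \<tau>) z
     + \<nu> z $ j *\<^sub>R tderiv (A z *v ?e i) \<tau> z - \<nu> z $ i *\<^sub>R tderiv (A z *v ?e j) \<tau> z" for i j
    using commutator[OF z smooth_tau, of "?e i" "?e j"] by (simp add: inner_axis algebra_simps)
  have "\<tau> z $ j * tderiv (?e i) (tderiv (?e j) \<tau>) z $ i = \<tau> z $ j * tderiv (?e j) (tderiv (?e i) \<tau>) z $ i
      + (\<tau> z $ j * \<nu> z $ j) * tderiv (A z *v ?e i) \<tau> z $ i - \<tau> z $ j * (\<nu> z $ i * tderiv (A z *v ?e j) \<tau> z $ i)" for i j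
    by (subst c) (simp add: algebra_simps)
  then have "(\<Sum>i\<in>UNIV. \<Sum>j\<in>UNIV. \<tau> z $ j * tderiv (?e i) (tderiv (?e j) \<tau>) z $ i) =
    (\<Sum>i\<in>UNIV. \<Sum>j\<in>UNIV. \<tau> z $ j * tderiv (?e j) (tderiv (?e i) \<tau>) z $ i)
    + (\<Sum>i\<in>UNIV. \<Sum>j\<in>UNIV. (\<tau> z $ j * \<nu> z $ j) * tderiv (A z *v ?e i) \<tau> z $ i)
    - (\<Sum>i\<in>UNIV. \<Sum>j\<in>UNIV. \<tau> z $ j * (\<nu> z $ i * tderiv (A z *v ?e j) \<tau> z $ i))"
    by (simp only: sum.distrib sum_subtractf)
  also have "(\<Sum>i\<in>UNIV. \<Sum>j\<in>UNIV. (\<tau> z $ j * \<nu> z $ j) * tderiv (A z *v ?e i) \<tau> z $ i) = 0"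
    using tau_nu[OF z] by (simp add: sum_distrib_right[symmetric] inner_vec_def)
  also have "(\<Sum>i\<in>UNIV. \<Sum>j\<in>UNIV. \<tau> z $ j * tderiv (?e j) (tderiv (?e i) \<tau>) z $ i) = tderiv (\<tau> z) (\<lambda>w. tr (\<lambda>b. tderiv b \<tau> w)) z"
    by (subst sum.swap, subst tderiv_expand[OF Ld]) (simp add: L sum_distrib_left)
  also have "(\<Sum>i\<in>UNIV. \<Sum>j\<in>UNIV. \<tau> z $ j * (\<nu> z $ i * tderiv (A z *v ?e j) \<tau> z $ i)) = \<nu> z \<bullet> tderiv (A z *v \<tau> z) \<tau> z"
  proof -
    have "tderiv (A z *v \<tau> z) \<tau> z = (\<Sum>j\<in>UNIV. \<tau> z $ j *\<^sub>R tderiv (A z *v ?e j) \<tau> z)"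
      using vec_sum_axis[OF linear_compose[OF linear_A lin], of "\<tau> z" z] by (simp add: o_def)
    then have "\<nu> z \<bullet> tderiv (A z *v \<tau> z) \<tau> z = (\<Sum>j\<in>UNIV. \<tau> z $ j * (\<nu> z \<bullet> tderiv (A z *v ?e j) \<tau> z))"
      by (simp add: inner_sum_right)
    then show ?thesis by (subst sum.swap) (simp add: inner_vec_def sum_distrib_left)
  qed
  finally have 2: "(\<Sum>i\<in>UNIV. \<Sum>j\<in>UNIV. \<tau> z $ j * tderiv (?e i) (tderiv (?e j) \<tau>) z $ i) =
    tderiv (\<tau> z) (\<lambda>w. tr (\<lambda>b. tderiv b \<tau> w)) z + 0 - \<nu> z \<bullet> tderiv (A z *v \<tau> z) \<tau> z" .
  have "tr (\<lambda>y. tderiv y (\<lambda>w. tderiv (\<tau> w) \<tau> w) z) =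
    (\<Sum>i\<in>UNIV. \<Sum>j\<in>UNIV. \<tau> z $ j * tderiv (?e i) (tderiv (?e j) \<tau>) z $ i)
    + (\<Sum>i\<in>UNIV. \<Sum>j\<in>UNIV. tderiv (?e i) \<tau> z $ j * tderiv (?e j) \<tau> z $ i)"
    unfolding tr_def dV by (simp add: sum.distrib)
  then show ?thesis unfolding 1 2 by simp
qed

end

context biharmonic_patch
begin

text \<open>The set to be shown empty. It is open, so identities valid on it can be differentiated
  there.\<close>

definition W :: "(real^'n) set" where "W = {z \<in> \<Omega>. k z \<noteq> 0 \<and> \<tau> z \<noteq> 0}"

lemma open_nonzero: "smooth_on \<phi> \<Omega> \<Longrightarrow> open {z \<in> \<Omega>. \<phi> z \<noteq> 0}"
proof -
  assume "smooth_on \<phi> \<Omega>"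
  then have "open (\<Omega> \<inter> \<phi> -` (- {0}))"
    using continuous_open_preimage[OF smooth_continuous op] by blast
  moreover have "\<Omega> \<inter> \<phi> -` (- {0}) = {z \<in> \<Omega>. \<phi> z \<noteq> 0}" by auto
  ultimately show ?thesis by simp
qed

lemma open_W: "open W"
proof -
  have "W = {z \<in> \<Omega>. k z \<noteq> 0} \<inter> {z \<in> \<Omega>. \<tau> z \<noteq> 0}" by (auto simp: W_def)
  then show ?thesis by (simp add: open_Int open_nonzero smooth_k smooth_tau)
qed

definition s :: "real^'n \<Rightarrow> real" where "s w = \<tau> w \<bullet> \<tau> w"
text \<open>On \<open>W\<close> this is the Hessian eigenvalue from
  \<open>gradient_structure\<close>, now viewed as a function of the point.\<close>

definition \<alpha> :: "real^'n \<Rightarrow> real" where "\<alpha> w = 3 * s w / (4 * k w) + 5/2 * k w ^ 3"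

lemma s_diff: "z \<in> \<Omega> \<Longrightarrow> s differentiable (at z)"
  unfolding s_def[abs_def] by (intro differentiable_bilinear[OF bounded_bilinear_inner] tau_diff)

lemma tderiv_s:
  assumes "z \<in> W"
  shows "tderiv y s z = 2 * \<alpha> z * (\<tau> z \<bullet> y)"
proof -
  have z: "z \<in> \<Omega>" "k z \<noteq> 0" "\<tau> z \<noteq> 0" using assms by (auto simp: W_def)
  show ?thesis
    unfolding s_def[abs_def] tderiv_inner[OF tau_diff tau_diff, OF z(1) z(1)]
    using gradient_structure(4)[OF z, of y] by (simp add: \<alpha>_def s_def inner_commute)
qed

lemma k_power_diff: "z \<in> \<Omega> \<Longrightarrow> (\<lambda>w. c * k w ^ m) differentiable (at z)"
  by (intro differentiable_mult differentiable_power k_diff) simp_all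

lemma tderiv_k_power:
  assumes z: "z \<in> \<Omega>"
  shows "tderiv y (\<lambda>w. c * k w ^ Suc m) z = c * Suc m * k z ^ m * (\<tau> z \<bullet> y)"
proof -
  have kd: "(\<lambda>w. k w ^ m) differentiable (at z)" for m
    by (intro differentiable_power k_diff z)
  have "tderiv y (\<lambda>w. k w ^ Suc m) z = Suc m * k z ^ m * (\<tau> z \<bullet> y)"
  proof (induction m)
    case 0
    then show ?case by (simp add: tderiv_k[OF z])
  next
    case (Suc m)
    have "tderiv y (\<lambda>w. k w ^ Suc (Suc m)) z = k z * tderiv y (\<lambda>w. k w ^ Suc m) z + tderiv y k z * k z ^ Suc m"
      unfolding power_Suc[of _ "Suc m"] by (rule tderiv_mult[OF k_diff[OF z] kd])
    then show ?case unfolding Suc tderiv_k[OF z] by (simp add: algebra_simps)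
  qed
  then show ?thesis
    using tderiv_linear[OF bounded_linear_mult_right kd, of y c "Suc m"] by simp
qed

text \<open>The trace of the derivative of \<open>V\<close> is computed twice on \<open>W\<close>:
  from the explicit form of \<open>V\<close> in terms of \<open>\<tau>\<close> and
  \<open>\<nu>\<close>, and from the Bochner identity. Equating the results is the hypothesis of
  \<open>bochner_algebra\<close>.\<close>

lemma s_eq:
  assumes zW: "z \<in> W"
  shows "s z = 7/2 * k z ^ 4"
proof -
  have z: "z \<in> \<Omega>" "k z \<noteq> 0" "\<tau> z \<noteq> 0" using assms by (auto simp: W_def)
  have Wz: "w \<in> \<Omega>" "k w \<noteq> 0" "\<tau> w \<noteq> 0" if "w \<in> W" for w using that by (auto simp: W_def)
  define V where "V w = tderiv (\<tau> w) \<tau> w" for w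
  have Vd: "V differentiable (at z)"
    unfolding V_def[abs_def] by (rule smooth_differentiable[OF smooth_tderiv[OF smooth_tau smooth_tau] z(1)])
  note V = gradient_structure(1)[OF Wz, folded s_def, folded \<alpha>_def, folded V_def]
  \<comment> \<open>Multiplying \<open>V\<close> by \<open>k\<close> clears the denominator in
    \<open>\<alpha>\<close>, so no quotient has to be differentiated; \<open>p\<close> and
    \<open>q\<close> are the resulting coefficients of \<open>\<tau>\<close> and of minus
    \<open>\<nu>\<close>.\<close>
  define p where "p w = 3/4 * s w + 5/2 * k w ^ 4" for w
  define q where "q w = (1/2 * k w ^ 2) * s w" for w
  have p: "p w = k w * \<alpha> w" if "w \<in> W" for w
    using Wz[OF that] by (simp add: p_def \<alpha>_def field_simps eval_nat_numeral)
  have L: "tr (\<lambda>b. tderiv b \<tau> w) = 5/2 * k w ^ 3" if "w \<in> W" for w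
    using biharmonic_split(2)[OF Wz(1)[OF that]] gradient_structure(2)[OF Wz[OF that]] by (simp add: eval_nat_numeral)
  note md = differentiable_mult[OF _ s_diff[OF z(1)]]
  have pd: "p differentiable (at z)" unfolding p_def[abs_def]
    by (intro differentiable_add md k_power_diff z(1)) simp
  have qd: "q differentiable (at z)" unfolding q_def[abs_def]
    by (intro md k_power_diff z(1))
  have dp: "tderiv y p z = (3/2 * \<alpha> z + 10 * k z ^ 3) * (\<tau> z \<bullet> y)" for y
  proof -
    have "tderiv y p z = tderiv y (\<lambda>w. 3/4 * s w) z + tderiv y (\<lambda>w. 5/2 * k w ^ Suc 3) z"
    proof -
      have d1: "(\<lambda>w. 3/4 * s w) differentiable (at z)" by (rule md) simp
      have "p = (\<lambda>w. 3/4 * s w + 5/2 * k w ^ Suc 3)" by (simp add: p_def fun_eq_iff eval_nat_numeral)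
      then show ?thesis by (simp only: tderiv_add[OF d1 k_power_diff[OF z(1)]])
    qed
    also have "tderiv y (\<lambda>w. 3/4 * s w) z = 3/4 * tderiv y s z"
      by (rule tderiv_linear[OF bounded_linear_mult_right s_diff[OF z(1)]])
    finally show ?thesis unfolding tderiv_s[OF zW] tderiv_k_power[OF z(1)] by (simp add: algebra_simps)
  qed
  have dq: "tderiv y q z = (k z ^ 2 * \<alpha> z + k z * s z) * (\<tau> z \<bullet> y)" for y
  proof -
    have "tderiv y q z = (1/2 * k z ^ 2) * tderiv y s z + tderiv y (\<lambda>w. 1/2 * k w ^ 2) z * s z"
      unfolding q_def[abs_def] by (rule tderiv_mult) (intro k_power_diff s_diff z(1))+
    also have "tderiv y (\<lambda>w. 1/2 * k w ^ 2) z = k z * (\<tau> z \<bullet> y)"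
      using tderiv_k_power[OF z(1), of y "1/2" 1] by (simp add: numeral_2_eq_2)
    finally show ?thesis by (simp add: tderiv_s[OF zW] algebra_simps)
  qed
  note sc = bounded_bilinear_scaleR
  have kV: "k w *\<^sub>R V w = p w *\<^sub>R \<tau> w - q w *\<^sub>R \<nu> w" if "w \<in> W" for w
    by (simp add: V[OF that that that] p[OF that] q_def scaleR_diff_right power2_eq_square mult_ac)
  have "tderiv y (\<lambda>w. k w *\<^sub>R V w) z = tderiv y (\<lambda>w. p w *\<^sub>R \<tau> w - q w *\<^sub>R \<nu> w) z" for y
    by (rule tderiv_cong_open[OF open_W zW]) (simp_all add: kV differentiable_bilinear[OF sc] k_diff z(1) Vd)
  then have "k z *\<^sub>R tderiv y V z + (\<tau> z \<bullet> y) *\<^sub>R V z =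
      p z *\<^sub>R tderiv y \<tau> z + ((3/2 * \<alpha> z + 10 * k z ^ 3) * (\<tau> z \<bullet> y)) *\<^sub>R \<tau> z
      - (q z *\<^sub>R - (A z *v y) + ((k z ^ 2 * \<alpha> z + k z * s z) * (\<tau> z \<bullet> y)) *\<^sub>R \<nu> z)" for y
    by (simp add: tderiv_diff differentiable_bilinear[OF sc] k_diff nu_diff tau_diff z(1) Vd pd qd tderiv_scaleR tderiv_k dp dq tderiv_normal)
  then have "tr (\<lambda>y. k z *\<^sub>R tderiv y V z + (\<tau> z \<bullet> y) *\<^sub>R V z) =
     tr (\<lambda>y. p z *\<^sub>R tderiv y \<tau> z + ((3/2 * \<alpha> z + 10 * k z ^ 3) * (\<tau> z \<bullet> y)) *\<^sub>R \<tau> z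
      - ((- q z) *\<^sub>R (A z *v y) + ((k z ^ 2 * \<alpha> z + k z * s z) * (\<tau> z \<bullet> y)) *\<^sub>R \<nu> z))"
    by simp
  then have "k z * tr (\<lambda>y. tderiv y V z) + \<tau> z \<bullet> V z =
     p z * (5/2 * k z ^ 3) + (3/2 * \<alpha> z + 10 * k z ^ 3) * s z + q z * k z"
    unfolding tr_add tr_diff tr_scaleR tr_rank_one tr_rank_one_scaled(2) L[OF zW] trace_tr[symmetric] k_def[symmetric]
    using tau_nu[OF z(1)] by (simp add: s_def)
  moreover have "\<tau> z \<bullet> V z = \<alpha> z * s z"
    using tau_nu[OF z(1)] by (simp add: V zW inner_diff_right s_def)
  \<comment> \<open>The second evaluation, by Bochner; the trace of the derivative of
    \<open>\<tau>\<close> is 5/2 k^3 on all of \<open>W\<close> and may be differentiated.\<close>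
  moreover have "tr (\<lambda>y. tderiv y V z) = (\<alpha> z)\<^sup>2 + 9 * (s z)\<^sup>2 / (16 * (k z)\<^sup>2) + 15/2 * (k z)\<^sup>2 * s z - (k z)\<^sup>2 * s z / 4"
  proof -
    have "tderiv (\<tau> z) (\<lambda>w. 5/2 * k w ^ 3) z = tderiv (\<tau> z) (\<lambda>w. tr (\<lambda>b. tderiv b \<tau> w)) z"
      by (rule tderiv_cong_open[OF open_W zW k_power_diff[OF z(1)]]) (simp add: L)
    then have "tderiv (\<tau> z) (\<lambda>w. tr (\<lambda>b. tderiv b \<tau> w)) z = 15/2 * (k z)\<^sup>2 * s z"
      using tderiv_k_power[OF z(1), of "\<tau> z" "5/2" 2] by (simp add: s_def eval_nat_numeral)
    moreover have "\<nu> z \<bullet> tderiv (A z *v \<tau> z) \<tau> z = (k z)\<^sup>2 * s z / 4"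
    proof -
      have "tderiv (A z *v \<tau> z) \<tau> z = (- k z / 2) *\<^sub>R V z"
        unfolding biharmonic_split(1)[OF z(1)] V_def by (rule tderiv_w_scaleR[OF tau_diff[OF z(1)]])
      then show ?thesis
        using tau_nu[OF z(1)] unit[OF z(1)] by (simp add: V zW inner_diff_right inner_commute power2_eq_square)
    qed
    ultimately show ?thesis
      using bochner[OF z(1)] gradient_structure(3)[OF z] by (simp add: V_def[abs_def] s_def \<alpha>_def)
  qed
  moreover have "s z \<noteq> 0" using z(3) by (simp add: s_def)
  ultimately show ?thesis
    using p[OF zW] by (intro bochner_algebra[OF z(2) _ \<alpha>_def]) (simp_all add: q_def)
qed

lemma W_empty: "W = {}"
proof (rule ccontr)
  assume "W \<noteq> {}"
  then obtain z where zW: "z \<in> W" by auto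
  then have z: "z \<in> \<Omega>" "k z \<noteq> 0" "\<tau> z \<noteq> 0" by (auto simp: W_def)
  have "tderiv (\<tau> z) s z = tderiv (\<tau> z) (\<lambda>w. 7/2 * k w ^ Suc 3) z"
    by (rule tderiv_cong_open[OF open_W zW s_diff[OF z(1)]]) (simp add: s_eq)
  then have "2 * \<alpha> z * s z = 14 * k z ^ 3 * s z"
    unfolding tderiv_s[OF zW] tderiv_k_power[OF z(1)] by (simp add: s_def)
  then have "\<alpha> z = 7 * k z ^ 3" using z(3) by (simp add: s_def)
  \<comment> \<open>Inserting s = (7/2) k^4 into the definition of \<open>\<alpha>\<close> gives the
    coefficient 21/8 + 5/2.\<close>
  moreover have "\<alpha> z = 41/8 * k z ^ 3"
    using z(2) by (simp add: \<alpha>_def s_eq[OF zW] eval_nat_numeral field_simps)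
  ultimately show False using z(2) by simp
qed

lemma k_zero:
  assumes z: "z \<in> \<Omega>"
  shows "k z = 0"
proof (rule ccontr)
  assume k0: "k z \<noteq> 0"
  \<comment> \<open>On this open neighbourhood of \<open>z\<close> the gradient vanishes
    identically, so its derivative at \<open>z\<close> vanishes too.\<close>
  define U where "U = {z \<in> \<Omega>. k z \<noteq> 0}"
  have U: "open U" "z \<in> U" using open_nonzero[OF smooth_k] z k0 by (auto simp: U_def)
  have t0: "\<tau> w = 0" if "w \<in> U" for w
    using W_empty that by (auto simp: U_def W_def)
  have "tderiv y (\<lambda>_. 0) z = tderiv y \<tau> z" for y
    by (rule tderiv_cong_open[OF U]) (simp_all add: t0)
  then have "tr (\<lambda>b. tderiv b \<tau> z) = 0" by (simp add: tderiv_const tr_def)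
  then have "normsq_A z = 0" using biharmonic_split(2)[OF z] k0 by simp
  then have "A z *v y = 0" for y
    by (intro tr_square_eq_0[of "\<lambda>v. A z *v v"]) (simp_all add: normsq_A_tr A_sym[OF z])
  then have "k z = 0" by (simp add: k_def trace_tr tr_def)
  with k0 show False by simp
qed

end

section \<open>Passage from coordinate patches to the manifold\<close>

theorem theorem3p1:
  fixes M :: "'a topology"
    and \<A> :: "('a, 'n::finite) chart set"
    and g :: "('a, 'n) chart \<Rightarrow> 'a \<Rightarrow> real^'n^'n"
    and x :: "'a \<Rightarrow> real^'m::finite"
  assumes "smooth_manifold M \<A>"
    and "riemannian_metric \<A> g"
    and "CARD('m) = CARD('n) + 1"
    and "isometric_immersion \<A> g x"
    and "biharmonic_hypersurface M \<A> g x"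
    and "recurrent_ricci_operator \<A> g"
  shows "minimal_hypersurface M \<A> x"
  unfolding minimal_hypersurface_def
proof (intro allI impI ballI)
  fix V N c p
  assume N: "local_unit_normal M \<A> x V N" and c: "c \<in> \<A>" and p: "p \<in> V \<inter> chart_dom c"
  \<comment> \<open>The part of the chart image over which the given normal field is
    defined.\<close>
  define \<Omega> where "\<Omega> = coords c ` (V \<inter> chart_dom c)"
  have chart: "is_chart M c" using assms(1) c by (simp add: smooth_manifold_def)
  have V: "openin M V" using N by (simp add: local_unit_normal_def)
  have inj: "inj_on (coords c) (chart_dom c)"
    using chart homeomorphic_imp_injective_map openin_subset unfolding is_chart_def
    by (metis inf.absorb2 topspace_subtopology)
  have "openin (subtopology M (chart_dom c)) (V \<inter> chart_dom c)"
    using V by (metis openin_subtopology)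
  then have "openin (top_of_set (chart_img c)) \<Omega>"
    using chart homeomorphic_imp_open_map unfolding \<Omega>_def is_chart_def open_map_def by blast
  then have op: "open \<Omega>" using chart openin_open_eq unfolding is_chart_def by blast
  have pt: "in_chart c h (coords c q) = h q" if "q \<in> chart_dom c" for h :: "'a \<Rightarrow> 'b" and q
    using that inj by (simp add: in_chart_def chart_point_def)
  have \<Omega>: "\<exists>q. q \<in> V \<inter> chart_dom c \<and> z = coords c q" if "z \<in> \<Omega>" for z
    using that by (auto simp: \<Omega>_def)
  obtain \<eta> where \<eta>: "\<And>X Y q. smooth_on X (chart_img c) \<Longrightarrow> smooth_on Y (chart_img c) \<Longrightarrow> q \<in> chart_dom c \<Longrightarrow>
      cov_deriv_endo (in_chart c (g c)) (ricci_op (in_chart c (g c))) X Y (coords c q) =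
      (\<eta> c q \<bullet> X (coords c q)) *\<^sub>R (ricci_op (in_chart c (g c)) (coords c q) *v Y (coords c q))"
    using assms(6) c unfolding recurrent_ricci_operator_def Let_def by metis
  interpret biharmonic_patch \<Omega> "in_chart c x" "in_chart c N" "in_chart c (g c)"
  proof unfold_locales
    show "open \<Omega>" by (rule op)
    show "CARD('m) = CARD('n) + 1" by (rule assms(3))
    show "smooth_on (in_chart c x) \<Omega>"
      using assms(4) c by (intro smooth_subset[of \<Omega> "chart_img c"]) (auto simp: isometric_immersion_def \<Omega>_def)
    show "smooth_on (in_chart c N) \<Omega>"
      using N c by (simp add: local_unit_normal_def \<Omega>_def)
  next
    fix z assume "z \<in> \<Omega>"
    then obtain q where q: "q \<in> V" "q \<in> chart_dom c" and z: "z = coords c q" using \<Omega> by blast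
    show "inj (D (in_chart c x) z)"
      using assms(4) c q by (simp add: isometric_immersion_def z)
    have "norm (N q) = 1" using N q by (simp add: local_unit_normal_def)
    then show "in_chart c N z \<bullet> in_chart c N z = 1"
      by (simp add: z pt q dot_square_norm)
    show "D (in_chart c x) z u \<bullet> in_chart c N z = 0" for u
      using N c q by (simp add: local_unit_normal_def z pt)
    show "D (in_chart c x) z u \<bullet> D (in_chart c x) z v = u \<bullet> (in_chart c (g c) z *v v)" for u v
      using assms(4) c q by (simp add: isometric_immersion_def z pt)
    show "laplacian (in_chart c (g c)) (mean_curvature_vector (in_chart c x) (in_chart c N)) z = 0"
      using assms(5) N c q unfolding biharmonic_hypersurface_def z by blast
    \<comment> \<open>Constant coordinate fields are smooth on the chart image, and the covector at
      this point is \<open>\<eta> c q\<close>.\<close>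
    have "cov_deriv_endo (in_chart c (g c)) (ricci_op (in_chart c (g c))) (\<lambda>_. u) (\<lambda>_. v) z =
        (\<eta> c q \<bullet> u) *\<^sub>R (ricci_op (in_chart c (g c)) z *v v)" for u v
      using \<eta>[OF smooth_const smooth_const q(2), of u v] by (simp add: z)
    then show "\<exists>e. \<forall>u v. cov_deriv_endo (in_chart c (g c)) (ricci_op (in_chart c (g c))) (\<lambda>_. u) (\<lambda>_. v) z =
        (e \<bullet> u) *\<^sub>R (ricci_op (in_chart c (g c)) z *v v)" by blast
  qed
  have "coords c p \<in> \<Omega>" using p by (simp add: \<Omega>_def)
  then show "mean_curvature (in_chart c x) (in_chart c N) (coords c p) = 0"
    using k_zero by (simp add: mean_curvature_eq k_def)
qed

end
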